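(* Let $D\subset\mathbb C^n$, $n\ge2$, be a bounded, strongly pseudoconvex domain of class $C^2$. For any $1\le p<\infty$ and any $A_p$-measure $\Omega_p$ on $bD$ with density $\psi_p$ (i.e. $\Omega_p=\psi_p\sigma$), there is $p_0=p_0(\Omega_p)\in(1,p)$ such that $$H^p(bD,\Omega_p)\subset H^{p_0}(bD,\sigma)\quad\text{with}\quad \|F\|_{H^{p_0}(bD,\sigma)}\le C_{\Omega_p,D}\,\|F\|_{H^p(bD,\Omega_p)},$$ where $$C_{\Omega_p,D}=\bigg(\int_{bD}\psi_p(w)^{-\frac{p_0}{p-p_0}}\,d\sigma(w)\bigg)^{\frac{p-p_0}{p\,p_0}}.$$
   Context: Domain. $D=\{\rho<0\}$, $bD=\{\rho=0\}$, where $\rho\in C^2(\mathbb C^n,\mathbb R)$ is strictly plurisubharmonic with $\nabla\rho\ne0$ on $bD$; $\rho$ is fixed once and for all. $\sigma$ is the induced Lebesgue (surface) measure on $bD$. Quasi-distance. Write $\langle\eta,\zeta\rangle=\sum_j\eta_j\zeta_j$ and $$\mathcal L_0(w,z)=\langle\partial\rho(w),w-z\rangle-\tfrac12\sum_{j,k}\frac{\partial^2\rho(w)}{\partial w_j\partial w_k}(w_j-z_j)(w_k-z_k),\quad g_0(w,z)=\chi\mathcal L_0(w,z)+(1-\chi)|w-z|^2,$$ where $\chi=\chi(w,z)$ is a $C^\infty$ cutoff with $\chi=1$ for $|w-z|\le\mu/2$ and $\chi=0$ for $|w-z|\ge\mu$, and $\mu>0$ is fixed so small that $\operatorname{Re}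 g_0(w,z)\ge c(-\rho(z)+|w-z|^2)$ for $w\in bD$, $z\in\overline D$, for some $c>0$. Then ${\tt d}(w,z)=|g_0(w,z)|^{1/2}$ is a quasi-distance on $bD$, with balls $B_r(w)=\{z\in bD:{\tt d}(z,w)<r\}$; $\sigma$ is doubling with respect to these balls. $A_p$-measures. For $1<p<\infty$, $p'=p/(p-1)$, an $A_p$-weight is a non-negative locally integrable function $\psi$ on $bD$ with $[\psi]_{A_p}=\sup_B\langle\psi\rangle_B\langle\psi^{1-p'}\rangle_B^{p-1}<\infty$, the supremum being over all balls $B$ of ${\tt d}$ and $\langle\phi\rangle_B=\sigma(B)^{-1}\int_B\phi\,d\sigma$. An $A_1$-weight is such a $\psi$ with $[\psi]_{A_1}=\inf\{C\ge0:\langle\psi\rangle_B\le C\psi(x)\ \text{for all } x\in B\text{ and all balls }B\}<\infty$. An $A_p$-measure is $\Omega_p=\psi_p\sigma$ with $\psi_p$ an $A_p$-weight ($\sigma$ itself is one, for every $p$). Hardy space. For $1\le p<\infty$ and an $A_p$-measure $\Omega_p$, $H^p(bD,\Omega_p)$ is the space of $F$ holomorphic in $D$ with $\mathcal N(F)\in L^p(bD,\Omega_p)$, with $\|F\|_{H^p(bD,\Omega_p)}=\|\mathcal N(F)\|_{L^p(bD,\Omega_p)}$, where $\mathcal N(F)(\xi)=\sup_{z\in\Gamma_\alpha(\xi)}|F(z)|$, $\xi\in bD$, and $\Gamma_\alpha(\xi)=\{z\in D: |(z-\xi)\cdot\bar\nu_\xi|<(1+\alpha)\delta_\xi(z),\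 |z-\xi|^2<\alpha\delta_\xi(z)\}$ ($\alpha>0$ fixed, $\bar\nu_\xi$ the complex conjugate of the outer unit normal at $\xi$, $\delta_\xi(z)$ the minimum of the Euclidean distance of $z$ to $bD$ and the distance of $z$ to the tangent space at $\xi$).
   Formalization: The formal theorem is stated for 1 < p < ∞ rather than 1 ≤ p < ∞: at p = 1 the interval (1,p) is empty, so no p_0 exists although σ is an A_1-measure, and the claim as printed fails there. *)

theory Defs
  imports "HOL-Analysis.Analysis"
begin

section \<open>Differentiability classes and complex derivatives\<close>

text \<open>In finite dimension this is the usual class \<open>C\<^sup>k\<close>: differentiability forces continuity at
  every level, and the derivative is continuous iff all directional derivatives are.\<close>

fun Ck :: "nat \<Rightarrow> ('a::euclidean_space \<Rightarrow> 'b::real_normed_vector) \<Rightarrow> bool" where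
  "Ck 0 f \<longleftrightarrow> continuous_on UNIV f"
| "Ck (Suc k) f \<longleftrightarrow> (\<forall>x. f differentiable (at x)) \<and>
     (\<forall>v. Ck k (\<lambda>x. frechet_derivative f (at x) v))"

text \<open>The Wirtinger derivatives with respect to \<open>w\<^sub>j\<close> and to its conjugate.\<close>

definition wirt :: "'n::finite \<Rightarrow> (complex^'n \<Rightarrow> complex) \<Rightarrow> complex^'n \<Rightarrow> complex" where
  "wirt j f w = (frechet_derivative f (at w) (axis j 1)
                 - \<i> * frechet_derivative f (at w) (axis j \<i>)) / 2"

definition wirt_bar :: "'n::finite \<Rightarrow> (complex^'n \<Rightarrow> complex) \<Rightarrow> complex^'n \<Rightarrow> complex" where
  "wirt_bar j f w = (frechet_derivative f (at w) (axis j 1)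
                     + \<i> * frechet_derivative f (at w) (axis j \<i>)) / 2"

abbreviation cplx :: "('a \<Rightarrow> real) \<Rightarrow> 'a \<Rightarrow> complex" where
  "cplx \<rho> \<equiv> (\<lambda>w. complex_of_real (\<rho> w))"

text \<open>The Levi form is real for \<open>\<rho>\<close> of class \<open>C\<^sup>2\<close>; \<open>Re\<close> only changes the type.\<close>

definition strictly_plurisubharmonic :: "(complex^'n::finite \<Rightarrow> real) \<Rightarrow> bool" where
  "strictly_plurisubharmonic \<rho> \<longleftrightarrow> (\<forall>w v. v \<noteq> 0 \<longrightarrow>
     0 < Re (\<Sum>j\<in>UNIV. \<Sum>k\<in>UNIV. wirt j (wirt_bar k (cplx \<rho>)) w * v $ j * cnj (v $ k)))"

text \<open>The real gradient, with the real vector \<open>(\<partial>/\<partial>x\<^sub>j, \<partial>/\<partial>y\<^sub>j)\<close> read as a complex vector.\<close>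

definition grad :: "(complex^'n::finite \<Rightarrow> real) \<Rightarrow> complex^'n \<Rightarrow> complex^'n" where
  "grad \<rho> w = (\<chi> j. Complex (frechet_derivative \<rho> (at w) (axis j 1))
                            (frechet_derivative \<rho> (at w) (axis j \<i>)))"

definition holomorphic_in :: "(complex^'n::finite \<Rightarrow> complex) \<Rightarrow> (complex^'n) set \<Rightarrow> bool" where
  "holomorphic_in F D \<longleftrightarrow> (\<forall>z\<in>D. \<exists>F'. (F has_derivative F') (at z) \<and>
     (\<forall>c v. F' (c *s v) = c * F' v))"


section \<open>The domain and its surface measure\<close>

definition Dom :: "(complex^'n::finite \<Rightarrow> real) \<Rightarrow> (complex^'n) set" where
  "Dom \<rho> = {z. \<rho> z < 0}"

definition bDom :: "(complex^'n::finite \<Rightarrow> real) \<Rightarrow> (complex^'n) set" where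
  "bDom \<rho> = {z. \<rho> z = 0}"

text \<open>Hausdorff measure of dimension \<open>m \<ge> 1\<close>, normalised to agree with Lebesgue measure on
  \<open>m\<close>-dimensional subspaces.  On a \<open>C\<^sup>1\<close> hypersurface of real codimension one it is the induced
  Lebesgue measure.\<close>

definition hausdorff_pre :: "nat \<Rightarrow> real \<Rightarrow> 'a::euclidean_space set \<Rightarrow> ennreal" where
  "hausdorff_pre m \<delta> A =
     (INF E\<in>{E :: nat \<Rightarrow> 'a set. A \<subseteq> (\<Union>i. E i) \<and> (\<forall>i. bounded (E i) \<and> diameter (E i) \<le> \<delta>)}.
        \<Sum>i. ennreal (unit_ball_vol (real m) * (diameter (E i) / 2) ^ m))"

definition hausdorff_outer :: "nat \<Rightarrow> 'a::euclidean_space set \<Rightarrow> ennreal" where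
  "hausdorff_outer m A = (SUP \<delta>\<in>{0<..}. hausdorff_pre m \<delta> A)"

definition hausdorff_measure :: "nat \<Rightarrow> 'a::euclidean_space measure" where
  "hausdorff_measure m = measure_of UNIV (sets borel) (hausdorff_outer m)"

text \<open>Completed, so that measurable functions are the Lebesgue measurable ones.\<close>

definition surface_measure :: "(complex^'n::finite) set \<Rightarrow> (complex^'n) measure" where
  "surface_measure S = completion (restrict_space (hausdorff_measure (2 * CARD('n) - 1)) S)"

abbreviation \<sigma>_of :: "(complex^'n::finite \<Rightarrow> real) \<Rightarrow> (complex^'n) measure" where
  "\<sigma>_of \<rho> \<equiv> surface_measure (bDom \<rho>)"


section \<open>The quasi-distance\<close>

definition L0 :: "(complex^'n::finite \<Rightarrow> real) \<Rightarrow> complex^'n \<Rightarrow> complex^'n \<Rightarrow> complex" where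
  "L0 \<rho> w z = (\<Sum>j\<in>UNIV. wirt j (cplx \<rho>) w * (w $ j - z $ j))
     - 1/2 * (\<Sum>j\<in>UNIV. \<Sum>k\<in>UNIV.
                wirt j (wirt k (cplx \<rho>)) w * (w $ j - z $ j) * (w $ k - z $ k))"

definition g0 :: "(complex^'n::finite \<Rightarrow> real) \<Rightarrow> (complex^'n \<Rightarrow> complex^'n \<Rightarrow> real) \<Rightarrow>
    complex^'n \<Rightarrow> complex^'n \<Rightarrow> complex" where
  "g0 \<rho> \<kappa> w z = of_real (\<kappa> w z) * L0 \<rho> w z + of_real ((1 - \<kappa> w z) * (norm (w - z))\<^sup>2)"

definition cutoff :: "real \<Rightarrow> (complex^'n::finite \<Rightarrow> complex^'n \<Rightarrow> real) \<Rightarrow> bool" where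
  "cutoff \<mu> \<kappa> \<longleftrightarrow> (\<forall>k. Ck k (\<lambda>(w, z). \<kappa> w z)) \<and>
     (\<forall>w z. 0 \<le> \<kappa> w z \<and> \<kappa> w z \<le> 1 \<and>
        (norm (w - z) \<le> \<mu> / 2 \<longrightarrow> \<kappa> w z = 1) \<and> (\<mu> \<le> norm (w - z) \<longrightarrow> \<kappa> w z = 0))"

definition qdist :: "(complex^'n::finite \<Rightarrow> real) \<Rightarrow> (complex^'n \<Rightarrow> complex^'n \<Rightarrow> real) \<Rightarrow>
    complex^'n \<Rightarrow> complex^'n \<Rightarrow> real" where
  "qdist \<rho> \<kappa> w z = sqrt (norm (g0 \<rho> \<kappa> w z))"

definition qball :: "(complex^'n::finite \<Rightarrow> real) \<Rightarrow> (complex^'n \<Rightarrow> complex^'n \<Rightarrow> real) \<Rightarrow>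
    complex^'n \<Rightarrow> real \<Rightarrow> (complex^'n) set" where
  "qball \<rho> \<kappa> w r = {z \<in> bDom \<rho>. qdist \<rho> \<kappa> z w < r}"


section \<open>\<open>A\<^sub>p\<close>-weights\<close>

text \<open>Powers in \<open>[0, \<infinity>]\<close>.  Real \<open>powr\<close> has \<open>0 powr a = 0\<close> for every \<open>a\<close>; here \<open>0\<close> to a negative
  power is \<open>\<infinity>\<close>, as needed for negative powers of weights that may vanish.\<close>

definition epowr :: "ennreal \<Rightarrow> real \<Rightarrow> ennreal" where
  "epowr x a = (if a = 0 then 1
                else if x = 0 then (if a < 0 then \<infinity> else 0)
                else if x = \<infinity> then (if a < 0 then 0 else \<infinity>)
                else ennreal (enn2real x powr a))"

definition average :: "'a measure \<Rightarrow> 'a set \<Rightarrow> ('a \<Rightarrow> ennreal) \<Rightarrow> ennreal" where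
  "average M B \<phi> = (\<integral>\<^sup>+x\<in>B. \<phi> x \<partial>M) / emeasure M B"

text \<open>For \<open>1 < p\<close>, with \<open>p' = p/(p - 1)\<close>.\<close>

definition Ap_char :: "(complex^'n::finite \<Rightarrow> real) \<Rightarrow> (complex^'n \<Rightarrow> complex^'n \<Rightarrow> real) \<Rightarrow>
    real \<Rightarrow> (complex^'n \<Rightarrow> real) \<Rightarrow> ennreal" where
  "Ap_char \<rho> \<kappa> p \<psi> =
     (SUP (w, r) \<in> bDom \<rho> \<times> {0<..}.
        average (\<sigma>_of \<rho>) (qball \<rho> \<kappa> w r) (\<lambda>x. ennreal (\<psi> x)) *
        epowr (average (\<sigma>_of \<rho>) (qball \<rho> \<kappa> w r)
                 (\<lambda>x. epowr (ennreal (\<psi> x)) (1 - p / (p - 1)))) (p - 1))"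

text \<open>Since \<open>0 * \<infinity> = 0\<close> in \<^typ>\<open>ennreal\<close>, the finiteness of the dual averages is required
  separately.  This only excludes weights vanishing almost everywhere: for all others
  it follows from \<open>Ap_char < \<infinity>\<close>, because \<open>bD\<close> is itself a ball.\<close>

definition Ap_weight :: "(complex^'n::finite \<Rightarrow> real) \<Rightarrow> (complex^'n \<Rightarrow> complex^'n \<Rightarrow> real) \<Rightarrow>
    real \<Rightarrow> (complex^'n \<Rightarrow> real) \<Rightarrow> bool" where
  "Ap_weight \<rho> \<kappa> p \<psi> \<longleftrightarrow>
     (\<forall>x\<in>bDom \<rho>. 0 \<le> \<psi> x) \<and>
     \<psi> \<in> borel_measurable (\<sigma>_of \<rho>) \<and>
     (\<forall>K. compact K \<and> K \<subseteq> bDom \<rho> \<longrightarrow> set_integrable (\<sigma>_of \<rho>) K \<psi>) \<and>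
     (\<forall>w\<in>bDom \<rho>. \<forall>r>0. average (\<sigma>_of \<rho>) (qball \<rho> \<kappa> w r)
        (\<lambda>x. epowr (ennreal (\<psi> x)) (1 - p / (p - 1))) < \<infinity>) \<and>
     Ap_char \<rho> \<kappa> p \<psi> < \<infinity>"

definition Ap_measure_with_density :: "(complex^'n::finite \<Rightarrow> real) \<Rightarrow>
    (complex^'n \<Rightarrow> complex^'n \<Rightarrow> real) \<Rightarrow> real \<Rightarrow> (complex^'n) measure \<Rightarrow>
    (complex^'n \<Rightarrow> real) \<Rightarrow> bool" where
  "Ap_measure_with_density \<rho> \<kappa> p \<Omega> \<psi> \<longleftrightarrow>
     Ap_weight \<rho> \<kappa> p \<psi> \<and> \<Omega> = density (\<sigma>_of \<rho>) (\<lambda>x. ennreal (\<psi> x))"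


section \<open>Hardy spaces\<close>

definition outer_normal :: "(complex^'n::finite \<Rightarrow> real) \<Rightarrow> complex^'n \<Rightarrow> complex^'n" where
  "outer_normal \<rho> \<xi> = sgn (grad \<rho> \<xi>)"

text \<open>The inner product here is the real one on \<open>\<complex>\<^sup>n = \<real>\<^sup>2\<^sup>n\<close>.\<close>

definition tangent_space :: "(complex^'n::finite \<Rightarrow> real) \<Rightarrow> complex^'n \<Rightarrow> (complex^'n) set" where
  "tangent_space \<rho> \<xi> = {\<zeta>. (\<zeta> - \<xi>) \<bullet> outer_normal \<rho> \<xi> = 0}"

definition delta :: "(complex^'n::finite \<Rightarrow> real) \<Rightarrow> complex^'n \<Rightarrow> complex^'n \<Rightarrow> real" where
  "delta \<rho> \<xi> z = min (infdist z (bDom \<rho>)) (infdist z (tangent_space \<rho> \<xi>))"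

definition approach_region :: "(complex^'n::finite \<Rightarrow> real) \<Rightarrow> real \<Rightarrow> complex^'n \<Rightarrow>
    (complex^'n) set" where
  "approach_region \<rho> \<alpha> \<xi> = {z \<in> Dom \<rho>.
     norm (\<Sum>j\<in>UNIV. (z $ j - \<xi> $ j) * cnj (outer_normal \<rho> \<xi> $ j)) < (1 + \<alpha>) * delta \<rho> \<xi> z \<and>
     (norm (z - \<xi>))\<^sup>2 < \<alpha> * delta \<rho> \<xi> z}"

definition nontangential_max :: "(complex^'n::finite \<Rightarrow> real) \<Rightarrow> real \<Rightarrow>
    (complex^'n \<Rightarrow> complex) \<Rightarrow> complex^'n \<Rightarrow> ennreal" where
  "nontangential_max \<rho> \<alpha> F \<xi> = (SUP z\<in>approach_region \<rho> \<alpha> \<xi>. ennreal (norm (F z)))"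

definition Lp_norm :: "'a measure \<Rightarrow> real \<Rightarrow> ('a \<Rightarrow> ennreal) \<Rightarrow> ennreal" where
  "Lp_norm M p f = epowr (\<integral>\<^sup>+x. epowr (f x) p \<partial>M) (1 / p)"

definition hardy_norm :: "(complex^'n::finite \<Rightarrow> real) \<Rightarrow> real \<Rightarrow> real \<Rightarrow> (complex^'n) measure \<Rightarrow>
    (complex^'n \<Rightarrow> complex) \<Rightarrow> ennreal" where
  "hardy_norm \<rho> \<alpha> p \<Omega> F = Lp_norm \<Omega> p (nontangential_max \<rho> \<alpha> F)"

definition hardy_space :: "(complex^'n::finite \<Rightarrow> real) \<Rightarrow> real \<Rightarrow> real \<Rightarrow> (complex^'n) measure \<Rightarrow>
    (complex^'n \<Rightarrow> complex) set" where
  "hardy_space \<rho> \<alpha> p \<Omega> = {F. holomorphic_in F (Dom \<rho>) \<and>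
     nontangential_max \<rho> \<alpha> F \<in> borel_measurable \<Omega> \<and> hardy_norm \<rho> \<alpha> p \<Omega> F < \<infinity>}"

definition embedding_const :: "(complex^'n::finite \<Rightarrow> real) \<Rightarrow> real \<Rightarrow> real \<Rightarrow>
    (complex^'n \<Rightarrow> real) \<Rightarrow> ennreal" where
  "embedding_const \<rho> p p0 \<psi> =
     epowr (\<integral>\<^sup>+w. epowr (ennreal (\<psi> w)) (- (p0 / (p - p0))) \<partial>(\<sigma>_of \<rho>)) ((p - p0) / (p * p0))"

end

theory Submission
  imports Defs
begin

text \<open>Hoelder's inequality reduces the embedding to the integrability of a power
  \<open>w\<^sup>1\<^sup>+\<^sup>\<epsilon>\<close> of the dual weight \<open>w = \<psi>\<^sup>1\<^sup>-\<^sup>p\<^sup>'\<close>, with \<open>\<epsilon> > 0\<close>.  This is the self-improvement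
  of the \<open>A\<^sub>p\<close> condition: for large \<open>\<lambda>\<close> one stops at the largest balls on which the average of
  \<open>w\<close> exceeds \<open>\<lambda>\<close>; by the \<open>A\<^sub>p\<close> condition \<open>w\<close> is comparable with or larger than \<open>\<lambda>\<close> on half
  of each of them, so that a Vitali covering gives
  \<open>\<integral>\<^bsub>{w > \<lambda>}\<^esub> w d\<sigma> \<le> \<lambda> \<sigma>{w > b \<lambda>}\<close>, and hence geometric decay of the left-hand side along
  \<open>\<lambda> = b\<^sup>-\<^sup>k\<close>.

  The balls are engulfing and doubling because \<open>|g\<^sub>0(w, z)|\<close> is comparable on \<open>bD\<close> with
  \<open>|\<langle>\<partial>\<rho>(w), w - z\<rangle>| + |w - z|\<^sup>2\<close>.\<close>

section \<open>Gehring-type self-improvement from level sets\<close>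

text \<open>Integrability of \<open>w\<close> alone would only give \<open>p0 = 1\<close>: Hoelder's
  inequality demands the power \<open>p0 / (p - p0)\<close> of \<open>1 / \<psi>\<close>, which at
  \<open>p0 = 1\<close> is \<open>1 / (p - 1) = p' - 1\<close>. Any gain \<epsilon> > 0, however
  small, moves \<open>p0\<close> above 1, so constants may be as bad as they like. Radii are
  discretised as \<open>r0 * q ^ j\<close>, with \<open>q\<close> so small that one step of the
  index absorbs all engulfing constants. Stopping at a largest ball then means taking a least index,
  and the Vitali enlargement of a ball is its predecessor. The model for \<open>g0\<close> is
  available only near the diagonal, where the cutoff is 1, so \<open>r0\<close> has to be small. At
  the top scale the averages of \<open>w\<close> are therefore controlled by taking \<lambda> large,
  which needs a lower bound for the measure of the top balls. Compactness and doubling provide it in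
  the form "null or at least \<open>m\<close>", so that no measure of a ball has to be computed or
  shown to be positive.\<close>

lemma geometric_decay_of_tail_bound:
  fixes F :: "nat \<Rightarrow> real"
  assumes F: "\<And>k. 0 \<le> F k" and D: "0 < D"
    and tail: "\<And>k n. (\<Sum>j<n. F (Suc k + j)) \<le> D * F k"
  shows "\<exists>R\<ge>0. \<forall>k. F k \<le> R * (D / (1 + D)) ^ k"
proof -
  have summ: "summable (\<lambda>j. F (Suc k + j))" for k
    using tail F by (intro bounded_imp_summable[where B="D * F k"])
      (auto simp: lessThan_Suc_atMost[symmetric] simp del: sum.lessThan_Suc)
  then have summ': "summable (\<lambda>j. F (k + j))" for k
    using summable_Suc_iff[of "\<lambda>j. F (k + j)"] by simp
  define R where "R = (\<lambda>k. \<Sum>j. F (k + j))"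
  have R_Suc: "R k = F k + R (Suc k)" for k
    using suminf_split_head[OF summ'[of k]] by (simp add: R_def)
  have R_nonneg: "0 \<le> R k" for k unfolding R_def by (intro suminf_nonneg summ' F)
  have "R (Suc k) \<le> D * F k" for k
    unfolding R_def using tail[where k=k] summ'[of "Suc k"] by (intro suminf_le_const) auto
  \<comment> \<open>Hole filling: since \<open>F k = R k - R (Suc k)\<close>, adding
    \<open>D * R (Suc k)\<close> to both sides yields a factor below 1 without any smallness of
    \<open>D\<close>.\<close>
  then have step: "R (Suc k) \<le> D / (1 + D) * R k" for k
    using R_Suc[of k] D by (simp add: field_simps)
  have "R k \<le> R 0 * (D / (1 + D)) ^ k" for k
  proof (induction k)
    case (Suc k)
    have "R (Suc k) \<le> D / (1 + D) * R k" by (rule step)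
    also have "\<dots> \<le> D / (1 + D) * (R 0 * (D / (1 + D)) ^ k)"
      using Suc D by (intro mult_left_mono) auto
    finally show ?case by (simp add: mult.assoc mult.left_commute)
  qed auto
  moreover have "F k \<le> R k" for k using R_Suc[of k] R_nonneg[of "Suc k"] by simp
  ultimately show ?thesis using R_nonneg by (meson order_trans)
qed

text \<open>A geometric sum is dominated by its last term, and the last level counted lies below
  \<open>v\<close>. If the top level is below \<open>v\<close>, all indicators may be replaced by 1;
  otherwise the new term vanishes.\<close>

lemma sum_levels_below_le:
  fixes t v l0 :: real
  assumes t: "1 < t" and l0: "0 < l0" and v: "0 \<le> v"
  shows "(\<Sum>j<n. l0 * t ^ Suc j * (if l0 * t ^ j < v then 1 else 0)) \<le> t\<^sup>2 / (t - 1) * v"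
proof (induction n)
  case 0
  then show ?case using t v by simp
next
  case (Suc n)
  show ?case
  proof (cases "l0 * t ^ n < v")
    case True
    have "(\<Sum>j<Suc n. l0 * t ^ Suc j * (if l0 * t ^ j < v then 1 else 0)) \<le> (\<Sum>j<Suc n. l0 * t * t ^ j)"
      using t l0 by (intro sum_mono) auto
    also have "\<dots> = l0 * t * ((t ^ Suc n - 1) / (t - 1))"
      using t by (simp add: sum_distrib_left[symmetric] geometric_sum del: sum.lessThan_Suc)
    also have "\<dots> \<le> l0 * t * (t ^ Suc n / (t - 1))"
      using t l0 by (intro mult_left_mono divide_right_mono) auto
    also have "\<dots> = t\<^sup>2 / (t - 1) * (l0 * t ^ n)" by (simp add: power2_eq_square)
    also have "\<dots> \<le> t\<^sup>2 / (t - 1) * v" using True t by (intro mult_left_mono) auto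
    finally show ?thesis .
  next
    case False
    then show ?thesis using Suc by simp
  qed
qed

lemma epowr_ennreal: "0 < x \<Longrightarrow> epowr (ennreal x) a = ennreal (x powr a)"
  by (simp add: epowr_def)

lemma epowr_measurable [measurable]: "(\<lambda>x. epowr x a) \<in> borel_measurable borel"
  unfolding epowr_def by measurable

lemma higher_integrability:
  fixes w :: "'a \<Rightarrow> ennreal"
  assumes w [measurable]: "w \<in> borel_measurable M" and w_fin: "(\<integral>\<^sup>+x. w x \<partial>M) < \<infinity>"
    and b: "0 < b" "b < 1" and l0: "0 < l0"
    and level: "\<And>l. l0 \<le> l \<Longrightarrow> (\<integral>\<^sup>+x\<in>{x \<in> space M. ennreal l < w x}. w x \<partial>M) \<le>
        ennreal l * emeasure M {x \<in> space M. ennreal (b * l) < w x}"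
  shows "\<exists>\<epsilon>>0. (\<integral>\<^sup>+x. epowr (w x) (1 + \<epsilon>) \<partial>M) < \<infinity>"
proof -
  \<comment> \<open>With ratio \<open>1 / b\<close> the two thresholds in \<open>level\<close>
    become consecutive levels.\<close>
  define t where "t = 1 / b"
  have t: "1 < t" using b by (simp add: t_def)
  define \<Lambda> where "\<Lambda> = (\<lambda>k. l0 * t ^ k)"
  have \<Lambda>_pos: "0 < \<Lambda> k" for k using l0 t by (simp add: \<Lambda>_def)
  have \<Lambda>_mono: "\<Lambda> i \<le> \<Lambda> j" if "i \<le> j" for i j
    using that l0 t by (simp add: \<Lambda>_def power_increasing)
  define W where "W = (\<lambda>k. {x \<in> space M. ennreal (\<Lambda> k) < w x})"
  have [measurable]: "W k \<in> sets M" for k by (simp add: W_def)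
  define f where "f = (\<lambda>k. \<integral>\<^sup>+x\<in>W k. w x \<partial>M)"
  define D where "D = t\<^sup>2 / (t - 1)"
  have D: "0 < D" using t by (simp add: D_def)
  have w_ae: "AE x in M. w x \<noteq> \<infinity>"
    using w_fin by (intro nn_integral_noteq_infinite) auto
  have f_le: "f k \<le> (\<integral>\<^sup>+x. w x \<partial>M)" for k
    unfolding f_def by (intro nn_integral_mono) (auto simp: indicator_def)
  have f_fin: "f k \<noteq> \<infinity>" for k using f_le[of k] w_fin by (auto simp: top_unique)
  have f_step: "f (Suc k) \<le> ennreal (\<Lambda> (Suc k)) * emeasure M (W k)" for k
  proof -
    have "l0 \<le> \<Lambda> (Suc k)" using \<Lambda>_mono[of 0 "Suc k"] by (simp add: \<Lambda>_def)
    moreover have "b * \<Lambda> (Suc k) = \<Lambda> k" using b by (simp add: \<Lambda>_def t_def)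
    ultimately show ?thesis using level[of "\<Lambda> (Suc k)"] by (simp add: f_def W_def)
  qed
  \<comment> \<open>The measures of the sets \<open>W (k + j)\<close>, weighted by the levels, sum
    back to an integral of \<open>w\<close> over \<open>W k\<close>. This closes the chain of level
    inequalities into a tail bound.\<close>
  have f_tail: "(\<Sum>j<n. f (Suc k + j)) \<le> ennreal D * f k" for k n
  proof -
    have "(\<Sum>j<n. f (Suc k + j)) \<le> (\<Sum>j<n. \<integral>\<^sup>+x. ennreal (\<Lambda> (Suc (k + j))) * indicator (W (k + j)) x \<partial>M)"
      using f_step[of "k + _"] by (intro sum_mono) (simp add: nn_integral_cmult_indicator)
    also have "\<dots> = (\<integral>\<^sup>+x. (\<Sum>j<n. ennreal (\<Lambda> (Suc (k + j))) * indicator (W (k + j)) x) \<partial>M)"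
      by (subst nn_integral_sum) auto
    also have "\<dots> \<le> (\<integral>\<^sup>+x. ennreal D * (w x * indicator (W k) x) \<partial>M)"
    proof (rule nn_integral_mono_AE, rule AE_mp[OF w_ae], intro AE_I2 impI)
      fix x assume wx: "w x \<noteq> \<infinity>"
      then obtain v where v: "w x = ennreal v" "0 \<le> v" by (cases "w x") auto
      show "(\<Sum>j<n. ennreal (\<Lambda> (Suc (k + j))) * indicator (W (k + j)) x)
          \<le> ennreal D * (w x * indicator (W k) x)"
      proof (cases "x \<in> W k")
        case False
        then have "x \<notin> W (k + j)" for j
          using \<Lambda>_mono[of k "k + j"] by (auto simp: W_def not_less intro: order_trans ennreal_leI)
        then show ?thesis by simp
      next
        case True
        have "(\<Sum>j<n. ennreal (\<Lambda> (Suc (k + j))) * indicator (W (k + j)) x)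
          = (\<Sum>j<n. ennreal (\<Lambda> (Suc (k + j)) * (if \<Lambda> (k + j) < v then 1 else 0)))"
          using True v \<Lambda>_pos less_imp_le[OF \<Lambda>_pos]
          by (intro sum.cong) (auto simp: W_def indicator_def ennreal_less_iff)
        also have "\<dots> = ennreal (\<Sum>j<n. \<Lambda> (Suc (k + j)) * (if \<Lambda> (k + j) < v then 1 else 0))"
          using less_imp_le[OF \<Lambda>_pos] by (intro sum_ennreal) auto
        also have "(\<Sum>j<n. \<Lambda> (Suc (k + j)) * (if \<Lambda> (k + j) < v then 1 else 0)) \<le> D * v"
          using sum_levels_below_le[of t "l0 * t ^ k" v n] t l0 v
          by (simp add: D_def \<Lambda>_def power_add mult_ac)
        finally show ?thesis using True v D by (simp add: ennreal_mult ennreal_leI)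
      qed
    qed
    also have "\<dots> = ennreal D * f k" by (simp add: f_def nn_integral_cmult)
    finally show ?thesis .
  qed
  define F where "F = (\<lambda>k. enn2real (f k))"
  have fF: "f k = ennreal (F k)" and F0: "0 \<le> F k" for k
    using f_fin[of k] by (auto simp: F_def top.not_eq_extremum)
  have "(\<Sum>j<n. F (Suc k + j)) \<le> D * F k" for k n
    using f_tail[where k=k and n=n] D F0
    by (simp add: fF sum_nonneg ennreal_mult[symmetric])
  then obtain R where R: "0 \<le> R" "\<And>k. F k \<le> R * (D / (1 + D)) ^ k"
    using geometric_decay_of_tail_bound[of F D] F0 D by blast
  define \<theta> where "\<theta> = D / (1 + D)"
  have \<theta>: "0 < \<theta>" "\<theta> < 1" using D by (auto simp: \<theta>_def)
  \<comment> \<open>Chosen so that the growth \<open>t powr \<epsilon>\<close> of the levels uses up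
    only a square root of the decay: the final series is geometric with ratio
    \<open>sqrt \<theta>\<close>.\<close>
  define \<epsilon> where "\<epsilon> = log t (1 / sqrt \<theta>)"
  have t_\<epsilon>: "t powr \<epsilon> = 1 / sqrt \<theta>" using t \<theta> by (simp add: \<epsilon>_def)
  have \<epsilon>: "0 < \<epsilon>" using t \<theta> by (simp add: \<epsilon>_def)
  have pointwise: "epowr (w x) (1 + \<epsilon>) \<le> ennreal (l0 powr \<epsilon>) * w x
      + (\<Sum>k. ennreal (\<Lambda> (Suc k) powr \<epsilon>) * (w x * indicator (W k) x))"
    if wx: "w x \<noteq> \<infinity>" and x: "x \<in> space M" for x
  proof -
    obtain v where v: "w x = ennreal v" "0 \<le> v" using wx by (cases "w x") auto
    have split: "epowr (w x) (1 + \<epsilon>) \<le> ennreal (u powr \<epsilon>) * w x" if "v \<le> u" for u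
    proof (cases "v = 0")
      case True
      then show ?thesis using v \<epsilon> by (simp add: epowr_def)
    next
      case False
      have "v powr (1 + \<epsilon>) \<le> u powr \<epsilon> * v"
        using False v(2) that \<epsilon> by (simp add: powr_add mult.commute powr_mono2)
      then show ?thesis
        using False v by (simp add: epowr_ennreal ennreal_mult[symmetric] ennreal_leI)
    qed
    show ?thesis
    proof (cases "v \<le> l0")
      case True
      then show ?thesis using split[of l0] by (simp add: add_increasing2)
    next
      case False
      obtain n where "v / l0 < t ^ n" using real_arch_pow[OF t] by blast
      then have "v \<le> \<Lambda> n" using l0 by (simp add: \<Lambda>_def field_simps)
      then have ex: "\<exists>n. v \<le> \<Lambda> n" by blast
      \<comment> \<open>The least level not below \<open>v\<close> locates the layer between two
        consecutive levels that contains \<open>v\<close>; only the term of this layer is kept from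
        the series.\<close>
      define n where "n = (LEAST n. v \<le> \<Lambda> n)"
      have n: "v \<le> \<Lambda> n" using LeastI_ex[OF ex] by (simp add: n_def)
      then have "n \<noteq> 0" using False by (cases n) (auto simp: \<Lambda>_def)
      then obtain k where k: "n = Suc k" using not0_implies_Suc by blast
      have "\<not> v \<le> \<Lambda> k" using not_less_Least[of k "\<lambda>n. v \<le> \<Lambda> n"] k by (simp add: n_def)
      then have "x \<in> W k" using x v less_imp_le[OF \<Lambda>_pos[of k]] by (simp add: W_def ennreal_less_iff)
      then have "epowr (w x) (1 + \<epsilon>) \<le> ennreal (\<Lambda> (Suc k) powr \<epsilon>) * (w x * indicator (W k) x)"
        using split[of "\<Lambda> (Suc k)"] n k by simp
      also have "\<dots> \<le> (\<Sum>k. ennreal (\<Lambda> (Suc k) powr \<epsilon>) * (w x * indicator (W k) x))"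
        using sum_le_suminf[of "\<lambda>k. ennreal (\<Lambda> (Suc k) powr \<epsilon>) * (w x * indicator (W k) x)" "{k}"]
        by simp
      finally show ?thesis by (simp add: add_increasing)
    qed
  qed
  have "(\<integral>\<^sup>+x. epowr (w x) (1 + \<epsilon>) \<partial>M) \<le> (\<integral>\<^sup>+x. ennreal (l0 powr \<epsilon>) * w x
      + (\<Sum>k. ennreal (\<Lambda> (Suc k) powr \<epsilon>) * (w x * indicator (W k) x)) \<partial>M)"
    using w_ae pointwise by (intro nn_integral_mono_AE) auto
  also have "\<dots> = ennreal (l0 powr \<epsilon>) * (\<integral>\<^sup>+x. w x \<partial>M) + (\<Sum>k. ennreal (\<Lambda> (Suc k) powr \<epsilon>) * f k)"
    by (simp add: nn_integral_add nn_integral_suminf nn_integral_cmult f_def)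
  also have "\<dots> < \<infinity>"
  proof -
    define u where "u = (\<lambda>k. (l0 * t) powr \<epsilon> * R * sqrt \<theta> ^ k)"
    have "\<Lambda> (Suc k) powr \<epsilon> * F k \<le> u k" for k
    proof -
      have "\<Lambda> (Suc k) powr \<epsilon> * F k = (l0 * t) powr \<epsilon> * (t powr \<epsilon>) ^ k * F k"
        using l0 t by (simp add: \<Lambda>_def powr_mult powr_power mult.commute powr_powr powr_add ring_distribs flip: powr_realpow)
      also have "\<dots> \<le> (l0 * t) powr \<epsilon> * (t powr \<epsilon>) ^ k * (R * \<theta> ^ k)"
        using R(2)[of k] by (intro mult_left_mono) (auto simp: \<theta>_def)
      also have "\<dots> = (l0 * t) powr \<epsilon> * R * (t powr \<epsilon> * \<theta>) ^ k"
        by (simp add: power_mult_distrib)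
      also have "t powr \<epsilon> * \<theta> = sqrt \<theta>" using \<theta> by (simp add: t_\<epsilon> real_div_sqrt)
      finally show ?thesis by (simp add: u_def)
    qed
    then have "(\<Sum>k. ennreal (\<Lambda> (Suc k) powr \<epsilon>) * f k) \<le> (\<Sum>k. ennreal (u k))"
      using F0 by (intro suminf_le) (auto simp: fF ennreal_mult[symmetric] intro!: ennreal_leI)
    also have "\<dots> < \<infinity>"
    proof -
      have "summable u" unfolding u_def using \<theta> by (intro summable_mult summable_geometric) auto
      then show ?thesis
        using R(1) \<theta> by (subst suminf_ennreal2) (auto simp: u_def)
    qed
    finally show ?thesis using w_fin by (auto simp: ennreal_mult_less_top)
  qed
  finally show ?thesis using \<epsilon> by blast
qed

section \<open>Stopping-time argument on doubling balls\<close>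

text \<open>Greedy Vitali selection. A smaller \<open>k\<close> stands for a larger ball, so a ball
  of least \<open>k\<close> has all the balls that it meets inside its enlargement
  \<open>L i\<close>; the remaining ones are left to the induction.\<close>

lemma finite_disjoint_selection:
  fixes k :: "'i \<Rightarrow> nat"
  assumes "finite I"
    and "\<And>i j. i \<in> I \<Longrightarrow> j \<in> I \<Longrightarrow> k i \<le> k j \<Longrightarrow> S i \<inter> S j \<noteq> {} \<Longrightarrow> S j \<subseteq> L i"
  shows "\<exists>J\<subseteq>I. disjoint_family_on S J \<and> (\<Union>i\<in>I. S i) \<subseteq> (\<Union>i\<in>J. L i)"
  using assms
proof (induction I rule: finite_psubset_induct)
  case (psubset I)
  show ?case
  proof (cases "I = {}")
    case True
    then show ?thesis by (auto simp: disjoint_family_on_def)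
  next
    case False
    then obtain i where i: "i \<in> I" "\<And>j. j \<in> I \<Longrightarrow> k i \<le> k j"
      using that[of "arg_min_on k I"] arg_min_if_finite(1)[of I k] arg_min_least[of I _ k]
        psubset.hyps by blast
    define I' where "I' = {j \<in> I - {i}. S i \<inter> S j = {}}"
    have "I' \<subset> I" using i by (auto simp: I'_def)
    then obtain J where J: "J \<subseteq> I'" "disjoint_family_on S J" "(\<Union>i\<in>I'. S i) \<subseteq> (\<Union>i\<in>J. L i)"
      using psubset.IH[of I'] psubset.prems by blast
    have "disjoint_family_on S (insert i J)"
      using J(1,2) by (auto simp: disjoint_family_on_def I'_def)
    moreover have "S j \<subseteq> (\<Union>i\<in>insert i J. L i)" if "j \<in> I" for j
    proof (cases "j \<in> I'")
      case True
      then show ?thesis using J(3) by blast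
    next
      case False
      then have "j = i \<or> S i \<inter> S j \<noteq> {}" using that by (auto simp: I'_def)
      then have "S j \<subseteq> L i" using psubset.prems[of i j] i that by blast
      then show ?thesis by blast
    qed
    ultimately show ?thesis
      using i(1) J(1) \<open>I' \<subset> I\<close> by (intro exI[of _ "insert i J"]) blast
  qed
qed

text \<open>\<open>B x j\<close> models a ball of radius \<open>r0 * q ^ j\<close>, so larger
  indices mean smaller balls. By \<open>engulf\<close> the predecessor of a ball serves as its
  Vitali enlargement; \<open>doubling\<close> compares neighbouring scales and permits null balls.
  The relative openness in \<open>ball_open\<close> gives access to Lindelof for uncountable
  unions.\<close>

locale doubling_balls =
  fixes M :: "'a::second_countable_topology measure"
    and B :: "'a \<Rightarrow> nat \<Rightarrow> 'a set"
    and C :: real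
  assumes finite_space: "emeasure M (space M) < \<infinity>"
    and open_sets: "\<And>U. open U \<Longrightarrow> U \<inter> space M \<in> sets M"
    and ball_open: "\<And>x j. x \<in> space M \<Longrightarrow> \<exists>U. open U \<and> B x j = U \<inter> space M"
    and centre: "\<And>x j. x \<in> space M \<Longrightarrow> x \<in> B x j"
    and engulf: "\<And>x y i j. x \<in> space M \<Longrightarrow> y \<in> space M \<Longrightarrow> i \<le> j \<Longrightarrow>
        B x (Suc i) \<inter> B y (Suc j) \<noteq> {} \<Longrightarrow> B y (Suc j) \<subseteq> B x i"
    and doubling: "\<And>x j. x \<in> space M \<Longrightarrow>
        emeasure M (B x j) \<le> ennreal C * emeasure M (B x (Suc j))"
    and C_pos: "0 < C"
    and shrink: "\<And>x U. x \<in> space M \<Longrightarrow> open U \<Longrightarrow> x \<in> U \<Longrightarrow> \<exists>j. B x (Suc j) \<subseteq> U"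
    and outer_regular_open: "\<And>E e. E \<in> sets M \<Longrightarrow> 0 < e \<Longrightarrow>
        \<exists>U. open U \<and> E \<subseteq> U \<and> emeasure M (U \<inter> space M) \<le> emeasure M E + ennreal e"
begin

lemma ball_sets [measurable]: "x \<in> space M \<Longrightarrow> B x j \<in> sets M"
  using ball_open[of x j] open_sets by metis

text \<open>Disjoint small balls share out \<open>V\<close> while their predecessors cover the
  union, so summing \<open>bound\<close> over a Vitali selection loses no constant. Lindelof reduces
  to a countable union, which finite subunions exhaust; an infinite selection is avoided. The lemma
  serves twice: with \<open>V\<close> a level set of \<open>w\<close>, and with \<open>V\<close> an
  open neighbourhood of the exceptional set.\<close>

lemma covering_bound:
  assumes P: "P \<subseteq> space M" and N: "sets N = sets M" and V: "V \<in> sets M"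
    and bound: "\<And>x. x \<in> P \<Longrightarrow> emeasure N (B x (k x)) \<le> a * emeasure M (V \<inter> B x (Suc (k x)))"
  shows "(\<Union>x\<in>P. B x (Suc (k x))) \<in> sets M"
    and "emeasure N (\<Union>x\<in>P. B x (Suc (k x))) \<le> a * emeasure M V"
proof -
  define S where "S = (\<lambda>x. B x (Suc (k x)))"
  have Sm: "S x \<in> sets M" if "x \<in> P" for x using that P by (auto simp: S_def)
  have "\<forall>x\<in>P. \<exists>U. open U \<and> S x = U \<inter> space M" using ball_open P by (auto simp: S_def)
  then obtain U where U: "\<And>x. x \<in> P \<Longrightarrow> open (U x) \<and> S x = U x \<inter> space M" by metis
  obtain F where F: "F \<subseteq> U ` P" "countable F" "\<Union>F = \<Union>(U ` P)"
    using Lindelof[of "U ` P"] U by blast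
  then obtain Q where Q: "Q \<subseteq> P" "countable Q" "F = U ` Q"
    by (metis countable_subset_image)
  have un: "(\<Union>x\<in>P. S x) = (\<Union>x\<in>Q. S x)"
  proof -
    have "(\<Union>x\<in>P. S x) = \<Union>(U ` P) \<inter> space M" using U by auto
    also have "\<dots> = \<Union>(U ` Q) \<inter> space M" using F Q by simp
    also have "\<dots> = (\<Union>x\<in>Q. S x)" using U Q(1) by auto
    finally show ?thesis .
  qed
  show "(\<Union>x\<in>P. B x (Suc (k x))) \<in> sets M"
    using Sm Q(1) unfolding un[unfolded S_def] by (intro sets.countable_UN'[OF Q(2)]) (auto simp: S_def)
  have fin: "emeasure N (\<Union>x\<in>I. S x) \<le> a * emeasure M V" if I: "finite I" "I \<subseteq> P" for I
  proof -
    obtain J where J: "J \<subseteq> I" "disjoint_family_on S J" "(\<Union>i\<in>I. S i) \<subseteq> (\<Union>x\<in>J. B x (k x))"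
    proof -
      have "S y \<subseteq> B x (k x)" if "x \<in> I" "y \<in> I" "k x \<le> k y" "S x \<inter> S y \<noteq> {}" for x y
        using engulf[of x y "k x" "k y"] that I(2) P by (auto simp: S_def)
      then show ?thesis
        using finite_disjoint_selection[of I k S "\<lambda>x. B x (k x)"] I(1) that by blast
    qed
    have finJ: "finite J" using J(1) I(1) finite_subset by blast
    have Bm: "B x j \<in> sets N" if "x \<in> J" for x j
      using ball_sets[of x j] that J(1) I(2) P N by blast
    have "emeasure N (\<Union>x\<in>I. S x) \<le> emeasure N (\<Union>x\<in>J. B x (k x))"
      using J finJ Bm by (intro emeasure_mono sets.finite_UN) auto
    also have "\<dots> \<le> (\<Sum>x\<in>J. emeasure N (B x (k x)))"
      using finJ Bm by (intro emeasure_subadditive_finite) auto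
    also have "\<dots> \<le> (\<Sum>x\<in>J. a * emeasure M (V \<inter> S x))"
      using bound J I by (intro sum_mono) (auto simp: S_def)
    also have "\<dots> = a * (\<Sum>x\<in>J. emeasure M (V \<inter> S x))"
      by (simp add: sum_distrib_left)
    also have "(\<Sum>x\<in>J. emeasure M (V \<inter> S x)) = emeasure M (\<Union>x\<in>J. V \<inter> S x)"
      using J I Sm V finJ by (intro sum_emeasure) (auto simp: disjoint_family_on_def)
    also have "\<dots> \<le> emeasure M V" using V by (intro emeasure_mono) auto
    finally show ?thesis by (simp add: mult_left_mono)
  qed
  show "emeasure N (\<Union>x\<in>P. B x (Suc (k x))) \<le> a * emeasure M V"
  proof (cases "Q = {}")
    case True
    then show ?thesis using un by (simp add: S_def)
  next
    case False
    define q where "q = from_nat_into Q"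
    have q: "range q = Q" using False Q(2) by (simp add: q_def range_from_nat_into)
    have "(\<lambda>n. emeasure N (\<Union>i<n. S (q i))) \<longlonglongrightarrow> emeasure N (\<Union>n. \<Union>i<n. S (q i))"
    proof (rule Lim_emeasure_incseq)
      show "range (\<lambda>n. \<Union>i<n. S (q i)) \<subseteq> sets N" using Sm Q(1) q N by (auto intro!: sets.finite_UN)
      show "incseq (\<lambda>n. \<Union>i<n. S (q i))" by (intro monoI) force
    qed
    moreover have "emeasure N (\<Union>i<n. S (q i)) \<le> a * emeasure M V" for n
      using fin[of "q ` {..<n}"] q Q(1) by auto
    ultimately have "emeasure N (\<Union>n. \<Union>i<n. S (q i)) \<le> a * emeasure M V"
      by (intro LIMSEQ_le_const2) auto
    also have "(\<Union>n. \<Union>i<n. S (q i)) = (\<Union>x\<in>Q. S x)" using q by blast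
    finally show ?thesis using un by (simp add: S_def)
  qed
qed


lemma level_set_estimate:
  fixes w :: "'a \<Rightarrow> ennreal"
  assumes w [measurable]: "w \<in> borel_measurable M" and w_fin: "(\<integral>\<^sup>+x. w x \<partial>M) < \<infinity>"
    and c: "0 < c"
    and lower: "\<And>x j. x \<in> space M \<Longrightarrow> emeasure M (B x j) \<le>
        2 * emeasure M {y \<in> B x j. ennreal c * (\<integral>\<^sup>+z\<in>B x j. w z \<partial>M) \<le> w y * emeasure M (B x j)}"
    and m: "0 < m" "\<And>x. x \<in> space M \<Longrightarrow>
        emeasure M (B x 0) = 0 \<or> ennreal m \<le> emeasure M (B x 0)"
  obtains l0 where "0 < l0" "\<And>l. l0 \<le> l \<Longrightarrow>
      (\<integral>\<^sup>+x\<in>{x \<in> space M. ennreal l < w x}. w x \<partial>M) \<le>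
      ennreal l * emeasure M {x \<in> space M. ennreal (c / (2 * C) * l) < w x}"
proof -
  define N where "N = density M w"
  have sets_N [simp, measurable_cong]: "sets N = sets M" by (simp add: N_def)
  have N_eq: "emeasure N X = (\<integral>\<^sup>+x\<in>X. w x \<partial>M)" if "X \<in> sets M" for X
    using that by (simp add: N_def emeasure_density)
  have N_fin: "emeasure N (space M) < \<infinity>"
    using w_fin by (simp add: N_def emeasure_density space_density cong: nn_integral_cong)
  \<comment> \<open>Averages are compared with \<open>T = \<kappa> * l = l / (2 * C)\<close>. One
    doubling step costs \<open>C\<close>; the remaining 2 pays for the factor 2 of
    \<open>lower\<close> on the stopped balls, and on the exceptional set it leaves the factor
    \<open>1 / 2\<close> that forces measure zero.\<close>
  define \<kappa> where "\<kappa> = 1 / (2 * C)"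
  have \<kappa>: "0 < \<kappa>" "\<kappa> * C = 1 / 2" using C_pos by (auto simp: \<kappa>_def)
  \<comment> \<open>Total mass over the least positive measure of a top ball, so that averages over
    \<open>B x 0\<close> stay below \<open>T\<close>. The summand 1 keeps \<open>l0\<close> positive
    when \<open>w\<close> vanishes almost everywhere.\<close>
  define l0 where "l0 = (enn2real (emeasure N (space M)) + 1) / (\<kappa> * m)"
  have l0: "0 < l0" "\<kappa> * l0 * m = enn2real (emeasure N (space M)) + 1"
    using \<kappa> m(1) by (auto simp: l0_def intro!: divide_pos_pos add_nonneg_pos)
  show thesis
  proof (rule that[OF l0(1)])
    fix l assume l: "l0 \<le> l"
    then have l_pos: "0 < l" using l0 by simp
    define T where "T = \<kappa> * l"
    have T_pos: "0 < T" using l_pos \<kappa> by (simp add: T_def)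
    have TC: "T * C = l / 2" using \<kappa> by (simp add: T_def algebra_simps)
    have T0: "emeasure N (B x 0) \<le> ennreal T * emeasure M (B x 0)" if x: "x \<in> space M" for x
    proof (cases "emeasure M (B x 0) = 0")
      case True
      then have "emeasure N (B x 0) = 0"
        using x by (simp add: N_eq null_setsI nn_integral_null_set)
      then show ?thesis by simp
    next
      case False
      have "emeasure N (B x 0) \<le> emeasure N (space M)"
        by (metis emeasure_space sets_N sets_eq_imp_space_eq)
      also have "\<dots> \<le> ennreal (\<kappa> * l0 * m)"
        using N_fin l0(2) by (cases "emeasure N (space M)") (auto simp del: mult_eq_0_iff intro!: ennreal_leI)
      also have "\<dots> \<le> ennreal (T * m)"
        using l m(1) \<kappa>(1) by (intro ennreal_leI) (simp add: T_def)
      also have "\<dots> \<le> ennreal T * emeasure M (B x 0)"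
        using False m x T_pos by (auto simp: ennreal_mult intro!: mult_left_mono)
      finally show ?thesis .
    qed
    define A where "A = {x \<in> space M. ennreal l < w x}"
    define V where "V = {x \<in> space M. ennreal (c * T) < w x}"
    have [measurable]: "A \<in> sets M" "V \<in> sets M" by (auto simp: A_def V_def)
    define P where "P = {x \<in> A. \<exists>j. ennreal T * emeasure M (B x j) < emeasure N (B x j)}"
    have P_space: "P \<subseteq> space M" by (auto simp: P_def A_def)
    have "\<exists>k. emeasure N (B x k) \<le> ennreal T * emeasure M (B x k) \<and>
        ennreal T * emeasure M (B x (Suc k)) < emeasure N (B x (Suc k))" if "x \<in> P" for x
    proof -
      \<comment> \<open>The least index belongs to the largest ball above the threshold. By
        \<open>T0\<close> it is not 0, and its predecessor has average at most
        \<open>T\<close>.\<close>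
      define j where "j = (LEAST j. ennreal T * emeasure M (B x j) < emeasure N (B x j))"
      have "\<exists>j. ennreal T * emeasure M (B x j) < emeasure N (B x j)"
        using that by (simp add: P_def)
      from LeastI_ex[OF this] have j: "ennreal T * emeasure M (B x j) < emeasure N (B x j)"
        by (simp add: j_def)
      then have "j \<noteq> 0" using T0[of x] that P_space by (metis leD subsetD)
      then obtain k where k: "j = Suc k" using not0_implies_Suc by blast
      then have "\<not> (ennreal T * emeasure M (B x k) < emeasure N (B x k))"
        unfolding j_def using not_less_Least by (metis lessI)
      then show ?thesis using j k by (metis leI)
    qed
    then obtain k where k: "\<And>x. x \<in> P \<Longrightarrow> emeasure N (B x (k x)) \<le> ennreal T * emeasure M (B x (k x))"
        "\<And>x. x \<in> P \<Longrightarrow> ennreal T * emeasure M (B x (Suc (k x))) < emeasure N (B x (Suc (k x)))"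
      by metis
    define G where "G = (\<Union>x\<in>P. B x (Suc (k x)))"
    have bound: "emeasure N (B x (k x)) \<le> ennreal l * emeasure M (V \<inter> B x (Suc (k x)))"
      if x: "x \<in> P" for x
    proof -
      let ?B = "B x (Suc (k x))"
      have xs: "x \<in> space M" using x P_space by auto
      have "{y \<in> ?B. ennreal c * (\<integral>\<^sup>+z\<in>?B. w z \<partial>M) \<le> w y * emeasure M ?B} \<subseteq> V \<inter> ?B"
      proof safe
        fix y assume y: "y \<in> ?B" "ennreal c * (\<integral>\<^sup>+z\<in>?B. w z \<partial>M) \<le> w y * emeasure M ?B"
        have "ennreal (c * T) * emeasure M ?B = ennreal c * (ennreal T * emeasure M ?B)"
          using c T_pos by (simp add: ennreal_mult mult.assoc)
        also have "\<dots> < ennreal c * emeasure N ?B"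
          using k(2)[OF x] c by (intro ennreal_mult_strict_left_mono) auto
        also have "\<dots> \<le> w y * emeasure M ?B" using y xs by (simp add: N_eq)
        finally have "ennreal (c * T) < w y"
          by (meson linorder_not_less mult_right_mono zero_le)
        then show "y \<in> V"
          using y ball_sets[OF xs] sets.sets_into_space unfolding V_def by blast
      qed
      then have sub: "emeasure M {y \<in> ?B. ennreal c * (\<integral>\<^sup>+z\<in>?B. w z \<partial>M) \<le> w y * emeasure M ?B}
          \<le> emeasure M (V \<inter> ?B)"
        using xs by (intro emeasure_mono) auto
      have "emeasure N (B x (k x)) \<le> ennreal T * emeasure M (B x (k x))" by (rule k(1)[OF x])
      also have "\<dots> \<le> ennreal T * (ennreal C * emeasure M ?B)"
        by (intro mult_left_mono doubling xs) auto
      also have "\<dots> \<le> ennreal T * (ennreal C * (2 * emeasure M (V \<inter> ?B)))"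
        by (intro mult_left_mono order_trans[OF lower[OF xs] mult_left_mono[OF sub]]) auto
      also have "\<dots> = ennreal (T * C * 2) * emeasure M (V \<inter> ?B)"
        using T_pos C_pos by (simp add: ennreal_mult mult.assoc)
      also have "T * C * 2 = l" using TC by simp
      finally show ?thesis .
    qed
    have G [measurable]: "G \<in> sets M" and NG: "emeasure N G \<le> ennreal l * emeasure M V"
      unfolding G_def using bound P_space by (auto intro!: covering_bound(1,2)[where N=N and V=V])
    \<comment> \<open>No ball around a point of \<open>E\<close> exceeds the threshold
      \<open>l / (2 * C)\<close>, although \<open>w > l\<close> at the point itself: such points
      should form a null set.\<close>
    define E where "E = A - G"
    have [measurable]: "E \<in> sets M" by (simp add: E_def)
    have E_space: "E \<subseteq> space M" by (auto simp: E_def A_def)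
    have E_bad: "emeasure N (B x j) \<le> ennreal T * emeasure M (B x j)" if "x \<in> E" for x j
    proof -
      have "x \<notin> P"
        using that centre[of x "Suc (k x)"] E_space by (auto simp: E_def G_def)
      then show ?thesis using that by (auto simp: P_def E_def not_less)
    qed
    \<comment> \<open>outer regularity and the covering lemma replace Lebesgue differentiation here\<close>
    have E_le: "emeasure M E \<le> ennreal e" if e: "0 < e" for e
    proof -
      obtain U where U: "open U" "E \<subseteq> U" "emeasure M (U \<inter> space M) \<le> emeasure M E + ennreal e"
        using outer_regular_open[of E e] e by auto
      have "\<exists>k. B x (Suc k) \<subseteq> U" if "x \<in> E" for x using shrink[of x U] U that E_space by auto
      then obtain h where h: "\<And>x. x \<in> E \<Longrightarrow> B x (Suc (h x)) \<subseteq> U" by metis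
      have hb: "emeasure N (B x (h x)) \<le> ennreal (l / 2) * emeasure M ((U \<inter> space M) \<inter> B x (Suc (h x)))"
        if x: "x \<in> E" for x
      proof -
        have xs: "x \<in> space M" using x E_space by auto
        have eq: "(U \<inter> space M) \<inter> B x (Suc (h x)) = B x (Suc (h x))"
          using h[OF x] ball_sets[OF xs] sets.sets_into_space by blast
        have "emeasure N (B x (h x)) \<le> ennreal T * emeasure M (B x (h x))" by (rule E_bad[OF x])
        also have "\<dots> \<le> ennreal T * (ennreal C * emeasure M (B x (Suc (h x))))"
          by (intro mult_left_mono doubling xs) auto
        also have "\<dots> = ennreal (T * C) * emeasure M (B x (Suc (h x)))"
          using T_pos C_pos by (simp add: ennreal_mult mult.assoc)
        finally show ?thesis by (simp add: eq TC)
      qed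
      define H where "H = (\<Union>x\<in>E. B x (Suc (h x)))"
      have H: "H \<in> sets M" "emeasure N H \<le> ennreal (l / 2) * emeasure M (U \<inter> space M)"
        unfolding H_def using hb E_space open_sets[OF U(1)]
        by (auto intro!: covering_bound(1,2)[where N=N and V="U \<inter> space M"])
      have "E \<subseteq> H" using centre E_space by (auto simp: H_def)
      have "ennreal l * emeasure M E = (\<integral>\<^sup>+x. ennreal l * indicator E x \<partial>M)"
        by (rule nn_integral_cmult_indicator[symmetric]) simp
      also have "\<dots> \<le> (\<integral>\<^sup>+x. w x * indicator E x \<partial>M)"
        by (intro nn_integral_mono) (auto simp: E_def A_def indicator_def)
      also have "\<dots> = emeasure N E" by (simp add: N_eq)
      also have "\<dots> \<le> emeasure N H" using \<open>E \<subseteq> H\<close> H by (intro emeasure_mono) auto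
      also have "\<dots> \<le> ennreal (l / 2) * emeasure M (U \<inter> space M)" by (rule H)
      also have "\<dots> \<le> ennreal (l / 2) * (emeasure M E + ennreal e)"
        by (intro mult_left_mono U) auto
      finally have *: "ennreal l * emeasure M E \<le> ennreal (l / 2) * (emeasure M E + ennreal e)" .
      have "emeasure M E \<noteq> \<infinity>"
        using finite_space emeasure_space[of M E] by (auto simp: top_unique)
      then obtain a where a: "emeasure M E = ennreal a" "0 \<le> a"
        by (cases "emeasure M E") auto
      have "l * a \<le> l / 2 * (a + e)"
        using * a e l_pos by (simp add: ennreal_mult[symmetric] ennreal_plus[symmetric] del: ennreal_plus)
      then have "a \<le> (a + e) / 2" using l_pos
        by (metis (no_types, opaque_lifting) mult.commute mult_le_cancel_left_pos times_divide_eq_right)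
      then show ?thesis using a by (simp add: ennreal_leI)
    qed
    have "emeasure M E = 0"
      using E_le by (metis ennreal_0 ennreal_le_epsilon add.left_neutral le_zero_eq)
    then have NE: "emeasure N E = 0"
      by (simp add: N_eq null_setsI nn_integral_null_set)
    have "emeasure N A \<le> emeasure N (G \<union> E)" by (intro emeasure_mono) (auto simp: E_def)
    also have "\<dots> \<le> emeasure N G + emeasure N E" by (intro emeasure_subadditive) auto
    also have "\<dots> \<le> ennreal l * emeasure M V" using NG NE by simp
    finally show "(\<integral>\<^sup>+x\<in>{x \<in> space M. ennreal l < w x}. w x \<partial>M) \<le>
      ennreal l * emeasure M {x \<in> space M. ennreal (c / (2 * C) * l) < w x}"
      by (simp add: N_eq A_def[symmetric] V_def T_def \<kappa>_def)
  qed
qed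

end

section \<open>Hausdorff measure and Lipschitz maps\<close>

lemma hausdorff_pre_mono: "A \<subseteq> A' \<Longrightarrow> hausdorff_pre m \<delta> A \<le> hausdorff_pre m \<delta> A'"
  unfolding hausdorff_pre_def by (intro INF_superset_mono) auto

lemma hausdorff_outer_mono: "A \<subseteq> A' \<Longrightarrow> hausdorff_outer m A \<le> hausdorff_outer m A'"
  unfolding hausdorff_outer_def by (intro SUP_mono) (auto intro: hausdorff_pre_mono)

lemma hausdorff_outer_le_expanding_image:
  fixes A :: "'a::euclidean_space set" and f :: "'a \<Rightarrow> 'b::euclidean_space"
  assumes L: "0 < L" and f: "\<And>x y. x \<in> A \<Longrightarrow> y \<in> A \<Longrightarrow> norm (x - y) \<le> L * norm (f x - f y)"
  shows "hausdorff_outer m A \<le> ennreal (L ^ m) * hausdorff_outer m (f ` A)"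
proof -
  have "hausdorff_pre m \<delta> A \<le> ennreal (L ^ m) * hausdorff_outer m (f ` A)" if \<delta>: "0 < \<delta>" for \<delta>
  proof -
    let ?v = "unit_ball_vol (real m)"
    have "hausdorff_pre m \<delta> A / ennreal (L ^ m) \<le> hausdorff_pre m (\<delta> / L) (f ` A)"
      unfolding hausdorff_pre_def[of m "\<delta> / L"]
    proof (rule INF_greatest)
      fix E :: "nat \<Rightarrow> 'b set"
      assume "E \<in> {E. f ` A \<subseteq> (\<Union>i. E i) \<and> (\<forall>i. bounded (E i) \<and> diameter (E i) \<le> \<delta> / L)}"
      then have E: "f ` A \<subseteq> (\<Union>i. E i)" "\<And>i. bounded (E i)" "\<And>i. diameter (E i) \<le> \<delta> / L" by auto
      define E' where "E' = (\<lambda>i. A \<inter> f -` E i)"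
      have dist: "norm (x - y) \<le> L * diameter (E i)" if "x \<in> E' i" "y \<in> E' i" for x y i
      proof -
        have "norm (f x - f y) \<le> diameter (E i)"
          using that diameter_bounded_bound[OF E(2), of "f x" i "f y"] by (simp add: E'_def dist_norm)
        then show ?thesis using f[of x y] that L by (smt (verit) E'_def IntD1 mult_left_mono)
      qed
      have diam: "diameter (E' i) \<le> L * diameter (E i)" for i
        using dist L diameter_ge_0[OF E(2)] by (intro diameter_le) auto
      have bdd: "bounded (E' i)" for i
      proof (cases "E' i = {}")
        case False
        then obtain a where "a \<in> E' i" by blast
        then show ?thesis using dist by (intro bounded_subset[OF bounded_cball[of a]]) (auto simp: dist_norm)
      qed auto
      have small: "diameter (E' i) \<le> \<delta>" for i
        using diam[of i] E(3)[of i] L by (simp add: field_simps)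
      have "hausdorff_pre m \<delta> A \<le> (\<Sum>i. ennreal (?v * (diameter (E' i) / 2) ^ m))"
        unfolding hausdorff_pre_def using E(1) bdd small by (intro INF_lower) (fastforce simp: E'_def)
      also have "\<dots> \<le> (\<Sum>i. ennreal (L ^ m) * ennreal (?v * (diameter (E i) / 2) ^ m))"
      proof (intro suminf_le summableI)
        fix i
        have "?v * (diameter (E' i) / 2) ^ m \<le> ?v * (L * diameter (E i) / 2) ^ m"
          using diam[of i] diameter_ge_0[OF bdd] by (intro mult_left_mono power_mono) auto
        also have "\<dots> = L ^ m * (?v * (diameter (E i) / 2) ^ m)"
          by (simp add: power_mult_distrib power_divide)
        finally show "ennreal (?v * (diameter (E' i) / 2) ^ m)
            \<le> ennreal (L ^ m) * ennreal (?v * (diameter (E i) / 2) ^ m)"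
          using L diameter_ge_0[OF E(2)] by (simp add: ennreal_mult[symmetric] ennreal_leI)
      qed
      also have "\<dots> = ennreal (L ^ m) * (\<Sum>i. ennreal (?v * (diameter (E i) / 2) ^ m))" by simp
      finally show "hausdorff_pre m \<delta> A / ennreal (L ^ m) \<le> (\<Sum>i. ennreal (?v * (diameter (E i) / 2) ^ m))"
        using L by (intro divide_le_posI_ennreal) auto
    qed
    also have "\<dots> \<le> hausdorff_outer m (f ` A)"
      unfolding hausdorff_outer_def using L \<delta> by (intro SUP_upper) auto
    finally have le: "hausdorff_pre m \<delta> A / ennreal (L ^ m) \<le> hausdorff_outer m (f ` A)" .
    have "hausdorff_pre m \<delta> A = hausdorff_pre m \<delta> A * (ennreal (L ^ m) / ennreal (L ^ m))"
      using L by (subst ennreal_divide_self) auto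
    also have "\<dots> = hausdorff_pre m \<delta> A / ennreal (L ^ m) * ennreal (L ^ m)"
      by (rule ennreal_divide_times[symmetric])
    also have "\<dots> \<le> hausdorff_outer m (f ` A) * ennreal (L ^ m)"
      by (intro mult_right_mono le) simp
    finally show ?thesis by (subst mult.commute)
  qed
  then show ?thesis unfolding hausdorff_outer_def[of m A] by (intro SUP_least) auto
qed

text \<open>The cover is padded by empty sets to a sequence; \<open>0 < m\<close> makes the padding
  free, since diameter 0 enters to the power \<open>m\<close>.\<close>

lemma hausdorff_pre_finite_cover:
  assumes m: "0 < m" and K: "finite K" and cover: "A \<subseteq> (\<Union>k\<in>K. E k)"
    and E: "\<And>k. k \<in> K \<Longrightarrow> bounded (E k) \<and> diameter (E k) \<le> d" and d: "0 \<le> d" "d \<le> \<delta>"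
  shows "hausdorff_pre m \<delta> A \<le> ennreal (real (card K) * (unit_ball_vol (real m) * (d / 2) ^ m))"
proof -
  let ?v = "unit_ball_vol (real m)"
  obtain h where h: "bij_betw h {0..<card K} K" using ex_bij_betw_nat_finite[OF K] by blast
  then have hK: "h i \<in> K" if "i < card K" for i using that by (auto simp: bij_betw_def)
  define E' where "E' = (\<lambda>i. if i < card K then E (h i) else {})"
  have "A \<subseteq> (\<Union>i. E' i)"
  proof
    fix x assume "x \<in> A"
    then obtain k where k: "k \<in> K" "x \<in> E k" using cover by blast
    then obtain i where "i < card K" "k = h i"
      using h by (metis atLeastLessThan_iff bij_betw_imp_surj_on imageE)
    then show "x \<in> (\<Union>i. E' i)" using k by (auto simp: E'_def)
  qed
  moreover have "bounded (E' i) \<and> diameter (E' i) \<le> \<delta>" for i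
    using E hK d by (auto simp: E'_def intro: order_trans)
  ultimately have "hausdorff_pre m \<delta> A \<le> (\<Sum>i. ennreal (?v * (diameter (E' i) / 2) ^ m))"
    unfolding hausdorff_pre_def by (intro INF_lower) auto
  also have "\<dots> = (\<Sum>i<card K. ennreal (?v * (diameter (E' i) / 2) ^ m))"
    using m by (intro suminf_finite) (auto simp: E'_def)
  also have "\<dots> \<le> (\<Sum>i<card K. ennreal (?v * (d / 2) ^ m))"
    using E hK diameter_ge_0
    by (intro sum_mono ennreal_leI mult_left_mono power_mono divide_right_mono) (auto simp: E'_def)
  also have "\<dots> = ennreal (real (card K) * (?v * (d / 2) ^ m))"
    using d by (simp add: ennreal_mult[symmetric] ennreal_of_nat_eq_real_of_nat)
  finally show ?thesis .
qed

text \<open>By \<open>graph\<close>, \<open>A\<close> is a Lipschitz graph over the coordinates in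
  \<open>Bs\<close>. A grid of mesh \<open>1 / N\<close> in these coordinates has of order
  \<open>N ^ card Bs\<close> cells, each cutting out a piece of diameter of order
  \<open>1 / N\<close>, so the covering sums stay bounded as \<open>N\<close> grows.\<close>

lemma hausdorff_outer_finite_of_graph:
  fixes A :: "'a::euclidean_space set"
  assumes A: "bounded A" and Bs: "Bs \<subseteq> Basis" "Bs \<noteq> {}" and L: "0 < L"
    and graph: "\<And>x y. x \<in> A \<Longrightarrow> y \<in> A \<Longrightarrow> norm (x - y) \<le> L * (\<Sum>b\<in>Bs. \<bar>(x - y) \<bullet> b\<bar>)"
  shows "hausdorff_outer (card Bs) A < \<infinity>"
proof -
  let ?m = "card Bs"
  let ?v = "unit_ball_vol (real ?m)"
  have finBs: "finite Bs" using Bs(1) finite_Basis finite_subset by blast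
  then have m: "0 < ?m" using Bs(2) by (simp add: card_gt_0_iff)
  obtain R where R: "0 < R" "\<And>x. x \<in> A \<Longrightarrow> norm x \<le> R"
    using A by (auto simp: bounded_pos)
  define c where "c = ?v * ((2 * R + 3) * (L * real ?m) / 2) ^ ?m"
  have "hausdorff_pre ?m \<delta> A \<le> ennreal c" if \<delta>: "0 < \<delta>" for \<delta>
  proof -
    obtain N :: nat where N': "L * real ?m / \<delta> < real N" using reals_Archimedean2 by blast
    have "0 \<le> L * real ?m / \<delta>" using L \<delta> by simp
    then have "0 < real N" using N' by linarith
    then have N: "N > 0" "L * real ?m / \<delta> < real N" using N' by auto
    define d where "d = L * real ?m / real N"
    have d: "0 \<le> d" "d \<le> \<delta>" using N \<delta> L by (auto simp: d_def field_simps)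
    \<comment> \<open>The lower end is shifted by one because the floor of
      \<open>- (real N * R)\<close> may be one below
      \<open>- \<lfloor>real N * R\<rfloor>\<close>.\<close>
    define K where "K = PiE Bs (\<lambda>_. {- (\<lfloor>real N * R\<rfloor> + 1) .. \<lfloor>real N * R\<rfloor>})"
    define E where "E = (\<lambda>k. {x \<in> A. \<forall>b\<in>Bs. \<lfloor>real N * (x \<bullet> b)\<rfloor> = k b})"
    have finK: "finite K" using finBs by (auto simp: K_def intro: finite_PiE)
    have NR: "0 \<le> \<lfloor>real N * R\<rfloor>" using R by simp
    have "real (card K) = (2 * real_of_int \<lfloor>real N * R\<rfloor> + 2) ^ ?m"
      using finBs NR by (simp add: K_def card_PiE add.commute)
    also have "\<dots> \<le> (real N * (2 * R + 3)) ^ ?m"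
    proof (intro power_mono)
      have "2 * real_of_int \<lfloor>real N * R\<rfloor> + 2 \<le> 2 * (real N * R) + 3 * real N"
        using N(1) by (intro add_mono) auto
      also have "\<dots> = real N * (2 * R + 3)" by (simp add: algebra_simps)
      finally show "2 * real_of_int \<lfloor>real N * R\<rfloor> + 2 \<le> real N * (2 * R + 3)" .
    qed (use NR in auto)
    finally have cardK: "real (card K) \<le> (real N * (2 * R + 3)) ^ ?m" .
    have "A \<subseteq> (\<Union>k\<in>K. E k)"
    proof
      fix x assume x: "x \<in> A"
      define k where "k = restrict (\<lambda>b. \<lfloor>real N * (x \<bullet> b)\<rfloor>) Bs"
      have "\<lfloor>real N * (x \<bullet> b)\<rfloor> \<in> {- (\<lfloor>real N * R\<rfloor> + 1) .. \<lfloor>real N * R\<rfloor>}" if "b \<in> Bs" for b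
      proof -
        have "\<bar>x \<bullet> b\<bar> \<le> R"
          using that Bs(1) Basis_le_norm[of b x] R(2)[OF x] by auto
        then have "x \<bullet> b \<le> R" "- R \<le> x \<bullet> b" by auto
        then have "real N * (x \<bullet> b) \<le> real N * R" "real N * - R \<le> real N * (x \<bullet> b)"
          by (intro mult_left_mono; simp)+
        then have *: "real N * (x \<bullet> b) \<le> real N * R" "- (real N * R) \<le> real N * (x \<bullet> b)"
          by simp_all
        have "- (\<lfloor>real N * R\<rfloor> + 1) \<le> \<lfloor>- (real N * R)\<rfloor>" by linarith
        then show ?thesis using floor_mono[OF *(1)] floor_mono[OF *(2)] by auto
      qed
      then have "k \<in> K" by (auto simp: K_def k_def)
      moreover have "x \<in> E k" using x by (simp add: E_def k_def)
      ultimately show "x \<in> (\<Union>k\<in>K. E k)" by blast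
    qed
    moreover have "bounded (E k) \<and> diameter (E k) \<le> d" for k
    proof
      show "bounded (E k)" by (rule bounded_subset[OF A]) (auto simp: E_def)
      have "norm (x - y) \<le> d" if "x \<in> E k" "y \<in> E k" for x y
      proof -
        have "\<bar>(x - y) \<bullet> b\<bar> \<le> 1 / real N" if "b \<in> Bs" for b
        proof -
          have "\<lfloor>real N * (x \<bullet> b)\<rfloor> = \<lfloor>real N * (y \<bullet> b)\<rfloor>"
            using \<open>x \<in> E k\<close> \<open>y \<in> E k\<close> that by (simp add: E_def)
          then have "\<bar>real N * (x \<bullet> b) - real N * (y \<bullet> b)\<bar> \<le> 1" by linarith
          then have "real N * \<bar>(x - y) \<bullet> b\<bar> \<le> 1"
            by (simp add: inner_diff_left right_diff_distrib[symmetric] abs_mult)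
          then show ?thesis using N(1) by (simp add: field_simps)
        qed
        then have "(\<Sum>b\<in>Bs. \<bar>(x - y) \<bullet> b\<bar>) \<le> (\<Sum>b\<in>Bs. 1 / real N)" by (rule sum_mono)
        then have "L * (\<Sum>b\<in>Bs. \<bar>(x - y) \<bullet> b\<bar>) \<le> L * (real ?m / real N)"
          using L by (intro mult_left_mono) auto
        then show ?thesis using graph[of x y] that by (simp add: d_def E_def)
      qed
      then show "diameter (E k) \<le> d" using d by (intro diameter_le) auto
    qed
    ultimately have "hausdorff_pre ?m \<delta> A \<le> ennreal (real (card K) * (?v * (d / 2) ^ ?m))"
      using hausdorff_pre_finite_cover[of ?m K A E d \<delta>] m finK d by blast
    also have "\<dots> \<le> ennreal ((real N * (2 * R + 3)) ^ ?m * (?v * (d / 2) ^ ?m))"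
      using cardK d by (intro ennreal_leI mult_right_mono) auto
    also have "(real N * (2 * R + 3)) ^ ?m * (?v * (d / 2) ^ ?m) = ?v * (real N * (2 * R + 3) * (d / 2)) ^ ?m"
      by (simp only: power_mult_distrib[of "real N * (2 * R + 3)" "d / 2"] mult.left_commute)
    also have "real N * (2 * R + 3) * (d / 2) = (2 * R + 3) * (L * real ?m) / 2"
      using N(1) by (simp add: d_def)
    finally show ?thesis by (simp add: c_def)
  qed
  then have "hausdorff_outer ?m A \<le> ennreal c"
    unfolding hausdorff_outer_def by (intro SUP_least) auto
  then show ?thesis by (simp add: order_le_less_trans)
qed

lemma emeasure_hausdorff_measure:
  assumes "A \<in> sets borel"
  shows "emeasure (hausdorff_measure m :: 'a::euclidean_space measure) A =
    (if measure_space UNIV (sets (borel :: 'a measure)) (hausdorff_outer m) then hausdorff_outer m A else 0)"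
  using assms sets.sigma_sets_eq[of "borel :: 'a measure"]
  by (simp add: hausdorff_measure_def emeasure_measure_of_conv)

lemma sets_hausdorff_measure [simp]: "sets (hausdorff_measure m) = sets borel"
  using sets.sigma_sets_eq[of "borel :: 'a::euclidean_space measure"]
  by (simp add: hausdorff_measure_def sets_measure_of_conv)

lemma space_hausdorff_measure [simp]: "space (hausdorff_measure m) = UNIV"
  by (simp add: hausdorff_measure_def space_measure_of_conv)

text \<open>No Caratheodory argument is needed here: if the outer measure were not countably additive
  on Borel sets, \<^const>\<open>measure_of\<close> would return the null measure.\<close>

lemma hausdorff_measure_le_expanding:
  fixes A S :: "'a::euclidean_space set"
  assumes "A \<in> sets borel" "S \<in> sets borel" "0 < L" "f ` A \<subseteq> S"
    and "\<And>x y. x \<in> A \<Longrightarrow> y \<in> A \<Longrightarrow> norm (x - y) \<le> L * norm (f x - f y)"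
  shows "emeasure (hausdorff_measure m) A \<le> ennreal (L ^ m) * emeasure (hausdorff_measure m) S"
proof -
  have "hausdorff_outer m A \<le> ennreal (L ^ m) * hausdorff_outer m (f ` A)"
    using assms by (intro hausdorff_outer_le_expanding_image) auto
  also have "\<dots> \<le> ennreal (L ^ m) * hausdorff_outer m S"
    using assms by (intro mult_left_mono hausdorff_outer_mono) auto
  finally show ?thesis using assms by (simp add: emeasure_hausdorff_measure)
qed

lemma hausdorff_measure_finite_of_graph:
  fixes A :: "'a::euclidean_space set"
  assumes "A \<in> sets borel" "bounded A" "Bs \<subseteq> Basis" "Bs \<noteq> {}" "0 < L"
    and "\<And>x y. x \<in> A \<Longrightarrow> y \<in> A \<Longrightarrow> norm (x - y) \<le> L * (\<Sum>b\<in>Bs. \<bar>(x - y) \<bullet> b\<bar>)"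
  shows "emeasure (hausdorff_measure (card Bs)) A < \<infinity>"
  using hausdorff_outer_finite_of_graph[of A Bs L] assms by (simp add: emeasure_hausdorff_measure)

section \<open>Hypersurfaces of class \<open>C\<^sup>2\<close>\<close>

text \<open>The quantitative content of a \<open>C^2\<close> defining function with gradient
  \<open>G\<close>. In \<open>taylor\<close> the point \<open>z\<close> may lie off the surface,
  because surface points are later found by moving along the normal until \<rho> changes
  sign.\<close>

locale C2_hypersurface =
  fixes \<rho> :: "'a::euclidean_space \<Rightarrow> real" and G :: "'a \<Rightarrow> 'a" and M m :: real
  assumes cont: "continuous_on UNIV \<rho>"
    and M_pos: "0 < M" and m_pos: "0 < m"
    and taylor: "\<And>w z. \<rho> w = 0 \<Longrightarrow> norm (z - w) \<le> 1 \<Longrightarrow>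
        \<bar>\<rho> z - G w \<bullet> (z - w)\<bar> \<le> M * (norm (z - w))\<^sup>2"
    and G_lipschitz: "\<And>w z. \<rho> w = 0 \<Longrightarrow> \<rho> z = 0 \<Longrightarrow> norm (z - w) \<le> 1 \<Longrightarrow>
        norm (G z - G w) \<le> M * norm (z - w)"
    and G_lower: "\<And>w. \<rho> w = 0 \<Longrightarrow> m \<le> norm (G w)"
begin

lemma closed_surface: "closed {z. \<rho> z = 0}"
  using continuous_closed_vimage[of "{0}" \<rho>] cont
  by (simp add: vimage_def continuous_on_eq_continuous_at)

text \<open>Taylor at \<open>z2\<close> makes the secant tangent there up to second order; replacing
  \<open>G z2\<close> by \<open>G w\<close> costs a further \<open>M * \<eta>\<close> by the
  Lipschitz bound.\<close>

lemma secant_almost_tangent: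
  assumes w: "\<rho> w = 0" and z: "\<rho> z1 = 0" "\<rho> z2 = 0"
    and \<eta>: "norm (z1 - w) \<le> \<eta>" "norm (z2 - w) \<le> \<eta>" "\<eta> \<le> 1 / 2"
  shows "\<bar>G w \<bullet> (z1 - z2)\<bar> \<le> 3 * M * \<eta> * norm (z1 - z2)"
proof -
  have d: "norm (z1 - z2) \<le> 2 * \<eta>"
    using norm_triangle_ineq4[of "z1 - w" "z2 - w"] \<eta> by simp
  have "\<bar>G z2 \<bullet> (z1 - z2)\<bar> \<le> M * (norm (z1 - z2))\<^sup>2"
    using taylor[OF z(2), of z1] z(1) d \<eta>(3) by simp
  also have "\<dots> \<le> M * (2 * \<eta> * norm (z1 - z2))"
    using d M_pos by (intro mult_left_mono) (auto simp: power2_eq_square mult_right_mono)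
  finally have 1: "\<bar>G z2 \<bullet> (z1 - z2)\<bar> \<le> 2 * M * \<eta> * norm (z1 - z2)" by (simp add: mult_ac)
  have "\<bar>(G z2 - G w) \<bullet> (z1 - z2)\<bar> \<le> norm (G z2 - G w) * norm (z1 - z2)"
    by (rule Cauchy_Schwarz_ineq2)
  also have "\<dots> \<le> M * \<eta> * norm (z1 - z2)"
    using G_lipschitz[OF w z(2)] \<eta> M_pos
    by (intro mult_right_mono) (auto intro: order_trans mult_left_mono)
  finally show ?thesis using 1 by (simp add: inner_diff_left)
qed

text \<open>Near \<open>w\<close> the surface is a Lipschitz graph over the coordinates other than
  some \<open>e\<close> not orthogonal to \<open>G w\<close>: a secant almost orthogonal to
  \<open>G w\<close> has its \<open>e\<close> component controlled by the others. Compactness leaves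
  finitely many such pieces.\<close>

lemma hausdorff_measure_surface_finite:
  assumes bdd: "bounded {z. \<rho> z = 0}" and dim: "2 \<le> DIM('a)"
  shows "emeasure (hausdorff_measure (DIM('a) - 1)) {z. \<rho> z = 0} < \<infinity>"
proof -
  let ?S = "{z. \<rho> z = 0}" and ?H = "hausdorff_measure (DIM('a) - 1) :: 'a measure"
  have "\<exists>\<eta>>0. emeasure ?H (?S \<inter> ball w \<eta>) < \<infinity>" if w: "w \<in> ?S" for w
  proof -
    have "G w \<noteq> 0" using G_lower[of w] w m_pos by auto
    then obtain e where e: "e \<in> Basis" "G w \<bullet> e \<noteq> 0" using euclidean_eq_iff[of "G w" 0] by auto
    define \<gamma> where "\<gamma> = \<bar>G w \<bullet> e\<bar>"
    have \<gamma>: "0 < \<gamma>" using e by (simp add: \<gamma>_def)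
    \<comment> \<open>On this radius the secant bound \<open>3 * M * \<eta>\<close> is at most
      \<open>\<gamma> / 2\<close>, so the \<open>e\<close> component on the right can be absorbed
      into the left.\<close>
    define \<eta> where "\<eta> = min (1 / 2) (\<gamma> / (6 * M))"
    have \<eta>: "0 < \<eta>" "\<eta> \<le> 1 / 2" "3 * M * \<eta> \<le> \<gamma> / 2"
      using \<gamma> M_pos by (auto simp: \<eta>_def min_def field_simps)
    define L where "L = 2 + 2 * norm (G w) / \<gamma>"
    let ?Bs = "Basis - {e} :: 'a set"
    have "norm (x - y) \<le> L * (\<Sum>b\<in>?Bs. \<bar>(x - y) \<bullet> b\<bar>)"
      if x: "x \<in> ?S \<inter> ball w \<eta>" and y: "y \<in> ?S \<inter> ball w \<eta>" for x y
    proof -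
      define \<Delta> where "\<Delta> = x - y"
      define s where "s = (\<Sum>b\<in>?Bs. \<bar>\<Delta> \<bullet> b\<bar>)"
      have n: "norm \<Delta> \<le> \<bar>\<Delta> \<bullet> e\<bar> + s"
        using norm_le_l1[of \<Delta>] e(1) by (simp add: s_def sum.remove)
      have "\<bar>G w \<bullet> \<Delta>\<bar> \<le> 3 * M * \<eta> * norm \<Delta>"
        unfolding \<Delta>_def using x y w \<eta> by (intro secant_almost_tangent) (auto simp: dist_norm norm_minus_commute)
      also have "\<dots> \<le> \<gamma> / 2 * norm \<Delta>" using \<eta>(3) by (intro mult_right_mono) auto
      also have "\<dots> \<le> \<gamma> / 2 * (\<bar>\<Delta> \<bullet> e\<bar> + s)" using n \<gamma> by (intro mult_left_mono) auto
      finally have 1: "\<bar>G w \<bullet> \<Delta>\<bar> \<le> \<gamma> / 2 * (\<bar>\<Delta> \<bullet> e\<bar> + s)" .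
      have "G w \<bullet> \<Delta> = (\<Sum>b\<in>Basis. (G w \<bullet> b) * (\<Delta> \<bullet> b))" by (rule euclidean_inner)
      also have "\<dots> = (G w \<bullet> e) * (\<Delta> \<bullet> e) + (\<Sum>b\<in>?Bs. (G w \<bullet> b) * (\<Delta> \<bullet> b))"
        using e(1) by (simp add: sum.remove)
      finally have 2: "G w \<bullet> \<Delta> = (G w \<bullet> e) * (\<Delta> \<bullet> e) + (\<Sum>b\<in>?Bs. (G w \<bullet> b) * (\<Delta> \<bullet> b))" .
      have "\<bar>\<Sum>b\<in>?Bs. (G w \<bullet> b) * (\<Delta> \<bullet> b)\<bar> \<le> (\<Sum>b\<in>?Bs. norm (G w) * \<bar>\<Delta> \<bullet> b\<bar>)"
        by (rule order_trans[OF sum_abs sum_mono])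
          (auto simp: abs_mult Basis_le_norm intro!: mult_right_mono)
      then have 3: "\<bar>\<Sum>b\<in>?Bs. (G w \<bullet> b) * (\<Delta> \<bullet> b)\<bar> \<le> norm (G w) * s"
        by (simp add: s_def sum_distrib_left)
      have "\<gamma> * \<bar>\<Delta> \<bullet> e\<bar> = \<bar>(G w \<bullet> e) * (\<Delta> \<bullet> e)\<bar>" by (simp add: \<gamma>_def abs_mult)
      then have "\<gamma> * \<bar>\<Delta> \<bullet> e\<bar> \<le> \<gamma> / 2 * (\<bar>\<Delta> \<bullet> e\<bar> + s) + norm (G w) * s"
        using 1 2 3 by linarith
      then have "\<bar>\<Delta> \<bullet> e\<bar> \<le> (1 + 2 * norm (G w) / \<gamma>) * s"
        using \<gamma> by (simp add: field_simps)
      then show ?thesis using n by (simp add: \<Delta>_def[symmetric] s_def[symmetric] L_def algebra_simps)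
    qed
    moreover have "?Bs \<noteq> {}"
    proof
      assume "?Bs = {}"
      then have "card (Basis :: 'a set) \<le> card {e}" by (intro card_mono) auto
      then show False using dim by simp
    qed
    moreover have "0 < L" using \<gamma> by (simp add: L_def add_pos_nonneg)
    moreover have "card ?Bs = DIM('a) - 1" using e(1) by simp
    moreover have "?S \<inter> ball w \<eta> \<in> sets borel" using closed_surface by (intro sets.Int) auto
    moreover have "bounded (?S \<inter> ball w \<eta>)" by (meson bounded_Int bounded_ball)
    ultimately have "emeasure ?H (?S \<inter> ball w \<eta>) < \<infinity>"
      using hausdorff_measure_finite_of_graph[of "?S \<inter> ball w \<eta>" ?Bs L] by auto
    then show ?thesis using \<eta> by blast
  qed
  then obtain \<eta> where \<eta>: "\<And>w. w \<in> ?S \<Longrightarrow> 0 < \<eta> w \<and> emeasure ?H (?S \<inter> ball w (\<eta> w)) < \<infinity>" by metis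
  have "compact ?S" using bdd closed_surface by (simp add: compact_eq_bounded_closed)
  then obtain T where T: "T \<subseteq> ?S" "finite T" "?S \<subseteq> (\<Union>w\<in>T. ball w (\<eta> w))"
    using compactE_image[of ?S ?S "\<lambda>w. ball w (\<eta> w)"] \<eta> by (metis (no_types, lifting) UN_I centre_in_ball open_ball subsetI)
  have meas: "?S \<inter> ball w (\<eta> w) \<in> sets ?H" for w
    using closed_surface by auto
  have "emeasure ?H ?S \<le> emeasure ?H (\<Union>w\<in>T. ?S \<inter> ball w (\<eta> w))"
    using T meas by (intro emeasure_mono sets.finite_UN) auto
  also have "\<dots> \<le> (\<Sum>w\<in>T. emeasure ?H (?S \<inter> ball w (\<eta> w)))"
    using T meas by (intro emeasure_subadditive_finite) auto
  also have "\<dots> < \<infinity>" using \<eta> T by (auto simp: ennreal_sum_less_top)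
  finally show ?thesis .
qed

text \<open>Extent of order \<open>s\<close> along \<tau> but only \<open>sqrt s\<close> as
  constraint in the other tangential directions: up to constants the shape of a quasi-distance ball
  of squared radius \<open>s\<close>, once \<tau> is i times the unit normal.\<close>

definition surface_box :: "'a \<Rightarrow> 'a \<Rightarrow> real \<Rightarrow> 'a set" where
  "surface_box w \<tau> s = {z. \<rho> z = 0 \<and> \<bar>(z - w) \<bullet> \<tau>\<bar> + (norm (z - w))\<^sup>2 < s}"

lemma surface_box_borel [measurable]: "surface_box w \<tau> s \<in> sets borel"
proof -
  have "surface_box w \<tau> s = {z. \<rho> z = 0} \<inter> {z. \<bar>(z - w) \<bullet> \<tau>\<bar> + (norm (z - w))\<^sup>2 < s}"
    by (auto simp: surface_box_def)
  moreover have "open {z. \<bar>(z - w) \<bullet> \<tau>\<bar> + (norm (z - w))\<^sup>2 < s}"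
    by (intro open_Collect_less continuous_intros)
  ultimately show ?thesis using closed_surface by auto
qed

text \<open>Intermediate value theorem along the normal. At height \<open>s0\<close> the linear
  growth \<open>norm (G w) * s\<close> of \<rho> balances the quadratic Taylor error, so \<rho> has
  opposite weak signs at \<open>- s0\<close> and \<open>s0\<close>.\<close>

lemma exists_surface_point_above:
  assumes w: "\<rho> w = 0" and u: "u \<bullet> G w = 0" and small: "norm u \<le> 1 / 2" "2 * M / m * norm u \<le> 1"
  obtains s where "\<rho> (w + u + s *\<^sub>R sgn (G w)) = 0" "\<bar>s\<bar> \<le> norm u"
proof -
  define s0 where "s0 = 2 * M / m * (norm u)\<^sup>2"
  define \<phi> where "\<phi> = (\<lambda>s. \<rho> (w + u + s *\<^sub>R sgn (G w)))"
  have s0: "0 \<le> s0" "s0 \<le> norm u"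
    using M_pos m_pos mult_right_mono[OF small(2), of "norm u"]
    by (auto simp: s0_def power2_eq_square mult.assoc)
  have Gw: "norm (G w) \<noteq> 0" using G_lower[OF w] m_pos by auto
  have *: "\<bar>\<phi> s - norm (G w) * s\<bar> \<le> norm (G w) * s0" if s: "\<bar>s\<bar> \<le> s0" for s
  proof -
    let ?h = "u + s *\<^sub>R sgn (G w)"
    have "norm ?h \<le> norm u + \<bar>s\<bar>"
      using norm_triangle_ineq[of u "s *\<^sub>R sgn (G w)"] Gw by (simp add: norm_sgn)
    then have h1: "norm ?h \<le> 1" using s s0 small by linarith
    have "(norm ?h)\<^sup>2 = (norm u)\<^sup>2 + s\<^sup>2 * (norm (sgn (G w)))\<^sup>2"
      using u norm_add_Pythagorean[of u "s *\<^sub>R sgn (G w)"]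
      by (simp add: orthogonal_def sgn_div_norm power_mult_distrib)
    also have "\<dots> \<le> (norm u)\<^sup>2 + (norm u)\<^sup>2"
      using Gw s s0 by (intro add_left_mono) (auto simp: norm_sgn abs_le_square_iff[symmetric])
    finally have h2: "(norm ?h)\<^sup>2 \<le> 2 * (norm u)\<^sup>2" by simp
    have "G w \<bullet> ?h = s * norm (G w)"
      using u Gw by (simp add: inner_simps sgn_div_norm inner_commute power2_norm_eq_inner[symmetric] power2_eq_square)
    then have "\<bar>\<phi> s - norm (G w) * s\<bar> \<le> M * (norm ?h)\<^sup>2"
      using taylor[OF w, of "w + ?h"] h1 by (simp add: \<phi>_def add.assoc mult.commute)
    also have "\<dots> \<le> M * (2 * (norm u)\<^sup>2)" using h2 M_pos by (intro mult_left_mono) auto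
    also have "\<dots> = m * s0" using m_pos by (simp add: s0_def)
    also have "\<dots> \<le> norm (G w) * s0" using G_lower[OF w] s0 by (intro mult_right_mono) auto
    finally show ?thesis .
  qed
  have "\<phi> (- s0) \<le> 0" "0 \<le> \<phi> s0" using *[of "- s0"] *[of s0] s0 by auto
  moreover have "continuous_on {- s0..s0} \<phi>"
    unfolding \<phi>_def by (intro continuous_on_compose2[OF cont] continuous_intros) auto
  ultimately obtain s where "- s0 \<le> s" "s \<le> s0" "\<phi> s = 0"
    using IVT'[of \<phi> "- s0" 0 s0] s0 by auto
  then show thesis using that[of s] s0 by (auto simp: \<phi>_def)
qed

text \<open>The surface measure is never computed: the anisotropic contraction
  \<open>t \<tau> + v \<mapsto> q\<^sup>2 t \<tau> + q v\<close> of the tangent space, lifted to the surface, maps a large box into a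
  small one, and its inverse is Lipschitz.\<close>

lemma surface_box_measure_doubling:
  obtains s0 where "0 < s0"
    "\<And>w \<tau> s q k. \<rho> w = 0 \<Longrightarrow> norm \<tau> = 1 \<Longrightarrow> \<tau> \<bullet> G w = 0 \<Longrightarrow> s \<le> s0 \<Longrightarrow> 0 < q \<Longrightarrow> q \<le> 1 \<Longrightarrow>
      emeasure (hausdorff_measure k) (surface_box w \<tau> s) \<le>
      ennreal ((2 / q\<^sup>2) ^ k) * emeasure (hausdorff_measure k) (surface_box w \<tau> (2 * q\<^sup>2 * s))"
proof -
  \<comment> \<open>The bound \<open>3 * M * \<eta> \<le> m / 2\<close> keeps the normal component
    of a secant below half its length; \<open>2 * M / m * \<eta> \<le> 1\<close> is what the lift to
    the surface requires.\<close>
  define \<eta> where "\<eta> = min (1 / 2) (m / (6 * M))"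
  have \<eta>: "0 < \<eta>" "\<eta> \<le> 1 / 2" "3 * M * \<eta> \<le> m / 2" "2 * M / m * \<eta> \<le> 1"
    using M_pos m_pos by (auto simp: \<eta>_def min_def field_simps)
  show thesis
  proof (rule that[of "\<eta>\<^sup>2"])
    show "0 < \<eta>\<^sup>2" using \<eta> by simp
    fix w \<tau> s q k
    assume w: "\<rho> w = 0" and \<tau>: "norm \<tau> = 1" "\<tau> \<bullet> G w = 0" and s: "s \<le> \<eta>\<^sup>2" and q: "0 < (q::real)" "q \<le> 1"
    define \<nu> where "\<nu> = sgn (G w)"
    have Gw: "norm (G w) \<noteq> 0" using G_lower[OF w] m_pos by auto
    have G_\<nu>: "G w = norm (G w) *\<^sub>R \<nu>" using Gw by (simp add: \<nu>_def sgn_div_norm)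
    have on: "\<nu> \<bullet> \<nu> = 1" "\<tau> \<bullet> \<tau> = 1" "\<nu> \<bullet> \<tau> = 0" "\<tau> \<bullet> \<nu> = 0"
      using \<tau> Gw by (auto simp: \<nu>_def norm_sgn sgn_div_norm inner_commute power2_norm_eq_inner[symmetric] power2_eq_square)
    define P where "P = (\<lambda>h. h - (h \<bullet> \<nu>) *\<^sub>R \<nu>)"
    \<comment> \<open>\<open>P\<close> projects onto the tangent hyperplane. \<open>A\<close> acts
      there as \<open>q\<^sup>2\<close> along \<tau> and as \<open>q\<close> across it, so that both
      terms in the size of a box scale by \<open>q\<^sup>2\<close>.\<close>
    define A where "A = (\<lambda>h. q *\<^sub>R P h + (q\<^sup>2 - q) *\<^sub>R ((h \<bullet> \<tau>) *\<^sub>R \<tau>))"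
    have P_sq: "(norm (P h))\<^sup>2 = (norm h)\<^sup>2 - (h \<bullet> \<nu>)\<^sup>2" for h
      using on by (simp add: P_def power2_norm_eq_inner inner_simps inner_commute[of \<nu> h]) (simp add: power2_eq_square)
    have P_\<tau>: "P h \<bullet> \<tau> = h \<bullet> \<tau>" for h using on by (simp add: P_def inner_simps)
    have P_ge: "(h \<bullet> \<tau>)\<^sup>2 \<le> (norm (P h))\<^sup>2" for h
      using Cauchy_Schwarz_ineq2[of "P h" \<tau>] \<tau>(1) by (simp add: P_\<tau> abs_le_square_iff[symmetric])
    have A_sq: "(norm (A h))\<^sup>2 = q\<^sup>2 * (norm (P h))\<^sup>2 + (q^4 - q\<^sup>2) * (h \<bullet> \<tau>)\<^sup>2" for h
      using on P_\<tau>[of h]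
      by (simp add: A_def power2_norm_eq_inner inner_simps inner_commute[of \<tau> "P h"])
        (simp add: power2_eq_square power4_eq_xxxx algebra_simps)
    have A_\<nu>: "A h \<bullet> \<nu> = 0" for h using on by (simp add: A_def P_def inner_simps)
    have A_\<tau>: "A h \<bullet> \<tau> = q\<^sup>2 * (h \<bullet> \<tau>)" for h
      using on P_\<tau>[of h] by (simp add: A_def inner_simps algebra_simps)
    have A_diff: "A (h - h') = A h - A h'" for h h'
      by (simp add: A_def P_def inner_simps algebra_simps)
    have q4: "q^4 \<le> q\<^sup>2" using q by (intro power_decreasing) auto
    have A_le: "norm (A h) \<le> q * norm h" for h
    proof (rule power2_le_imp_le)
      have "(norm (A h))\<^sup>2 \<le> q\<^sup>2 * (norm (P h))\<^sup>2"
        unfolding A_sq using q4 by (simp add: mult_nonpos_nonneg)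
      also have "\<dots> \<le> q\<^sup>2 * (norm h)\<^sup>2" unfolding P_sq by (intro mult_left_mono) auto
      finally show "(norm (A h))\<^sup>2 \<le> (q * norm h)\<^sup>2" by (simp add: power_mult_distrib)
    qed (use q in auto)
    have A_ge: "q\<^sup>2 * norm (P h) \<le> norm (A h)" for h
    proof (rule power2_le_imp_le)
      have "(q\<^sup>2 - q^4) * (h \<bullet> \<tau>)\<^sup>2 \<le> (q\<^sup>2 - q^4) * (norm (P h))\<^sup>2"
        using q4 P_ge by (intro mult_left_mono) auto
      then show "(q\<^sup>2 * norm (P h))\<^sup>2 \<le> (norm (A h))\<^sup>2"
        unfolding A_sq by (simp add: power_mult_distrib algebra_simps flip: power_mult)
    qed auto
    have small: "norm (z - w) < \<eta>" if "z \<in> surface_box w \<tau> s" for z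
    proof -
      have "(norm (z - w))\<^sup>2 < \<eta>\<^sup>2" using that s unfolding surface_box_def by auto
      then show ?thesis using \<eta>(1) by (meson less_imp_le power2_less_imp_less)
    qed
    have "\<exists>t. \<rho> (w + A (z - w) + t *\<^sub>R \<nu>) = 0 \<and> \<bar>t\<bar> \<le> norm (A (z - w))" if z: "z \<in> surface_box w \<tau> s" for z
    proof -
      have "norm (A (z - w)) \<le> norm (z - w)"
        using A_le[of "z - w"] q mult_left_le_one_le[of "norm (z - w)" q] by auto
      then have "norm (A (z - w)) \<le> \<eta>" using small[OF z] by linarith
      moreover from this have "2 * M / m * norm (A (z - w)) \<le> 1"
        using M_pos m_pos by (intro order_trans[OF mult_left_mono \<eta>(4)]) auto
      moreover have "A (z - w) \<bullet> G w = 0" by (subst G_\<nu>) (simp add: A_\<nu>)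
      ultimately show ?thesis
        using exists_surface_point_above[OF w, of "A (z - w)"] \<eta>(2) unfolding \<nu>_def
        by (metis order_trans)
    qed
    then obtain t where t: "\<And>z. z \<in> surface_box w \<tau> s \<Longrightarrow>
        \<rho> (w + A (z - w) + t z *\<^sub>R \<nu>) = 0 \<and> \<bar>t z\<bar> \<le> norm (A (z - w))" by metis
    \<comment> \<open>The heights \<open>t z\<close> result from a choice and need not depend
      continuously on \<open>z\<close>: what matters is that the inverse of \<open>f\<close> is
      Lipschitz, and differing normal heights can only move image points further apart.\<close>
    define f where "f = (\<lambda>z. w + A (z - w) + t z *\<^sub>R \<nu>)"
    have sq: "(norm (A h + c *\<^sub>R \<nu>))\<^sup>2 = (norm (A h))\<^sup>2 + c\<^sup>2" for h c
      using on A_\<nu>[of h] by (simp add: power2_norm_eq_inner inner_simps inner_commute[of \<nu> "A h"]) (simp add: power2_eq_square)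
    have "f z \<in> surface_box w \<tau> (2 * q\<^sup>2 * s)" if z: "z \<in> surface_box w \<tau> s" for z
    proof -
      have eq: "f z - w = A (z - w) + t z *\<^sub>R \<nu>" by (simp add: f_def)
      have 1: "\<bar>(f z - w) \<bullet> \<tau>\<bar> = q\<^sup>2 * \<bar>(z - w) \<bullet> \<tau>\<bar>"
        unfolding eq using on by (simp add: inner_add_left A_\<tau> abs_mult)
      \<comment> \<open>The lift is no longer than \<open>A (z - w)\<close> and orthogonal to it, so
        it at most doubles the squared norm; hence the factor 2 in the size of the target
        box.\<close>
      have "(norm (f z - w))\<^sup>2 \<le> 2 * (norm (A (z - w)))\<^sup>2"
        unfolding eq sq using t[OF z] by (simp add: abs_le_square_iff[symmetric])
      also have "\<dots> \<le> 2 * (q * norm (z - w))\<^sup>2" using A_le[of "z - w"] by (intro mult_left_mono power_mono) auto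
      finally have 2: "(norm (f z - w))\<^sup>2 \<le> 2 * q\<^sup>2 * (norm (z - w))\<^sup>2" by (simp add: power_mult_distrib)
      have "q\<^sup>2 * \<bar>(z - w) \<bullet> \<tau>\<bar> \<le> 2 * q\<^sup>2 * \<bar>(z - w) \<bullet> \<tau>\<bar>" by (intro mult_right_mono) auto
      then have "\<bar>(f z - w) \<bullet> \<tau>\<bar> + (norm (f z - w))\<^sup>2 \<le> 2 * q\<^sup>2 * (\<bar>(z - w) \<bullet> \<tau>\<bar> + (norm (z - w))\<^sup>2)"
        using 1 2 by (simp add: distrib_left)
      also have "\<dots> < 2 * q\<^sup>2 * s" using z q by (intro mult_strict_left_mono) (auto simp: surface_box_def)
      finally show ?thesis using t[OF z] by (simp add: surface_box_def f_def)
    qed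
    moreover have "norm (z1 - z2) \<le> 2 / q\<^sup>2 * norm (f z1 - f z2)"
      if z: "z1 \<in> surface_box w \<tau> s" "z2 \<in> surface_box w \<tau> s" for z1 z2
    proof -
      define \<Delta> where "\<Delta> = z1 - z2"
      have "\<bar>G w \<bullet> \<Delta>\<bar> \<le> 3 * M * \<eta> * norm \<Delta>"
        unfolding \<Delta>_def using small z \<eta> w
        by (intro secant_almost_tangent) (auto simp: surface_box_def intro!: less_imp_le)
      also have "\<dots> \<le> m / 2 * norm \<Delta>" using \<eta>(3) by (intro mult_right_mono) auto
      finally have "norm (G w) * \<bar>\<nu> \<bullet> \<Delta>\<bar> \<le> m / 2 * norm \<Delta>"
        by (subst (asm) G_\<nu>) (simp add: abs_mult)
      moreover have "m * \<bar>\<nu> \<bullet> \<Delta>\<bar> \<le> norm (G w) * \<bar>\<nu> \<bullet> \<Delta>\<bar>"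
        using G_lower[OF w] by (intro mult_right_mono) auto
      ultimately have "m * \<bar>\<nu> \<bullet> \<Delta>\<bar> \<le> m * (norm \<Delta> / 2)" by simp
      then have "\<bar>\<Delta> \<bullet> \<nu>\<bar> \<le> norm \<Delta> / 2" using m_pos by (simp add: inner_commute)
      then have "(\<Delta> \<bullet> \<nu>)\<^sup>2 \<le> (norm \<Delta> / 2)\<^sup>2" by (simp add: abs_le_square_iff[symmetric])
      moreover have "2 * (norm \<Delta> / 2)\<^sup>2 \<le> (norm \<Delta>)\<^sup>2" by (simp add: power_divide)
      ultimately have "(norm \<Delta> / 2)\<^sup>2 \<le> (norm (P \<Delta>))\<^sup>2"
        unfolding P_sq by linarith
      then have "norm \<Delta> / 2 \<le> norm (P \<Delta>)" by (rule power2_le_imp_le) simp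
      then have "q\<^sup>2 * (norm \<Delta> / 2) \<le> q\<^sup>2 * norm (P \<Delta>)" by (intro mult_left_mono) auto
      also have "\<dots> \<le> norm (A \<Delta>)" by (rule A_ge)
      also have "\<dots> \<le> norm (A \<Delta> + (t z1 - t z2) *\<^sub>R \<nu>)"
        by (rule power2_le_imp_le) (simp_all add: sq)
      also have "A \<Delta> + (t z1 - t z2) *\<^sub>R \<nu> = f z1 - f z2"
        using A_diff[of "z1 - w" "z2 - w"] by (simp add: f_def \<Delta>_def algebra_simps)
      finally show ?thesis using q by (simp add: \<Delta>_def field_simps)
    qed
    ultimately show "emeasure (hausdorff_measure k) (surface_box w \<tau> s) \<le>
      ennreal ((2 / q\<^sup>2) ^ k) * emeasure (hausdorff_measure k) (surface_box w \<tau> (2 * q\<^sup>2 * s))"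
      using q by (intro hausdorff_measure_le_expanding[where f=f]) auto
  qed
qed

end

section \<open>Engulfing and doubling for balls of a quasi-distance with box-shaped model\<close>

context C2_hypersurface
begin

text \<open>\<open>d\<close> is the squared quasi-distance and \<open>N\<close> its model below
  scale \<open>r1\<close>, every comparison costing a factor \<open>K\<close>. Engulfing chains the
  model triangle inequality through \<open>u\<close>, \<open>y\<close>, \<open>z\<close>,
  \<open>x\<close>; doubling squeezes the balls between boxes.\<close>

lemma quasi_ball_system:
  fixes d N :: "'a \<Rightarrow> 'a \<Rightarrow> real" and \<tau> :: "'a \<Rightarrow> 'a" and c K r1 :: real and k :: nat
  defines "\<B> \<equiv> \<lambda>x r. {z. \<rho> z = 0 \<and> sqrt (d z x) < r}"
  assumes c: "0 < c" and K: "1 \<le> K" and r1: "0 < r1"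
    and \<tau>: "\<And>w. \<rho> w = 0 \<Longrightarrow> norm (\<tau> w) = 1 \<and> \<tau> w \<bullet> G w = 0"
    and lower: "\<And>z w. \<rho> z = 0 \<Longrightarrow> \<rho> w = 0 \<Longrightarrow> c * (norm (z - w))\<^sup>2 \<le> d z w"
    and d_N: "\<And>z w. \<rho> z = 0 \<Longrightarrow> \<rho> w = 0 \<Longrightarrow> norm (z - w) \<le> r1 \<Longrightarrow>
        N z w \<le> K * d z w \<and> d z w \<le> K * N z w"
    and N_sym: "\<And>z w. \<rho> z = 0 \<Longrightarrow> \<rho> w = 0 \<Longrightarrow> norm (z - w) \<le> r1 \<Longrightarrow> N z w \<le> K * N w z"
    and N_triangle: "\<And>x y z. \<rho> x = 0 \<Longrightarrow> \<rho> y = 0 \<Longrightarrow> \<rho> z = 0 \<Longrightarrow>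
        norm (x - y) \<le> r1 \<Longrightarrow> norm (y - z) \<le> r1 \<Longrightarrow> N x z \<le> K * (N x y + N y z)"
    and N_box: "\<And>w z. \<rho> w = 0 \<Longrightarrow> \<rho> z = 0 \<Longrightarrow> norm (w - z) \<le> r1 \<Longrightarrow>
        \<bar>(z - w) \<bullet> \<tau> w\<bar> + (norm (z - w))\<^sup>2 \<le> K * N w z \<and>
        N w z \<le> K * (\<bar>(z - w) \<bullet> \<tau> w\<bar> + (norm (z - w))\<^sup>2)"
    and \<B>_borel: "\<And>x r. \<B> x r \<in> sets borel"
  obtains r0 q C where "0 < r0" "0 < q" "q < 1" "0 < C"
    "\<And>x y i j. \<rho> x = 0 \<Longrightarrow> \<rho> y = 0 \<Longrightarrow> i \<le> j \<Longrightarrow>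
        \<B> x (r0 * q ^ Suc i) \<inter> \<B> y (r0 * q ^ Suc j) \<noteq> {} \<Longrightarrow> \<B> y (r0 * q ^ Suc j) \<subseteq> \<B> x (r0 * q ^ i)"
    "\<And>x j. \<rho> x = 0 \<Longrightarrow> emeasure (hausdorff_measure k) (\<B> x (r0 * q ^ j)) \<le>
        ennreal C * emeasure (hausdorff_measure k) (\<B> x (r0 * q ^ Suc j))"
proof -
  obtain s0 where s0: "0 < s0"
    "\<And>w \<tau> s q. \<rho> w = 0 \<Longrightarrow> norm \<tau> = 1 \<Longrightarrow> \<tau> \<bullet> G w = 0 \<Longrightarrow> s \<le> s0 \<Longrightarrow> 0 < q \<Longrightarrow> q \<le> 1 \<Longrightarrow>
      emeasure (hausdorff_measure k) (surface_box w \<tau> s) \<le>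
      ennreal ((2 / q\<^sup>2) ^ k) * emeasure (hausdorff_measure k) (surface_box w \<tau> (2 * q\<^sup>2 * s))"
    using surface_box_measure_doubling by metis
  have K_pos: "0 < K" using K by simp
  \<comment> \<open>The chain in \<open>engulf\<close> ends with
    \<open>d u x < 3 * K ^ 5 * s (Suc i)\<close>. Since \<open>s (Suc i) = q\<^sup>2 * s i\<close>,
    one factor \<open>q\<close> pays for the constants.\<close>
  define q where "q = 1 / (3 * K ^ 5)"
  have "1 \<le> K ^ 5" using K by simp
  then have q: "0 < q" "q < 1" "q * (3 * K ^ 5) = 1" using K_pos by (auto simp: q_def field_simps)
  \<comment> \<open>Squared radius of the largest balls. The entries serve, in order: to keep ball
    points within \<open>r1 / 3\<close> of the centre, so that chains of three stay within
    \<open>r1\<close>; to make outer boxes small enough for box doubling; to keep inner boxes within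
    \<open>r1\<close>.\<close>
  define S where "S = Min {c * r1\<^sup>2 / 9, s0 / K ^ 3, r1\<^sup>2}"
  have S: "0 < S" "9 * S \<le> c * r1\<^sup>2" "K ^ 3 * S \<le> s0" "S \<le> r1\<^sup>2"
  proof -
    have "S \<le> c * r1\<^sup>2 / 9" "S \<le> s0 / K ^ 3" "S \<le> r1\<^sup>2"
      unfolding S_def by (intro Min_le; simp)+
    then show "9 * S \<le> c * r1\<^sup>2" "K ^ 3 * S \<le> s0" "S \<le> r1\<^sup>2"
      using K_pos by (auto simp: field_simps)
    show "0 < S" using c r1 s0(1) K_pos by (auto simp: S_def)
  qed
  define r0 where "r0 = sqrt S"
  have r0: "0 < r0" "r0\<^sup>2 = S" using S by (auto simp: r0_def)
  define s where "s = (\<lambda>j::nat. (r0 * q ^ j)\<^sup>2)"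
  have s_pos: "0 < s j" for j using r0 q by (simp add: s_def)
  have s_Suc: "s (Suc j) = q\<^sup>2 * s j" for j by (simp add: s_def power_mult_distrib mult_ac)
  have s_anti: "s j \<le> s i" if "i \<le> j" for i j
    using that r0 q unfolding s_def by (intro power_mono mult_left_mono power_decreasing) auto
  have s_le: "s j \<le> S" for j using s_anti[of 0 j] r0 by (simp add: s_def)
  have \<B>_iff: "z \<in> \<B> x (r0 * q ^ j) \<longleftrightarrow> \<rho> z = 0 \<and> d z x < s j" for z x j
  proof -
    have "sqrt (d z x) < r0 * q ^ j \<longleftrightarrow> sqrt (d z x) < sqrt (s j)"
      using r0 q by (simp add: s_def)
    then show ?thesis by (simp add: \<B>_def)
  qed
  have close: "norm (z - w) \<le> r1 / 3" if "\<rho> z = 0" "\<rho> w = 0" "d z w < s j" for z w j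
  proof (rule power2_le_imp_le)
    have "c * (norm (z - w))\<^sup>2 \<le> c * (r1\<^sup>2 / 9)"
      using lower[OF that(1,2)] that(3) s_le[of j] S(2) by linarith
    then show "(norm (z - w))\<^sup>2 \<le> (r1 / 3)\<^sup>2" using c by (simp add: power_divide)
  qed (use r1 in simp)
  have engulf: "\<B> y (r0 * q ^ Suc j) \<subseteq> \<B> x (r0 * q ^ i)"
    if x: "\<rho> x = 0" and y: "\<rho> y = 0" and "i \<le> j"
      and meet: "\<B> x (r0 * q ^ Suc i) \<inter> \<B> y (r0 * q ^ Suc j) \<noteq> {}" for x y i j
  proof
    obtain z where z: "\<rho> z = 0" "d z x < s (Suc i)" "d z y < s (Suc j)"
      using meet unfolding \<B>_iff[abs_def] by (auto simp: \<B>_iff simp del: power_Suc)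
    fix u assume "u \<in> \<B> y (r0 * q ^ Suc j)"
    then have u: "\<rho> u = 0" "d u y < s (Suc j)" by (auto simp: \<B>_iff simp del: power_Suc)
    let ?s = "s (Suc i)"
    have ji: "s (Suc j) \<le> ?s" using s_anti \<open>i \<le> j\<close> by simp
    have near: "norm (z - x) \<le> r1 / 3" "norm (z - y) \<le> r1 / 3" "norm (u - y) \<le> r1 / 3"
      using close z u x y by blast+
    have yx: "norm (y - x) \<le> 2 * (r1 / 3)"
      using norm_triangle_ineq4[of "z - x" "z - y"] near by simp
    have ux: "norm (u - x) \<le> r1"
      using norm_triangle_ineq[of "u - y" "y - x"] near yx by simp
    have le_r1: "a \<le> r1" if "a \<le> r1 / 3" for a using that r1 by simp
    have near': "norm (z - x) \<le> r1" "norm (z - y) \<le> r1" "norm (u - y) \<le> r1" "norm (y - x) \<le> r1"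
      using near[THEN le_r1] yx r1 by auto
    have K_le: "K * a \<le> K * b" if "a \<le> b" for a b using that K_pos by simp
    have K_less: "K * a < K * b" if "a < b" for a b using that K_pos by simp
    have "N z x \<le> K * d z x" "N z y \<le> K * d z y" "N u y \<le> K * d u y"
      using d_N z u x y near' by blast+
    moreover have "K * d z x < K * ?s" "K * d z y < K * ?s" "K * d u y < K * ?s"
      using z u ji by (auto intro!: K_less)
    ultimately have 1: "N z x < K * ?s" "N z y < K * ?s" "N u y < K * ?s" by linarith+
    have "N y z \<le> K * N z y"
      using N_sym[OF y z(1)] near' by (simp add: norm_minus_commute)
    then have 2: "N y z < K * (K * ?s)" using K_less[OF 1(2)] by linarith
    have "N y x \<le> K * (N y z + N z x)"
      using N_triangle[OF y z(1) x] near' by (simp add: norm_minus_commute)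
    then have 3: "N y x < K * (K * (K * ?s) + K * ?s)"
      using K_less[of "N y z + N z x" "K * (K * ?s) + K * ?s"] 1 2 by linarith
    have "N u x \<le> K * (N u y + N y x)"
      using N_triangle[OF u(1) y x] near' by simp
    then have 4: "N u x < K * (K * ?s + K * (K * (K * ?s) + K * ?s))"
      using K_less[of "N u y + N y x" "K * ?s + K * (K * (K * ?s) + K * ?s)"] 1 3 by linarith
    have "K ^ 2 \<le> K ^ 4" "K ^ 3 \<le> K ^ 4" using K by (auto intro: power_increasing)
    then have "(K ^ 2 + K ^ 4 + K ^ 3) * ?s \<le> (3 * K ^ 4) * ?s"
      using s_pos[of "Suc i"] by (intro mult_right_mono) auto
    moreover have "K * (K * ?s + K * (K * (K * ?s) + K * ?s)) = (K ^ 2 + K ^ 4 + K ^ 3) * ?s"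
      by (simp add: power2_eq_square power3_eq_cube power4_eq_xxxx algebra_simps)
    ultimately have 5: "N u x < 3 * K ^ 4 * ?s" using 4 by linarith
    have "d u x \<le> K * N u x" using d_N u x ux by blast
    also have "\<dots> < K * (3 * K ^ 4 * ?s)" by (rule K_less[OF 5])
    also have "\<dots> = (q * (3 * K ^ 5)) * (q * s i)"
      unfolding s_Suc by (simp add: power2_eq_square numeral_eq_Suc)
    also have "\<dots> \<le> s i" using q s_pos[of i] by simp
    finally show "u \<in> \<B> x (r0 * q ^ i)" using u by (simp add: \<B>_iff)
  qed
  \<comment> \<open>A ball lies in a box of size \<open>K ^ 3 * s j\<close>. Contraction by \<theta>
    gives a box of size \<open>2 * \<theta>\<^sup>2 * (K ^ 3 * s j)\<close>, and another
    \<open>K ^ 3\<close> for returning to balls makes this \<open>s (Suc j) / 2\<close>.\<close>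
  define \<theta> where "\<theta> = q / (2 * K ^ 3)"
  have K3: "1 \<le> K ^ 3" using K by simp
  have \<theta>: "0 < \<theta>" "\<theta> \<le> 1"
  proof -
    show "0 < \<theta>" using q K_pos by (simp add: \<theta>_def)
    have "q \<le> 2 * K ^ 3" using q K3 by linarith
    then show "\<theta> \<le> 1" using K_pos by (simp add: \<theta>_def)
  qed
  have doubling: "emeasure (hausdorff_measure k) (\<B> x (r0 * q ^ j)) \<le>
        ennreal ((2 / \<theta>\<^sup>2) ^ k) * emeasure (hausdorff_measure k) (\<B> x (r0 * q ^ Suc j))"
    if x: "\<rho> x = 0" for x j
  proof -
    let ?b = "\<lambda>z. \<bar>(z - x) \<bullet> \<tau> x\<bar> + (norm (z - x))\<^sup>2"
    let ?t = "2 * \<theta>\<^sup>2 * (K ^ 3 * s j)"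
    have "\<B> x (r0 * q ^ j) \<subseteq> surface_box x (\<tau> x) (K ^ 3 * s j)"
    proof
      fix z assume "z \<in> \<B> x (r0 * q ^ j)"
      then have z: "\<rho> z = 0" "d z x < s j" by (auto simp: \<B>_iff)
      have nz: "norm (z - x) \<le> r1" "norm (x - z) \<le> r1"
        using close[OF z(1) x z(2)] r1 by (auto simp: norm_minus_commute)
      have "?b z \<le> K * N x z" using N_box[OF x z(1)] nz by blast
      also have "\<dots> \<le> K * (K * N z x)" using N_sym[OF x z(1)] nz K_pos by (intro mult_left_mono) auto
      also have "\<dots> \<le> K * (K * (K * d z x))" using d_N[OF z(1) x] nz K_pos by (intro mult_left_mono) auto
      also have "\<dots> < K * (K * (K * s j))" using z(2) K_pos by (intro mult_strict_left_mono) auto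
      finally show "z \<in> surface_box x (\<tau> x) (K ^ 3 * s j)" using z by (simp add: surface_box_def power3_eq_cube mult.assoc)
    qed
    then have "emeasure (hausdorff_measure k) (\<B> x (r0 * q ^ j)) \<le>
        emeasure (hausdorff_measure k) (surface_box x (\<tau> x) (K ^ 3 * s j))"
      by (intro emeasure_mono) auto
    also have "\<dots> \<le> ennreal ((2 / \<theta>\<^sup>2) ^ k) * emeasure (hausdorff_measure k) (surface_box x (\<tau> x) ?t)"
    proof (rule s0(2)[OF x _ _ _ \<theta>])
      have "K ^ 3 * s j \<le> K ^ 3 * S" using s_le K_pos by (intro mult_left_mono) auto
      then show "K ^ 3 * s j \<le> s0" using S(3) by linarith
    qed (use \<tau>[OF x] in auto)
    also have "\<dots> \<le> ennreal ((2 / \<theta>\<^sup>2) ^ k) * emeasure (hausdorff_measure k) (\<B> x (r0 * q ^ Suc j))"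
    proof (intro mult_left_mono emeasure_mono)
      have K3t: "K ^ 3 * ?t = s (Suc j) / 2"
        unfolding s_Suc using K_pos by (simp add: \<theta>_def power2_eq_square field_simps)
      have t_pos: "0 < ?t" using \<theta> K_pos s_pos by simp
      have "1 * ?t \<le> K ^ 3 * ?t" using K3 t_pos by (intro mult_right_mono) auto
      then have "?t \<le> s (Suc j)" unfolding K3t using s_pos[of "Suc j"] by linarith
      then have t_r1: "?t \<le> r1\<^sup>2" using s_le[of "Suc j"] S(4) by linarith
      show "surface_box x (\<tau> x) ?t \<subseteq> \<B> x (r0 * q ^ Suc j)"
      proof
        fix z assume "z \<in> surface_box x (\<tau> x) ?t"
        then have z: "\<rho> z = 0" "?b z < ?t" by (auto simp: surface_box_def)
        have "norm (z - x) \<le> r1"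
        proof (rule power2_le_imp_le)
          show "(norm (z - x))\<^sup>2 \<le> r1\<^sup>2" using z(2) t_r1 by linarith
        qed (use r1 in simp)
        then have nz: "norm (z - x) \<le> r1" "norm (x - z) \<le> r1" by (auto simp: norm_minus_commute)
        have "d z x \<le> K * N z x" using d_N[OF z(1) x] nz by blast
        also have "\<dots> \<le> K * (K * N x z)" using N_sym[OF z(1) x] nz K_pos by (intro mult_left_mono) auto
        also have "\<dots> \<le> K * (K * (K * ?b z))" using N_box[OF x z(1)] nz K_pos by (intro mult_left_mono) auto
        also have "\<dots> < K * (K * (K * ?t))" using z(2) K_pos by (intro mult_strict_left_mono) auto
        also have "\<dots> = s (Suc j) / 2" using K3t by (simp add: power3_eq_cube mult.assoc)
        also have "\<dots> \<le> s (Suc j)" using s_pos[of "Suc j"] by simp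
        finally show "z \<in> \<B> x (r0 * q ^ Suc j)" using z unfolding \<B>_iff by blast
      qed
    qed (use \<B>_borel in auto)
    finally show ?thesis .
  qed
  show thesis
    by (rule that[OF r0(1) q(1,2) _ engulf doubling]) (use \<theta> in auto)
qed

end

section \<open>Derivatives of the defining function\<close>

lemma Ck_bounded_linear:
  assumes L: "bounded_linear L" and f: "Ck k f"
  shows "Ck k (\<lambda>x. L (f x))"
  using f
proof (induction k arbitrary: f)
  case 0
  then show ?case using L by (simp add: bounded_linear.continuous_on)
next
  case (Suc k)
  have "(f has_derivative frechet_derivative f (at x)) (at x)" for x
    using Suc.prems by (simp add: frechet_derivative_works)
  note D = bounded_linear.has_derivative[OF L this]
  have "frechet_derivative (\<lambda>x. L (f x)) (at x) = (\<lambda>v. L (frechet_derivative f (at x) v))" for x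
    by (rule frechet_derivative_at[OF D, symmetric])
  then show ?case using D Suc by (auto simp: differentiable_def)
qed

lemma Ck_add:
  assumes "Ck k f" "Ck k g"
  shows "Ck k (\<lambda>x. f x + g x)"
  using assms
proof (induction k arbitrary: f g)
  case 0
  then show ?case by (simp add: continuous_on_add)
next
  case (Suc k)
  have "(f has_derivative frechet_derivative f (at x)) (at x)"
    "(g has_derivative frechet_derivative g (at x)) (at x)" for x
    using Suc.prems by (simp_all add: frechet_derivative_works)
  note D = has_derivative_add[OF this]
  have "frechet_derivative (\<lambda>x. f x + g x) (at x) =
      (\<lambda>v. frechet_derivative f (at x) v + frechet_derivative g (at x) v)" for x
    by (rule frechet_derivative_at[OF D, symmetric])
  then show ?case using D Suc by (auto simp: differentiable_def)
qed

lemma Ck_wirt: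
  assumes "Ck (Suc k) f"
  shows "Ck k (wirt j f)"
proof -
  have "wirt j f = (\<lambda>w. frechet_derivative f (at w) (axis j 1) / 2
      + (- \<i> / 2) * frechet_derivative f (at w) (axis j \<i>))"
    by (simp add: wirt_def fun_eq_iff diff_divide_distrib)
  moreover have "Ck k (\<lambda>w. frechet_derivative f (at w) (axis j 1) / 2
      + (- \<i> / 2) * frechet_derivative f (at w) (axis j \<i>))"
    using assms
    by (intro Ck_add Ck_bounded_linear[OF bounded_linear_divide, of k _ 2]
        Ck_bounded_linear[OF bounded_linear_mult_right, of k _ "- \<i> / 2"]) simp_all
  ultimately show ?thesis by simp
qed

lemma continuous_on_wirt_cplx:
  assumes "Ck 2 \<rho>"
  shows "continuous_on UNIV (wirt j (cplx \<rho>))" "continuous_on UNIV (wirt i (wirt j (cplx \<rho>)))"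
proof -
  have "Ck 2 (cplx \<rho>)" using assms by (rule Ck_bounded_linear[OF bounded_linear_of_real])
  then have 1: "Ck (Suc 0) (wirt j (cplx \<rho>))" by (intro Ck_wirt) (simp add: numeral_2_eq_2)
  show "continuous_on UNIV (wirt i (wirt j (cplx \<rho>)))" using Ck_wirt[OF 1] by simp
  have "wirt j (cplx \<rho>) differentiable at x" for x using 1 by simp
  then show "continuous_on UNIV (wirt j (cplx \<rho>))"
    by (intro continuous_at_imp_continuous_on ballI differentiable_imp_continuous_within)
qed

lemma linear_bound_Basis:
  fixes L :: "'a::euclidean_space \<Rightarrow> real"
  assumes "linear L" and K: "\<And>b. b \<in> Basis \<Longrightarrow> \<bar>L b\<bar> \<le> K b"
  shows "\<bar>L v\<bar> \<le> (\<Sum>b\<in>Basis. K b) * norm v"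
proof -
  have "L v = (\<Sum>b\<in>Basis. (v \<bullet> b) * L b)"
    using arg_cong[OF euclidean_representation[symmetric, of v], of L] assms(1)
    by (simp only: linear_sum linear_scale real_scaleR_def)
  also have "\<bar>\<dots>\<bar> \<le> (\<Sum>b\<in>Basis. norm v * K b)"
    by (rule order_trans[OF sum_abs sum_mono])
      (auto simp: abs_mult Basis_le_norm K intro!: mult_mono)
  finally show ?thesis by (simp add: sum_distrib_left mult.commute)
qed

text \<open>\<open>Ck\<close> speaks of one direction at a time. The mean value inequality is
  therefore applied for each fixed \<open>v\<close>, with second derivatives bounded on the compact
  ball, and linearity in \<open>v\<close> assembles a uniform constant from the basis
  directions.\<close>

lemma C2_derivative_Lipschitz_on_cball:
  fixes f :: "'a::euclidean_space \<Rightarrow> real"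
  assumes "Ck 2 f"
  obtains M where "0 < M" "\<And>x y v. x \<in> cball 0 R \<Longrightarrow> y \<in> cball 0 R \<Longrightarrow>
    \<bar>frechet_derivative f (at x) v - frechet_derivative f (at y) v\<bar> \<le> M * norm (x - y) * norm v"
proof -
  let ?D = "\<lambda>v x. frechet_derivative f (at x) v"
  have f: "f differentiable at x" for x using assms by (simp add: numeral_2_eq_2)
  have D: "?D v differentiable at x" "continuous_on UNIV (\<lambda>x. frechet_derivative (?D v) (at x) b)" for v x b
    using assms by (auto simp: numeral_2_eq_2)
  have lin: "linear (frechet_derivative f (at x))" for x by (rule linear_frechet_derivative[OF f])
  have "\<exists>K. \<forall>x\<in>cball 0 R. \<bar>frechet_derivative (?D v) (at x) b\<bar> \<le> K" for v b
  proof -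
    have "compact ((\<lambda>x. frechet_derivative (?D v) (at x) b) ` cball 0 R)"
      by (intro compact_continuous_image continuous_on_subset[OF D(2)]) auto
    then show ?thesis using compact_imp_bounded by (fastforce simp: bounded_real)
  qed
  then obtain K where K: "\<And>v b x. x \<in> cball 0 R \<Longrightarrow> \<bar>frechet_derivative (?D v) (at x) b\<bar> \<le> K v b"
    by metis
  define K' where "K' = (\<lambda>v. \<Sum>b\<in>Basis. \<bar>K v b\<bar>)"
  have lip: "\<bar>?D v x - ?D v y\<bar> \<le> K' v * norm (x - y)"
    if "x \<in> cball 0 R" "y \<in> cball 0 R" for v x y
  proof -
    have on: "onorm (frechet_derivative (?D v) (at z)) \<le> K' v" if "z \<in> cball 0 R" for z
    proof (rule onorm_le)
      fix h
      show "norm (frechet_derivative (?D v) (at z) h) \<le> K' v * norm h"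
        unfolding K'_def real_norm_def
        using K[OF that] abs_ge_self order_trans
        by (intro linear_bound_Basis linear_frechet_derivative D) blast
    qed
    have hd: "(?D v has_derivative frechet_derivative (?D v) (at z)) (at z within cball 0 R)" for z
      using D(1)[of v z] unfolding frechet_derivative_works by (rule has_derivative_at_withinI)
    show ?thesis using differentiable_bound[OF convex_cball hd on that] by simp
  qed
  define M where "M = (\<Sum>b\<in>Basis. K' b) + 1"
  show thesis
  proof (rule that[of M])
    show "0 < M" by (auto simp: M_def K'_def intro!: add_nonneg_pos sum_nonneg)
    fix x y v :: 'a assume xy: "x \<in> cball 0 R" "y \<in> cball 0 R"
    have "\<bar>?D v x - ?D v y\<bar> \<le> (\<Sum>b\<in>Basis. K' b * norm (x - y)) * norm v"
      using lip[OF xy] lin by (intro linear_bound_Basis linear_compose_sub) auto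
    also have "\<dots> = (\<Sum>b\<in>Basis. K' b) * norm (x - y) * norm v" by (simp add: sum_distrib_right)
    also have "\<dots> \<le> M * norm (x - y) * norm v" by (intro mult_right_mono) (auto simp: M_def)
    finally show "\<bar>?D v x - ?D v y\<bar> \<le> M * norm (x - y) * norm v" .
  qed
qed

text \<open>Mean value inequality on the segment for \<open>f\<close> minus its linear part at
  \<open>w\<close>; the sharper constant \<open>M / 2\<close> is not sought.\<close>

lemma derivative_Lipschitz_imp_taylor:
  fixes f :: "'a::euclidean_space \<Rightarrow> real"
  assumes f: "\<And>x. f differentiable at x" and C: "convex C" "w \<in> C" "z \<in> C"
    and lip: "\<And>x v. x \<in> C \<Longrightarrow>
      \<bar>frechet_derivative f (at x) v - frechet_derivative f (at w) v\<bar> \<le> M * norm (x - w) * norm v"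
    and M: "0 \<le> M"
  shows "\<bar>f z - f w - frechet_derivative f (at w) (z - w)\<bar> \<le> M * (norm (z - w))\<^sup>2"
proof -
  let ?D = "\<lambda>x. frechet_derivative f (at x)"
  let ?g = "\<lambda>x. f x - ?D w x"
  have lin: "linear (?D w)" by (rule linear_frechet_derivative[OF f])
  have "norm (?g z - ?g w) \<le> M * norm (z - w) * norm (z - w)"
  proof (rule differentiable_bound[of "closed_segment w z"])
    fix x assume x: "x \<in> closed_segment w z"
    show "(?g has_derivative (\<lambda>v. ?D x v - ?D w v)) (at x within closed_segment w z)"
      by (intro has_derivative_diff has_derivative_at_withinI[OF f[unfolded frechet_derivative_works]]
          linear_imp_has_derivative lin)
    have "x \<in> C" using x C by (meson closed_segment_subset subsetD)
    have "norm (x - w) \<le> norm (z - w)" using segment_bound1[OF x] .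
    then have "M * norm (x - w) * norm v \<le> M * norm (z - w) * norm v" for v
      using M by (intro mult_left_mono mult_right_mono) auto
    then show "onorm (\<lambda>v. ?D x v - ?D w v) \<le> M * norm (z - w)"
      using lip[OF \<open>x \<in> C\<close>] by (intro onorm_le) (auto intro: order_trans)
  qed auto
  also have "?g z - ?g w = f z - f w - ?D w (z - w)" using lin by (simp add: linear_diff)
  finally show ?thesis by (simp add: power2_eq_square mult.assoc)
qed

lemma complex_vec_eq_sum_axis:
  fixes h :: "complex^'n::finite"
  shows "h = (\<Sum>j\<in>UNIV. Re (h $ j) *\<^sub>R axis j 1 + Im (h $ j) *\<^sub>R axis j \<i>)"
proof (rule vec_eq_iff[THEN iffD2], intro allI)
  fix i
  have "(\<Sum>j\<in>UNIV. Re (h $ j) *\<^sub>R axis j 1 + Im (h $ j) *\<^sub>R axis j \<i>) $ i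
    = (\<Sum>j\<in>UNIV. if j = i then h $ i else 0)"
    unfolding sum_component by (rule sum.cong) (auto simp: axis_def complex_eq_iff)
  then show "h $ i = (\<Sum>j\<in>UNIV. Re (h $ j) *\<^sub>R axis j 1 + Im (h $ j) *\<^sub>R axis j \<i>) $ i" by simp
qed

lemma linear_complex_vec:
  fixes L :: "complex^'n::finite \<Rightarrow> real"
  assumes "linear L"
  shows "L h = (\<Sum>j\<in>UNIV. Re (h $ j) * L (axis j 1) + Im (h $ j) * L (axis j \<i>))"
proof -
  have "L h = L (\<Sum>j\<in>UNIV. Re (h $ j) *\<^sub>R axis j 1 + Im (h $ j) *\<^sub>R axis j \<i>)"
    by (rule arg_cong[OF complex_vec_eq_sum_axis])
  then show ?thesis
    by (simp only: linear_sum[OF assms] linear_add[OF assms] linear_scale[OF assms] real_scaleR_def)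
qed

lemma grad_inner:
  fixes \<rho> :: "complex^'n::finite \<Rightarrow> real"
  assumes "\<rho> differentiable at w"
  shows "grad \<rho> w \<bullet> h = frechet_derivative \<rho> (at w) h"
  unfolding linear_complex_vec[OF linear_frechet_derivative[OF assms], of h]
  by (simp add: grad_def inner_vec_def inner_complex_def mult.commute)

text \<open>The (1,0)-form \<partial>\<rho>(w) applied to \<open>h\<close>; at
  \<open>h = w - z\<close> it is the first-order part of \<open>L0\<close>.\<close>

definition dhol :: "(complex^'n::finite \<Rightarrow> real) \<Rightarrow> complex^'n \<Rightarrow> complex^'n \<Rightarrow> complex" where
  "dhol \<rho> w h = (\<Sum>j\<in>UNIV. wirt j (cplx \<rho>) w * h $ j)"

text \<open>This splitting produces the box shape: on the surface the real part is of second order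
  by Taylor, while the imaginary part measures the displacement along i times the gradient.\<close>

lemma dhol_eq:
  fixes \<rho> :: "complex^'n::finite \<Rightarrow> real"
  assumes "\<rho> differentiable at w"
  shows "dhol \<rho> w h = Complex (frechet_derivative \<rho> (at w) h / 2) (- frechet_derivative \<rho> (at w) (\<i> *s h) / 2)"
proof -
  have "((\<lambda>x. complex_of_real (\<rho> x)) has_derivative
      (\<lambda>v. complex_of_real (frechet_derivative \<rho> (at w) v))) (at w)"
    using assms by (intro bounded_linear.has_derivative[OF bounded_linear_of_real])
      (simp add: frechet_derivative_works)
  then have D: "frechet_derivative (cplx \<rho>) (at w) = (\<lambda>v. complex_of_real (frechet_derivative \<rho> (at w) v))"
    by (rule frechet_derivative_at[symmetric])
  show ?thesis
    unfolding linear_complex_vec[OF linear_frechet_derivative[OF assms], of h]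
      linear_complex_vec[OF linear_frechet_derivative[OF assms], of "\<i> *s h"]
    by (simp add: dhol_def wirt_def D complex_eq_iff sum_divide_distrib sum_negf[symmetric])
      (auto intro!: sum.cong simp: field_simps)
qed

section \<open>The balls of the quasi-distance\<close>

lemma imag_scale_inner: "((\<i> *s a) \<bullet> b :: real) = - (a \<bullet> (\<i> *s b))"
  for a b :: "complex^'n::finite"
  by (simp add: inner_vec_def inner_complex_def sum_negf[symmetric])

lemma imag_scale_inner_self: "((\<i> *s a) \<bullet> a :: real) = 0" for a :: "complex^'n::finite"
  by (simp add: inner_vec_def inner_complex_def)

lemma norm_imag_scale [simp]: "norm (\<i> *s a) = norm a" for a :: "complex^'n::finite"
  by (simp add: norm_vec_def norm_mult)

text \<open>Pseudoconvexity enters through \<open>Re_g0\<close>, which on the boundary bounds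
  \<open>(norm (w - z))\<^sup>2\<close> by a multiple of
  \<open>norm (g0 \<rho> \<kappa> w z)\<close>.\<close>

locale defining_function =
  fixes \<rho> :: "complex^'n::finite \<Rightarrow> real" and \<kappa> :: "complex^'n \<Rightarrow> complex^'n \<Rightarrow> real" and \<mu> c :: real
  assumes C2: "Ck 2 \<rho>" and grad_nonzero: "\<And>w. w \<in> bDom \<rho> \<Longrightarrow> grad \<rho> w \<noteq> 0"
    and bounded_Dom: "bounded (Dom \<rho>)" and \<mu>_pos: "0 < \<mu>" and cutoff: "cutoff \<mu> \<kappa>" and c_pos: "0 < c"
    and Re_g0: "\<And>w z. w \<in> bDom \<rho> \<Longrightarrow> z \<in> closure (Dom \<rho>) \<Longrightarrow>
        c * (- \<rho> z + (norm (w - z))\<^sup>2) \<le> Re (g0 \<rho> \<kappa> w z)"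
begin

lemma differentiable: "\<rho> differentiable at w"
  using C2 by (simp add: numeral_2_eq_2)

lemma continuous: "continuous_on UNIV \<rho>"
  by (intro continuous_at_imp_continuous_on ballI differentiable_imp_continuous_within differentiable)

lemma closed_bDom: "closed (bDom \<rho>)"
  unfolding bDom_def using continuous_closed_vimage[of "{0}" \<rho>] continuous
  by (simp add: vimage_def continuous_on_eq_continuous_at)

text \<open>A short step against the gradient leads into the domain. The inclusion allows
  \<open>Re_g0\<close>, stated for the closure of \<open>Dom \<rho>\<close>, to be applied to pairs
  of boundary points.\<close>

lemma bDom_subset_closure: "bDom \<rho> \<subseteq> closure (Dom \<rho>)"
proof
  fix z assume z: "z \<in> bDom \<rho>"
  let ?g = "grad \<rho> z"
  have g: "?g \<noteq> 0" by (rule grad_nonzero[OF z])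
  have "((\<lambda>t. z - t *\<^sub>R ?g) has_derivative (\<lambda>t. - t *\<^sub>R ?g)) (at 0)"
    by (auto intro!: derivative_eq_intros)
  moreover have "(\<rho> has_derivative frechet_derivative \<rho> (at z)) (at (z - 0 *\<^sub>R ?g))"
    using differentiable[of z] by (simp add: frechet_derivative_works)
  ultimately have "((\<lambda>t. \<rho> (z - t *\<^sub>R ?g)) has_derivative (\<lambda>t. frechet_derivative \<rho> (at z) (- t *\<^sub>R ?g))) (at 0)"
    by (rule has_derivative_compose)
  moreover have "(\<lambda>t. frechet_derivative \<rho> (at z) (- t *\<^sub>R ?g)) = (*) (- (?g \<bullet> ?g))"
    by (auto simp: grad_inner[OF differentiable, symmetric])
  ultimately have "((\<lambda>t. \<rho> (z - t *\<^sub>R ?g)) has_real_derivative (- (?g \<bullet> ?g))) (at 0)"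
    by (simp add: has_field_derivative_def)
  from DERIV_neg_dec_right[OF this] g obtain d where d: "0 < d"
      "\<And>h. 0 < h \<Longrightarrow> h < d \<Longrightarrow> \<rho> (z - h *\<^sub>R ?g) < 0"
    using z by (auto simp: bDom_def)
  show "z \<in> closure (Dom \<rho>)"
    unfolding closure_approachable
  proof safe
    fix e :: real assume e: "0 < e"
    define h where "h = min (d / 2) (e / (2 * norm ?g))"
    have h: "0 < h" "h < d" using d e g by (auto simp: h_def)
    have "h * norm ?g \<le> e / (2 * norm ?g) * norm ?g" by (intro mult_right_mono) (auto simp: h_def)
    then have "dist (z - h *\<^sub>R ?g) z < e" using h e g by (simp add: dist_norm)
    then show "\<exists>y\<in>Dom \<rho>. dist y z < e" using d(2)[OF h] by (auto simp: Dom_def)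
  qed
qed

lemma bounded_bDom: "bounded (bDom \<rho>)"
  using bounded_subset[OF bounded_closure[OF bounded_Dom] bDom_subset_closure] .

lemma compact_bDom: "compact (bDom \<rho>)"
  using bounded_bDom closed_bDom by (simp add: compact_eq_bounded_closed)

lemma grad_diff_inner: "(grad \<rho> x - grad \<rho> y) \<bullet> v =
    frechet_derivative \<rho> (at x) v - frechet_derivative \<rho> (at y) v"
  by (simp add: inner_diff_left grad_inner[OF differentiable])

text \<open>\<open>M\<close> is made large enough to be both a Lipschitz constant and a bound for
  the gradient. The estimates are taken on a ball of radius \<open>R + 1\<close> because
  \<open>taylor\<close> reaches distance 1 from the surface.\<close>

lemma hypersurface_constants:
  obtains M m where "C2_hypersurface \<rho> (grad \<rho>) M m"
    "\<And>x y. x \<in> bDom \<rho> \<Longrightarrow> y \<in> bDom \<rho> \<Longrightarrow> norm (grad \<rho> x - grad \<rho> y) \<le> M * norm (x - y)"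
    "\<And>x. x \<in> bDom \<rho> \<Longrightarrow> norm (grad \<rho> x) \<le> M"
proof -
  obtain R where R: "0 < R" "\<And>x. x \<in> bDom \<rho> \<Longrightarrow> norm x \<le> R"
    using bounded_bDom by (auto simp: bounded_pos)
  obtain L where L: "0 < L" "\<And>x y v. x \<in> cball 0 (R + 1) \<Longrightarrow> y \<in> cball 0 (R + 1) \<Longrightarrow>
      \<bar>frechet_derivative \<rho> (at x) v - frechet_derivative \<rho> (at y) v\<bar> \<le> L * norm (x - y) * norm v"
    using C2_derivative_Lipschitz_on_cball[OF C2] by metis
  have lip: "norm (grad \<rho> x - grad \<rho> y) \<le> L * norm (x - y)"
    if "x \<in> cball 0 (R + 1)" "y \<in> cball 0 (R + 1)" for x y
  proof -
    let ?v = "grad \<rho> x - grad \<rho> y"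
    have "(norm ?v)\<^sup>2 \<le> L * norm (x - y) * norm ?v"
      using L(2)[OF that, of ?v] by (simp add: grad_diff_inner[symmetric] power2_norm_eq_inner)
    then show ?thesis
      using L(1) by (cases "?v = 0") (auto simp: power2_eq_square)
  qed
  have in_ball: "x \<in> cball 0 (R + 1)" if "x \<in> bDom \<rho>" for x using R(2)[OF that] by simp
  define M where "M = L + norm (grad \<rho> 0) + L * R"
  have M: "L \<le> M" using L R by (simp add: M_def)
  have grad_le: "norm (grad \<rho> x) \<le> M" if "x \<in> bDom \<rho>" for x
  proof -
    have "norm (grad \<rho> x - grad \<rho> 0) \<le> L * norm x" using lip[OF in_ball[OF that], of 0] R by simp
    also have "\<dots> \<le> L * R" using R(2)[OF that] L by (intro mult_left_mono) auto
    finally show ?thesis using norm_triangle_sub[of "grad \<rho> x" "grad \<rho> 0"] L by (simp add: M_def)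
  qed
  have "\<exists>m>0. \<forall>x\<in>bDom \<rho>. m \<le> norm (grad \<rho> x)"
  proof (cases "bDom \<rho> = {}")
    case False
    have "L-lipschitz_on (bDom \<rho>) (grad \<rho>)"
      using lip in_ball L(1) by (intro lipschitz_onI) (auto simp: dist_norm)
    then have "continuous_on (bDom \<rho>) (\<lambda>x. norm (grad \<rho> x))"
      by (intro continuous_on_norm lipschitz_on_continuous_on)
    then obtain x where "x \<in> bDom \<rho>" "\<forall>y\<in>bDom \<rho>. norm (grad \<rho> x) \<le> norm (grad \<rho> y)"
      using continuous_attains_inf[OF compact_bDom False] by blast
    then show ?thesis using grad_nonzero by (intro exI[of _ "norm (grad \<rho> x)"]) auto
  qed (auto intro: exI[of _ 1])
  then obtain m where m: "0 < m" "\<And>x. x \<in> bDom \<rho> \<Longrightarrow> m \<le> norm (grad \<rho> x)" by blast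
  have lipM: "norm (grad \<rho> x - grad \<rho> y) \<le> M * norm (x - y)" if "x \<in> bDom \<rho>" "y \<in> bDom \<rho>" for x y
    using lip[OF that[THEN in_ball]] mult_right_mono[OF M, of "norm (x - y)"] by simp
  have "C2_hypersurface \<rho> (grad \<rho>) M m"
  proof
    show "continuous_on UNIV \<rho>" by (rule continuous)
    show "0 < M" "0 < m" using L M m by auto
    fix w assume "\<rho> w = 0"
    then have w: "w \<in> bDom \<rho>" by (simp add: bDom_def)
    show "m \<le> norm (grad \<rho> w)" by (rule m(2)[OF w])
    fix z assume z: "norm (z - w) \<le> 1"
    have "z \<in> cball 0 (R + 1)" using norm_triangle_sub[of z w] R(2)[OF w] z by simp
    then have "\<bar>\<rho> z - \<rho> w - frechet_derivative \<rho> (at w) (z - w)\<bar> \<le> L * (norm (z - w))\<^sup>2"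
      using differentiable in_ball[OF w] L
      by (intro derivative_Lipschitz_imp_taylor[where C="cball 0 (R + 1)"]) auto
    also have "\<dots> \<le> M * (norm (z - w))\<^sup>2" using M by (intro mult_right_mono) auto
    finally show "\<bar>\<rho> z - grad \<rho> w \<bullet> (z - w)\<bar> \<le> M * (norm (z - w))\<^sup>2"
      using \<open>\<rho> w = 0\<close> by (simp add: grad_inner[OF differentiable])
    show "norm (grad \<rho> z - grad \<rho> w) \<le> M * norm (z - w)" if "\<rho> z = 0"
      using that w by (intro lipM) (auto simp: bDom_def)
  qed
  then show thesis using that lipM grad_le by blast
qed

lemma L0_minus_dhol:
  obtains K where "0 \<le> K"
    "\<And>w z. w \<in> bDom \<rho> \<Longrightarrow> norm (L0 \<rho> w z - dhol \<rho> w (w - z)) \<le> K * (norm (w - z))\<^sup>2"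
proof -
  let ?W = "\<lambda>j k w. wirt j (wirt k (cplx \<rho>)) w"
  have "\<exists>K. \<forall>w\<in>bDom \<rho>. norm (?W j k w) \<le> K" for j k
  proof -
    have "compact (?W j k ` bDom \<rho>)"
      using continuous_on_wirt_cplx(2)[OF C2] compact_bDom
      by (intro compact_continuous_image) (auto intro: continuous_on_subset)
    then show ?thesis using compact_imp_bounded by (fastforce simp: bounded_iff)
  qed
  then obtain K where K: "\<And>j k w. w \<in> bDom \<rho> \<Longrightarrow> norm (?W j k w) \<le> K j k" by metis
  define K' where "K' = (\<Sum>j\<in>UNIV. \<Sum>k\<in>UNIV. \<bar>K j k\<bar>)"
  show thesis
  proof (rule that[of K'])
    show "0 \<le> K'" by (auto simp: K'_def intro!: sum_nonneg)
    fix w z assume w: "w \<in> bDom \<rho>"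
    let ?h = "w - z"
    have t: "norm (?W j k w * ?h $ j * ?h $ k) \<le> \<bar>K j k\<bar> * (norm ?h)\<^sup>2" for j k
    proof -
      have "norm (?W j k w) \<le> \<bar>K j k\<bar>" using K[OF w, of j k] by linarith
      then have "norm (?W j k w) * norm (?h $ j) * norm (?h $ k) \<le> \<bar>K j k\<bar> * norm ?h * norm ?h"
        using Finite_Cartesian_Product.norm_nth_le[of ?h] by (intro mult_mono mult_nonneg_nonneg norm_ge_zero abs_ge_zero)
      then show ?thesis by (simp add: norm_mult power2_eq_square mult.assoc)
    qed
    define X where "X = (\<Sum>j\<in>UNIV. \<Sum>k\<in>UNIV. ?W j k w * ?h $ j * ?h $ k)"
    have "norm X \<le> (\<Sum>j\<in>UNIV. \<Sum>k\<in>UNIV. \<bar>K j k\<bar> * (norm ?h)\<^sup>2)"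
      unfolding X_def by (intro sum_norm_le t)
    also have "\<dots> = K' * (norm ?h)\<^sup>2" by (simp add: K'_def sum_distrib_right)
    finally have "norm X \<le> K' * (norm ?h)\<^sup>2" .
    moreover have "norm (- (1 / 2 * X)) = norm X / 2" by (simp add: norm_mult)
    ultimately have "norm (- (1 / 2 * X)) \<le> K' * (norm ?h)\<^sup>2" using norm_ge_zero[of X] by linarith
    moreover have "L0 \<rho> w z - dhol \<rho> w ?h = - (1 / 2 * X)"
      by (simp add: L0_def dhol_def X_def)
    ultimately show "norm (L0 \<rho> w z - dhol \<rho> w ?h) \<le> K' * (norm ?h)\<^sup>2" by simp
  qed
qed

text \<open>The first variable matters since \<open>qball\<close> places the centre second. There
  the coefficients of \<open>L0\<close> move as well, so continuity of the second derivatives of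
  \<rho> is used.\<close>

lemma continuous_g0: "continuous_on UNIV (\<lambda>z. g0 \<rho> \<kappa> z x)"
proof -
  have "Ck 0 (\<lambda>(w, z). \<kappa> w z)" using cutoff unfolding cutoff_def by blast
  then have "continuous_on UNIV (\<lambda>(w, z). \<kappa> w z)" by simp
  then have "continuous_on UNIV (\<lambda>w. (\<lambda>(w, z). \<kappa> w z) (w, x))"
    by (rule continuous_on_compose2) (auto intro!: continuous_intros)
  then have "continuous_on UNIV (\<lambda>w. \<kappa> w x)" by simp
  moreover have "continuous_on UNIV (\<lambda>w. L0 \<rho> w x)"
    unfolding L0_def by (intro continuous_intros continuous_on_wirt_cplx[OF C2])
  ultimately show ?thesis unfolding g0_def by (intro continuous_intros)
qed

lemma qball_open: "\<exists>U. open U \<and> qball \<rho> \<kappa> x r = U \<inter> bDom \<rho>"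
proof (intro exI conjI)
  show "open {z. sqrt (norm (g0 \<rho> \<kappa> z x)) < r}"
    by (intro open_Collect_less continuous_intros continuous_g0)
  show "qball \<rho> \<kappa> x r = {z. sqrt (norm (g0 \<rho> \<kappa> z x)) < r} \<inter> bDom \<rho>"
    by (auto simp: qball_def qdist_def)
qed

lemma qball_borel: "qball \<rho> \<kappa> x r \<in> sets borel"
  using qball_open[of x r] closed_bDom by auto

lemma qball_centre: "x \<in> bDom \<rho> \<Longrightarrow> 0 < r \<Longrightarrow> x \<in> qball \<rho> \<kappa> x r"
  by (simp add: qball_def qdist_def g0_def L0_def)

lemma g0_lower:
  assumes "z \<in> bDom \<rho>" "w \<in> bDom \<rho>"
  shows "c * (norm (z - w))\<^sup>2 \<le> norm (g0 \<rho> \<kappa> z w)"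
proof -
  have "c * (norm (z - w))\<^sup>2 \<le> Re (g0 \<rho> \<kappa> z w)"
    using Re_g0[of z w] assms bDom_subset_closure by (auto simp: bDom_def)
  also have "\<dots> \<le> norm (g0 \<rho> \<kappa> z w)" by (rule complex_Re_le_cmod)
  finally show ?thesis .
qed

lemma qball_shrink:
  assumes x: "x \<in> bDom \<rho>" and U: "open U" "x \<in> U" and r: "0 < r" "0 < q" "q < 1"
  shows "\<exists>j. qball \<rho> \<kappa> x (r * q ^ Suc j) \<subseteq> U"
proof -
  obtain e where e: "0 < e" "ball x e \<subseteq> U" using U open_contains_ball by blast
  have "0 < sqrt c * e / r" using c_pos e r by simp
  then obtain j where j: "q ^ j < sqrt c * e / r" using real_arch_pow_inv r by blast
  have "r * q ^ Suc j \<le> r * q ^ j" using r by (intro mult_left_mono power_decreasing) auto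
  also have "\<dots> < sqrt c * e" using j r by (simp add: field_simps)
  finally have "r * q ^ Suc j < sqrt c * e" .
  then have *: "(r * q ^ Suc j)\<^sup>2 < c * e\<^sup>2"
    using power_strict_mono[of "r * q ^ Suc j" "sqrt c * e" 2] r c_pos by (simp add: power_mult_distrib)
  have "z \<in> ball x e" if z: "z \<in> qball \<rho> \<kappa> x (r * q ^ Suc j)" for z
  proof -
    have "sqrt (norm (g0 \<rho> \<kappa> z x)) < r * q ^ Suc j" using z by (simp add: qball_def qdist_def)
    then have "(sqrt (norm (g0 \<rho> \<kappa> z x)))\<^sup>2 < (r * q ^ Suc j)\<^sup>2"
      by (intro power_strict_mono) auto
    then have "c * (norm (z - x))\<^sup>2 < c * e\<^sup>2"
      using g0_lower[of z x] z x * by (simp add: qball_def)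
    then have "(norm (z - x))\<^sup>2 < e\<^sup>2" using c_pos by simp
    then show ?thesis using e by (simp add: dist_norm norm_minus_commute power2_less_imp_less)
  qed
  then show ?thesis using e by blast
qed


lemma dhol_components:
  "Re (dhol \<rho> w h) = (grad \<rho> w \<bullet> h) / 2" "Im (dhol \<rho> w h) = ((\<i> *s grad \<rho> w) \<bullet> h) / 2"
  by (simp_all add: dhol_eq[OF differentiable] imag_scale_inner grad_inner[OF differentiable])

lemma dhol_minus: "dhol \<rho> w (- h) = - dhol \<rho> w h"
  by (simp add: dhol_def sum_negf)

lemma dhol_add: "dhol \<rho> w (h + h') = dhol \<rho> w h + dhol \<rho> w h'"
  by (simp add: dhol_def sum.distrib distrib_left)

lemma dhol_Lipschitz:
  assumes "norm (grad \<rho> x - grad \<rho> y) \<le> M * norm (x - y)"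
  shows "norm (dhol \<rho> x h - dhol \<rho> y h) \<le> M * norm (x - y) * norm h"
proof -
  let ?g = "grad \<rho> x - grad \<rho> y"
  have "\<i> *s grad \<rho> x - \<i> *s grad \<rho> y = \<i> *s ?g"
    by (simp add: vec_eq_iff right_diff_distrib)
  then have "Re (dhol \<rho> x h - dhol \<rho> y h) = (?g \<bullet> h) / 2"
    "Im (dhol \<rho> x h - dhol \<rho> y h) = ((\<i> *s ?g) \<bullet> h) / 2"
    by (simp_all add: dhol_components inner_diff_left diff_divide_distrib flip: inner_diff_left)
  then have "norm (dhol \<rho> x h - dhol \<rho> y h) \<le> \<bar>?g \<bullet> h\<bar> / 2 + \<bar>(\<i> *s ?g) \<bullet> h\<bar> / 2"
    using cmod_le[of "dhol \<rho> x h - dhol \<rho> y h"] by simp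
  also have "\<dots> \<le> norm ?g * norm h"
    using Cauchy_Schwarz_ineq2[of ?g h] Cauchy_Schwarz_ineq2[of "\<i> *s ?g" h, unfolded norm_imag_scale]
    by linarith
  also have "\<dots> \<le> M * norm (x - y) * norm h" using assms by (intro mult_right_mono) auto
  finally show ?thesis .
qed

text \<open>The model \<open>N\<close> keeps of \<open>L0\<close> its first-order part and replaces
  the rest by the squared distance, an error absorbed through \<open>g0_lower\<close>. Near-symmetry
  and the triangle inequality come from the Lipschitz gradient: moving the base point by
  \<open>x - y\<close> changes \<open>dhol\<close> at \<open>h\<close> by at most
  \<open>M * norm (x - y) * norm h\<close>.\<close>

lemma qball_system:
  obtains r0 q C where "0 < r0" "0 < q" "q < 1" "0 < C"
    "\<And>x y i j. x \<in> bDom \<rho> \<Longrightarrow> y \<in> bDom \<rho> \<Longrightarrow> i \<le> j \<Longrightarrow>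
        qball \<rho> \<kappa> x (r0 * q ^ Suc i) \<inter> qball \<rho> \<kappa> y (r0 * q ^ Suc j) \<noteq> {} \<Longrightarrow>
        qball \<rho> \<kappa> y (r0 * q ^ Suc j) \<subseteq> qball \<rho> \<kappa> x (r0 * q ^ i)"
    "\<And>x j. x \<in> bDom \<rho> \<Longrightarrow> emeasure (hausdorff_measure k) (qball \<rho> \<kappa> x (r0 * q ^ j)) \<le>
        ennreal C * emeasure (hausdorff_measure k) (qball \<rho> \<kappa> x (r0 * q ^ Suc j))"
proof -
  obtain M m where hyp: "C2_hypersurface \<rho> (grad \<rho>) M m"
    and lip: "\<And>x y. x \<in> bDom \<rho> \<Longrightarrow> y \<in> bDom \<rho> \<Longrightarrow> norm (grad \<rho> x - grad \<rho> y) \<le> M * norm (x - y)"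
    and grad_le: "\<And>x. x \<in> bDom \<rho> \<Longrightarrow> norm (grad \<rho> x) \<le> M"
    using hypersurface_constants by metis
  interpret C2_hypersurface \<rho> "grad \<rho>" M m by (rule hyp)
  obtain K2 where K2: "0 \<le> K2"
    "\<And>w z. w \<in> bDom \<rho> \<Longrightarrow> norm (L0 \<rho> w z - dhol \<rho> w (w - z)) \<le> K2 * (norm (w - z))\<^sup>2"
    using L0_minus_dhol by metis
  define N where "N = (\<lambda>z w. norm (dhol \<rho> z (z - w)) + (norm (z - w))\<^sup>2)"
  have N_nonneg: "0 \<le> N z w" for z w by (simp add: N_def)
  define d where "d = (\<lambda>z w. norm (g0 \<rho> \<kappa> z w))"
  \<comment> \<open>The real tangent direction orthogonal to the complex tangent space.\<close>
  define \<tau> where "\<tau> = (\<lambda>w. sgn (\<i> *s grad \<rho> w))"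
  \<comment> \<open>One constant for all comparisons; its summands are those met in
    \<open>d_N\<close>, \<open>N_sym\<close>, \<open>N_triangle\<close> and
    \<open>N_box\<close>.\<close>
  define K where "K = 2 + M + K2 + (K2 + 1) / c + 2 / m"
  \<comment> \<open>Within \<open>\<mu> / 2\<close> the cutoff is 1 and \<open>g0\<close> coincides
    with \<open>L0\<close>; the bound 1 is the range of \<open>taylor\<close>.\<close>
  define r1 where "r1 = min 1 (\<mu> / 2)"
  have r1: "0 < r1" "r1 \<le> 1" "r1 \<le> \<mu> / 2" using \<mu>_pos by (auto simp: r1_def)
  have nonneg: "0 \<le> (K2 + 1) / c" "0 \<le> 2 / m" using K2 c_pos m_pos by auto
  have K: "1 \<le> K" "1 + (K2 + 1) / c \<le> K" "1 + K2 \<le> K" "2 + M \<le> K" "1 + M \<le> K" "2 / m + 1 \<le> K"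
    using nonneg K2 M_pos by (auto simp: K_def)
  have bD: "\<rho> z = 0 \<longleftrightarrow> z \<in> bDom \<rho>" for z by (simp add: bDom_def)
  have lower: "c * (norm (z - w))\<^sup>2 \<le> d z w" if "z \<in> bDom \<rho>" "w \<in> bDom \<rho>" for z w
    using g0_lower[OF that] by (simp add: d_def)
  have d_N: "N z w \<le> K * d z w \<and> d z w \<le> K * N z w"
    if z: "z \<in> bDom \<rho>" and w: "w \<in> bDom \<rho>" and near: "norm (z - w) \<le> r1" for z w
  proof
    let ?n = "(norm (z - w))\<^sup>2"
    have "\<kappa> z w = 1" using cutoff near r1 unfolding cutoff_def by auto
    then have d: "d z w = norm (L0 \<rho> z w)" by (simp add: d_def g0_def)
    have diff: "norm (L0 \<rho> z w - dhol \<rho> z (z - w)) \<le> K2 * ?n" by (rule K2(2)[OF z])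
    have "norm (dhol \<rho> z (z - w)) \<le> d z w + K2 * ?n"
      using diff norm_triangle_sub[of "dhol \<rho> z (z - w)" "L0 \<rho> z w"] by (simp add: d norm_minus_commute)
    then have "N z w \<le> d z w + (K2 + 1) * ?n" by (simp add: N_def distrib_right)
    also have "(K2 + 1) * ?n \<le> (K2 + 1) * (d z w / c)"
      using lower[OF z w] K2 c_pos by (intro mult_left_mono) (auto simp: field_simps)
    finally have "N z w \<le> (1 + (K2 + 1) / c) * d z w" by (simp add: algebra_simps)
    also have "\<dots> \<le> K * d z w" using K by (intro mult_right_mono) (auto simp: d_def)
    finally show "N z w \<le> K * d z w" .
    have "d z w \<le> norm (dhol \<rho> z (z - w)) + K2 * ?n"
      using diff norm_triangle_sub[of "L0 \<rho> z w" "dhol \<rho> z (z - w)"] by (simp add: d)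
    also have "\<dots> \<le> (1 + K2) * N z w"
      using K2 by (simp add: N_def algebra_simps)
    also have "\<dots> \<le> K * N z w" using K N_nonneg by (intro mult_right_mono) auto
    finally show "d z w \<le> K * N z w" .
  qed
  have N_sym: "N z w \<le> K * N w z" if z: "z \<in> bDom \<rho>" and w: "w \<in> bDom \<rho>" for z w
  proof -
    have "norm (dhol \<rho> z (z - w)) \<le> norm (dhol \<rho> w (z - w)) + norm (dhol \<rho> z (z - w) - dhol \<rho> w (z - w))"
      by (rule norm_triangle_sub)
    also have "\<dots> \<le> norm (dhol \<rho> w (w - z)) + M * (norm (w - z))\<^sup>2"
      using dhol_Lipschitz[OF lip[OF z w], of "z - w"] dhol_minus[of w "z - w"]
      by (simp add: norm_minus_commute power2_eq_square)
    finally have "N z w \<le> norm (dhol \<rho> w (w - z)) + M * (norm (w - z))\<^sup>2 + (norm (w - z))\<^sup>2"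
      by (simp add: N_def norm_minus_commute)
    also have "\<dots> \<le> \<dots> + M * norm (dhol \<rho> w (w - z))" using M_pos by simp
    also have "\<dots> = (1 + M) * N w z" by (simp add: N_def algebra_simps)
    also have "\<dots> \<le> K * N w z" using K N_nonneg by (intro mult_right_mono) auto
    finally show ?thesis .
  qed
  have N_triangle: "N x z \<le> K * (N x y + N y z)" if x: "x \<in> bDom \<rho>" and y: "y \<in> bDom \<rho>" for x y z
  proof -
    let ?a = "norm (x - y)" and ?b = "norm (y - z)"
    have am: "2 * (?a * ?b) \<le> ?a\<^sup>2 + ?b\<^sup>2" using sum_squares_bound[of ?a ?b] by simp
    have "dhol \<rho> x (x - z) = dhol \<rho> x (x - y) + dhol \<rho> y (y - z) + (dhol \<rho> x (y - z) - dhol \<rho> y (y - z))"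
      using dhol_add[of x "x - y" "y - z"] by simp
    also have "norm \<dots> \<le> norm (dhol \<rho> x (x - y)) + norm (dhol \<rho> y (y - z))
        + norm (dhol \<rho> x (y - z) - dhol \<rho> y (y - z))"
      by (meson add_mono norm_triangle_ineq order_refl order_trans)
    also have "norm (dhol \<rho> x (y - z) - dhol \<rho> y (y - z)) \<le> M * (?a * ?b)"
      using dhol_Lipschitz[OF lip[OF x y], of "y - z"] by (simp add: mult.assoc)
    also have "M * (?a * ?b) \<le> M * (?a\<^sup>2 + ?b\<^sup>2)"
      using M_pos am by (intro mult_left_mono) (auto intro: order_trans[rotated])
    finally have 1: "norm (dhol \<rho> x (x - z)) \<le> norm (dhol \<rho> x (x - y)) + norm (dhol \<rho> y (y - z)) + M * (?a\<^sup>2 + ?b\<^sup>2)"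
      by simp
    have "(norm (x - z))\<^sup>2 \<le> (?a + ?b)\<^sup>2"
      using norm_triangle_ineq[of "x - y" "y - z"] by (intro power_mono) auto
    also have "\<dots> \<le> 2 * (?a\<^sup>2 + ?b\<^sup>2)" using am by (simp add: power2_sum)
    finally have 2: "(norm (x - z))\<^sup>2 \<le> 2 * (?a\<^sup>2 + ?b\<^sup>2)" .
    let ?p = "norm (dhol \<rho> x (x - y)) + norm (dhol \<rho> y (y - z))"
    have "N x z \<le> ?p + (2 + M) * (?a\<^sup>2 + ?b\<^sup>2)"
      using 1 2 by (simp add: N_def distrib_right)
    also have "\<dots> \<le> (2 + M) * ?p + (2 + M) * (?a\<^sup>2 + ?b\<^sup>2)"
      using M_pos mult_right_mono[of 1 "2 + M" ?p] by simp
    also have "\<dots> = (2 + M) * (N x y + N y z)" by (simp add: N_def algebra_simps)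
    also have "\<dots> \<le> K * (N x y + N y z)" using K N_nonneg by (intro mult_right_mono) auto
    finally show ?thesis .
  qed
  have \<tau>: "norm (\<tau> w) = 1 \<and> \<tau> w \<bullet> grad \<rho> w = 0" if "w \<in> bDom \<rho>" for w
  proof -
    have "norm (\<i> *s grad \<rho> w) \<noteq> 0" using grad_nonzero[OF that] by simp
    then show ?thesis by (auto simp: \<tau>_def norm_sgn sgn_div_norm imag_scale_inner_self)
  qed
  have N_box: "\<bar>(z - w) \<bullet> \<tau> w\<bar> + (norm (z - w))\<^sup>2 \<le> K * N w z \<and>
        N w z \<le> K * (\<bar>(z - w) \<bullet> \<tau> w\<bar> + (norm (z - w))\<^sup>2)"
    if w: "w \<in> bDom \<rho>" and z: "z \<in> bDom \<rho>" and near: "norm (w - z) \<le> r1" for w z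
  proof
    let ?h = "z - w" and ?g = "norm (grad \<rho> w)"
    have N: "N w z = norm (dhol \<rho> w ?h) + (norm ?h)\<^sup>2"
      using dhol_minus[of w ?h] by (simp add: N_def norm_minus_commute)
    have g: "0 < m" "m \<le> ?g" "?g \<le> M" using m_pos G_lower[of w] grad_le[OF w] w by (auto simp: bD)
    then have "?g \<noteq> 0" by linarith
    then have "\<i> *s grad \<rho> w = ?g *\<^sub>R \<tau> w" by (simp add: \<tau>_def sgn_div_norm)
    then have Im: "Im (dhol \<rho> w ?h) = ?g * (?h \<bullet> \<tau> w) / 2"
      by (simp add: dhol_components inner_commute)
    have "m * \<bar>?h \<bullet> \<tau> w\<bar> \<le> ?g * \<bar>?h \<bullet> \<tau> w\<bar>" using g by (intro mult_right_mono) auto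
    also have "\<dots> = 2 * \<bar>Im (dhol \<rho> w ?h)\<bar>" using g by (simp add: Im abs_mult)
    also have "\<dots> \<le> 2 * norm (dhol \<rho> w ?h)" using abs_Im_le_cmod[of "dhol \<rho> w ?h"] by simp
    finally have "\<bar>?h \<bullet> \<tau> w\<bar> \<le> 2 / m * norm (dhol \<rho> w ?h)" using g by (simp add: field_simps)
    then have "\<bar>?h \<bullet> \<tau> w\<bar> + (norm ?h)\<^sup>2 \<le> (2 / m + 1) * N w z"
      using g unfolding N by (simp add: distrib_left distrib_right add_increasing2 add_mono)
    also have "\<dots> \<le> K * N w z" using K N_nonneg by (intro mult_right_mono) auto
    finally show "\<bar>?h \<bullet> \<tau> w\<bar> + (norm ?h)\<^sup>2 \<le> K * N w z" .
    have "\<bar>Re (dhol \<rho> w ?h)\<bar> \<le> M * (norm ?h)\<^sup>2"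
    proof -
      have "\<bar>grad \<rho> w \<bullet> ?h\<bar> \<le> M * (norm ?h)\<^sup>2"
        using taylor[of w z] w z near r1 by (simp add: bDom_def norm_minus_commute)
      then show ?thesis
        using abs_ge_zero[of "grad \<rho> w \<bullet> ?h"] unfolding dhol_components abs_divide by linarith
    qed
    moreover have "\<bar>Im (dhol \<rho> w ?h)\<bar> \<le> M * \<bar>?h \<bullet> \<tau> w\<bar>"
    proof -
      have "\<bar>Im (dhol \<rho> w ?h)\<bar> = ?g * \<bar>?h \<bullet> \<tau> w\<bar> / 2" by (simp add: Im abs_mult)
      moreover have "0 \<le> ?g * \<bar>?h \<bullet> \<tau> w\<bar>" by simp
      ultimately show ?thesis using mult_right_mono[OF g(3), of "\<bar>?h \<bullet> \<tau> w\<bar>"] by linarith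
    qed
    ultimately have "N w z \<le> M * (norm ?h)\<^sup>2 + M * \<bar>?h \<bullet> \<tau> w\<bar> + (norm ?h)\<^sup>2"
      using cmod_le[of "dhol \<rho> w ?h"] unfolding N by linarith
    also have "\<dots> \<le> (1 + M) * (\<bar>?h \<bullet> \<tau> w\<bar> + (norm ?h)\<^sup>2)" by (simp add: algebra_simps)
    also have "\<dots> \<le> K * (\<bar>?h \<bullet> \<tau> w\<bar> + (norm ?h)\<^sup>2)" using K by (intro mult_right_mono) auto
    finally show "N w z \<le> K * (\<bar>?h \<bullet> \<tau> w\<bar> + (norm ?h)\<^sup>2)" .
  qed
  have qball_eq: "qball \<rho> \<kappa> x r = {z. \<rho> z = 0 \<and> sqrt (d z x) < r}" for x r
    by (simp add: qball_def qdist_def d_def bDom_def)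
  show thesis
    by (rule quasi_ball_system[of c K r1 \<tau> d N k, folded qball_eq])
      (use c_pos K r1 \<tau> lower d_N N_sym N_triangle N_box qball_borel that in \<open>simp_all add: bD\<close>)
qed

lemma hausdorff_measure_bDom_finite:
  "emeasure (hausdorff_measure (2 * CARD('n) - 1)) (bDom \<rho>) < \<infinity>"
proof -
  obtain M m where "C2_hypersurface \<rho> (grad \<rho>) M m" by (rule hypersurface_constants)
  then interpret C2_hypersurface \<rho> "grad \<rho>" M m .
  have "0 < CARD('n)" by simp
  then have "2 \<le> DIM(complex^'n)" by simp
  then show ?thesis
    using hausdorff_measure_surface_finite bounded_bDom by (simp add: bDom_def mult.commute)
qed

end

section \<open>\<open>A\<^sub>p\<close>-weights and the embedding\<close>

lemma epowr_ennreal_pos: "0 \<le> x \<Longrightarrow> 0 < a \<Longrightarrow> epowr (ennreal x) a = ennreal (x powr a)"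
  by (cases "x = 0") (auto simp: epowr_def)

lemma epowr_less_top_iff: "0 < a \<Longrightarrow> epowr x a < \<infinity> \<longleftrightarrow> x < \<infinity>"
  by (cases x) (auto simp: epowr_ennreal_pos, simp add: epowr_def)

lemma epowr_mono: "0 \<le> a \<Longrightarrow> x \<le> y \<Longrightarrow> epowr x a \<le> epowr y a"
  by (cases x; cases y) (auto simp: epowr_def powr_mono2 ennreal_leI top_unique)

text \<open>Young's inequality for \<open>u / U\<close> and \<open>v / V\<close>. When
  \<open>U\<close> and \<open>V\<close> are the integrals of \<open>u\<close> and \<open>v\<close>,
  integration turns the bracket into 1, which gives Hoelder's inequality with constant exactly
  1.\<close>

lemma weighted_Young_scaled:
  fixes u v U V \<theta> :: real
  assumes \<theta>: "0 < \<theta>" "\<theta> < 1" and uv: "0 < u" "0 < v" and UV: "0 < U" "0 < V"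
  shows "u powr \<theta> * v powr (1 - \<theta>) \<le>
    U powr \<theta> * V powr (1 - \<theta>) * (\<theta> * u / U + (1 - \<theta>) * v / V)"
proof -
  have "(u / U) powr \<theta> * (v / V) powr (1 - \<theta>) \<le> \<theta> * (u / U) + (1 - \<theta>) * (v / V)"
    using assms by (intro Youngs_inequality_0) auto
  then have "U powr \<theta> * V powr (1 - \<theta>) * ((u / U) powr \<theta> * (v / V) powr (1 - \<theta>)) \<le>
      U powr \<theta> * V powr (1 - \<theta>) * (\<theta> * (u / U) + (1 - \<theta>) * (v / V))"
    by (intro mult_left_mono) auto
  then show ?thesis using assms by (simp add: powr_divide)
qed

text \<open>Hoelder's inequality with exponents \<open>p / p0\<close> and \<open>p / (p - p0)\<close>, applied to
  \<open>f\<^sup>p\<^sup>0 = (f\<^sup>p \<psi>)\<^sup>\<theta> (\<psi>\<^sup>-\<^sup>s)\<^sup>1\<^sup>-\<^sup>\<theta>\<close> with \<open>\<theta> = p0 / p\<close> and \<open>s = p0 / (p - p0)\<close>.\<close>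

lemma nn_integral_epowr_le_weighted:
  fixes f :: "'a \<Rightarrow> ennreal" and \<psi> :: "'a \<Rightarrow> real"
  assumes p: "0 < p0" "p0 < p"
    and f [measurable]: "f \<in> borel_measurable M" and \<psi> [measurable]: "\<psi> \<in> borel_measurable M"
    and X: "(\<integral>\<^sup>+x. ennreal (\<psi> x) * epowr (f x) p \<partial>M) < \<infinity>" (is "?X < \<infinity>")
    and Z: "(\<integral>\<^sup>+x. epowr (ennreal (\<psi> x)) (- (p0 / (p - p0))) \<partial>M) < \<infinity>" (is "?Z < \<infinity>")
  shows "(\<integral>\<^sup>+x. epowr (f x) p0 \<partial>M) \<le> epowr ?X (p0 / p) * epowr ?Z ((p - p0) / p)"
proof -
  define \<theta> where "\<theta> = p0 / p"
  define s where "s = p0 / (p - p0)"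
  have \<theta>: "0 < \<theta>" "\<theta> < 1" "1 - \<theta> = (p - p0) / p" and s: "0 < s" and s\<theta>: "s * (1 - \<theta>) = \<theta>" and p\<theta>: "p * \<theta> = p0"
    using p by (auto simp: \<theta>_def s_def field_simps)
  have p_pos: "0 < p" using p by simp
  define h where "h = (\<lambda>x. ennreal (\<psi> x) * epowr (f x) p)"
  define g where "g = (\<lambda>x. epowr (ennreal (\<psi> x)) (- s))"
  have [measurable]: "h \<in> borel_measurable M" "g \<in> borel_measurable M"
    unfolding h_def g_def by measurable
  have hX: "?X = (\<integral>\<^sup>+x. h x \<partial>M)" and gZ: "?Z = (\<integral>\<^sup>+x. g x \<partial>M)" by (simp_all add: h_def g_def s_def)
  have ae: "AE x in M. h x \<noteq> \<infinity>" "AE x in M. g x \<noteq> \<infinity>"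
    using X Z unfolding hX gZ by (intro nn_integral_noteq_infinite; simp)+
  \<comment> \<open>\<open>epowr\<close> sends 0 to \<infinity> under a negative power, so a finite
    \<open>?Z\<close> forces \<psi> > 0 almost everywhere.\<close>
  have \<psi>_pos: "0 < \<psi> x" if "g x \<noteq> \<infinity>" for x
    using that s by (auto simp: g_def epowr_def ennreal_eq_0_iff not_le split: if_splits)
  have f_fin: "f x \<noteq> \<infinity>" if "h x \<noteq> \<infinity>" "g x \<noteq> \<infinity>" for x
    using that \<psi>_pos[OF that(2)] p_pos by (auto simp: h_def epowr_def ennreal_mult_eq_top_iff)
  show ?thesis
  proof (cases "?X = 0 \<or> ?Z = 0")
    \<comment> \<open>Normalising needs both integrals positive. If \<open>?X\<close> vanishes, so
      does \<open>f\<close> almost everywhere because \<psi> > 0 there; if \<open>?Z\<close>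
      vanishes, the measure itself is null.\<close>
    case True
    have "AE x in M. f x = 0"
    proof (cases "?X = 0")
      case True
      then have "AE x in M. h x = 0" unfolding hX by (simp add: nn_integral_0_iff_AE)
      with ae(2) show ?thesis
      proof eventually_elim
        case (elim x)
        then have "epowr (f x) p = 0" using \<psi>_pos[of x] by (simp add: h_def)
        then show ?case using p_pos by (cases "f x") (auto simp: epowr_ennreal_pos, simp add: epowr_def)
      qed
    next
      case False
      then have "AE x in M. g x = 0" using \<open>?X = 0 \<or> ?Z = 0\<close> unfolding gZ by (simp add: nn_integral_0_iff_AE)
      with ae(2) show ?thesis
      proof eventually_elim
        case (elim x)
        then show ?case using \<psi>_pos[of x] by (simp add: g_def epowr_ennreal)
      qed
    qed
    then have "(\<integral>\<^sup>+x. epowr (f x) p0 \<partial>M) = (\<integral>\<^sup>+x. 0 \<partial>M)"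
      using p by (intro nn_integral_cong_AE) (auto simp: epowr_def)
    then show ?thesis by simp
  next
    case False
    obtain U where U: "?X = ennreal U" "0 < U" using X False by (cases ?X) (auto simp: less_le)
    obtain V where V: "?Z = ennreal V" "0 < V" using Z False by (cases ?Z) (auto simp: less_le)
    define c where "c = U powr \<theta> * V powr (1 - \<theta>)"
    have c: "0 < c" using U V by (simp add: c_def)
    have "(\<integral>\<^sup>+x. epowr (f x) p0 \<partial>M) \<le>
        (\<integral>\<^sup>+x. ennreal (c * \<theta> / U) * h x + ennreal (c * (1 - \<theta>) / V) * g x \<partial>M)"
    proof (rule nn_integral_mono_AE)
      show "AE x in M. epowr (f x) p0 \<le> ennreal (c * \<theta> / U) * h x + ennreal (c * (1 - \<theta>) / V) * g x"
        using ae
      proof eventually_elim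
        case (elim x)
        have \<psi>x: "0 < \<psi> x" using \<psi>_pos elim by simp
        obtain y where y: "f x = ennreal y" "0 \<le> y" using f_fin[of x] elim by (cases "f x") auto
        show ?case
        proof (cases "y = 0")
          case True
          then show ?thesis using y p by (simp add: epowr_def)
        next
          case False
          then have y0: "0 < y" using y by simp
          have h: "h x = ennreal (\<psi> x * y powr p)"
            using y0 \<psi>x by (simp add: h_def y epowr_ennreal ennreal_mult)
          have g: "g x = ennreal (\<psi> x powr (- s))" using \<psi>x by (simp add: g_def epowr_ennreal)
          have "(\<psi> x * y powr p) powr \<theta> * (\<psi> x powr (- s)) powr (1 - \<theta>)
              = y powr (p * \<theta>) * (\<psi> x powr \<theta> * \<psi> x powr (- (s * (1 - \<theta>))))"
            using \<psi>x y0 by (simp add: powr_mult powr_powr)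
          also have "\<dots> = y powr p0"
            using \<psi>x by (simp add: s\<theta> p\<theta> powr_add[symmetric])
          finally have "y powr p0 \<le> c * (\<theta> * (\<psi> x * y powr p) / U + (1 - \<theta>) * \<psi> x powr (- s) / V)"
            using weighted_Young_scaled[OF \<theta>(1,2), of "\<psi> x * y powr p" "\<psi> x powr (- s)" U V] \<psi>x y0 U V
            by (simp add: c_def)
          also have "\<dots> = c * \<theta> / U * (\<psi> x * y powr p) + c * (1 - \<theta>) / V * \<psi> x powr (- s)"
            by (simp add: distrib_left)
          finally show ?thesis
            using y y0 c \<theta>(1,2) U(2) V(2) \<psi>x
            by (simp add: epowr_ennreal h g ennreal_mult[symmetric] ennreal_plus[symmetric] ennreal_leI
                del: ennreal_plus)
        qed
      qed
    qed
    also have "\<dots> = ennreal (c * \<theta> / U) * ?X + ennreal (c * (1 - \<theta>) / V) * ?Z"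
      unfolding hX gZ by (simp add: nn_integral_add nn_integral_cmult)
    also have "\<dots> = ennreal (c * \<theta> + c * (1 - \<theta>))"
      using c \<theta>(1,2) U V by (simp add: ennreal_mult[symmetric] ennreal_plus[symmetric] del: ennreal_plus)
    also have "c * \<theta> + c * (1 - \<theta>) = c" by (simp add: algebra_simps)
    also have "ennreal c = epowr ?X (p0 / p) * epowr ?Z ((p - p0) / p)"
      using U V \<theta> by (simp add: c_def epowr_ennreal ennreal_mult \<theta>(3)[symmetric] \<theta>_def[symmetric])
    finally show ?thesis .
  qed
qed

text \<open>Where the dual weight \<open>\<psi>\<^sup>1\<^sup>-\<^sup>p\<^sup>'\<close> is small compared with its average, \<open>\<psi>\<close> is large, which the
  \<open>A\<^sub>p\<close> inequality forbids on more than half of the ball.\<close>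

lemma Ap_inequality_imp_half_large:
  fixes \<psi> :: "'a \<Rightarrow> real"
  assumes p: "1 < p" and \<psi> [measurable]: "\<psi> \<in> borel_measurable M" and B [measurable]: "B \<in> sets M"
    and B_fin: "emeasure M B < \<infinity>"
    and w_def: "w = (\<lambda>x. epowr (ennreal (\<psi> x)) (1 - p / (p - 1)))"
    and w_fin: "(\<integral>\<^sup>+x\<in>B. w x \<partial>M) < \<infinity>"
    and A: "0 \<le> A" "average M B (\<lambda>x. ennreal (\<psi> x)) * epowr (average M B w) (p - 1) \<le> ennreal A"
    and c: "0 < c" "A * c powr (p - 1) \<le> 1 / 2"
  shows "emeasure M B \<le> 2 * emeasure M {y \<in> B. ennreal c * (\<integral>\<^sup>+z\<in>B. w z \<partial>M) \<le> w y * emeasure M B}"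
    (is "_ \<le> 2 * emeasure M ?X")
proof (cases "emeasure M B = 0 \<or> (\<integral>\<^sup>+z\<in>B. w z \<partial>M) = 0")
  case True
  then have "emeasure M B = 0 \<or> ?X = B" by auto
  then show ?thesis
  proof
    assume "?X = B"
    then show ?thesis by (simp add: mult_2 add_increasing)
  qed simp
next
  case False
  have [measurable]: "w \<in> borel_measurable M" unfolding w_def by measurable
  obtain v where v: "emeasure M B = ennreal v" "0 < v" using B_fin False by (cases "emeasure M B") (auto simp: less_le)
  obtain i where i: "(\<integral>\<^sup>+z\<in>B. w z \<partial>M) = ennreal i" "0 < i"
    using w_fin False by (cases "\<integral>\<^sup>+z\<in>B. w z \<partial>M") (auto simp: less_le)
  define Y where "Y = {y \<in> B. \<not> (ennreal c * (\<integral>\<^sup>+z\<in>B. w z \<partial>M) \<le> w y * emeasure M B)}"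
  have B_space: "B \<subseteq> space M" using B by (rule sets.sets_into_space)
  have "Y = B \<inter> {y \<in> space M. \<not> (ennreal c * (\<integral>\<^sup>+z\<in>B. w z \<partial>M) \<le> w y * emeasure M B)}"
    using B_space by (auto simp: Y_def)
  then have [measurable]: "Y \<in> sets M" by simp
  have "?X = B - Y" by (auto simp: Y_def)
  then have [measurable]: "?X \<in> sets M" by simp
  define a where "a = c * i / v"
  have a: "0 < a" using c i v by (simp add: a_def)
  \<comment> \<open>A lower bound for \<psi> on \<open>Y\<close>: there \<open>w\<close>, which is
    \<psi> to the power \<open>- (1 / (p - 1))\<close>, stays below \<open>a\<close>, that is, below
    \<open>c\<close> times its average over \<open>B\<close>.\<close>
  define h where "h = a powr (- (p - 1))"
  have h: "ennreal h \<le> ennreal (\<psi> y)" if y: "y \<in> Y" for y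
  proof -
    have "w y * ennreal v < ennreal (c * i)"
      using y c i v by (simp add: Y_def not_le ennreal_mult)
    moreover from this have "w y \<noteq> \<infinity>" using v by (auto simp: ennreal_top_mult)
    ultimately obtain t where t: "w y = ennreal t" "0 \<le> t" "t * v < c * i"
      using v by (cases "w y") (auto simp: ennreal_mult[symmetric] ennreal_less_iff)
    then have t_a: "t < a" using v by (simp add: a_def field_simps)
    have e: "1 - p / (p - 1) = - (1 / (p - 1))" using p by (simp add: field_simps)
    have "0 < \<psi> y"
    proof (rule ccontr)
      assume "\<not> 0 < \<psi> y"
      then have "w y = \<infinity>" using p by (simp add: w_def e epowr_def ennreal_neg)
      then show False using t by simp
    qed
    then have t_eq: "t = \<psi> y powr (- (1 / (p - 1)))"
      using t by (simp add: w_def e epowr_ennreal)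
    then have "0 < t" using \<open>0 < \<psi> y\<close> by simp
    have "1 / (p - 1) * (p - 1) = 1" using p by simp
    then have "- (1 / (p - 1)) * - (p - 1) = 1" by (simp only: minus_mult_minus)
    then have "\<psi> y = t powr (- (p - 1))"
      using \<open>0 < \<psi> y\<close> by (simp only: t_eq powr_powr powr_one)
    then have "h \<le> \<psi> y" using t_a \<open>0 < t\<close> p unfolding h_def by (simp add: powr_mono2')
    then show ?thesis by (rule ennreal_leI)
  qed
  have "emeasure M Y \<le> emeasure M B" by (intro emeasure_mono) (auto simp: Y_def)
  then obtain y where y: "emeasure M Y = ennreal y" "0 \<le> y" using v
    by (cases "emeasure M Y") (auto simp: top_unique)
  have "ennreal (h * y) = (\<integral>\<^sup>+x. ennreal h * indicator Y x \<partial>M)"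
    using y by (simp add: nn_integral_cmult_indicator ennreal_mult h_def)
  also have "\<dots> \<le> (\<integral>\<^sup>+x\<in>B. ennreal (\<psi> x) \<partial>M)"
    using h by (intro nn_integral_mono) (auto simp: indicator_def Y_def)
  finally have av: "ennreal (h * y / v) \<le> average M B (\<lambda>x. ennreal (\<psi> x))"
    using v y unfolding average_def
    by (metis divide_ennreal divide_right_mono_ennreal h_def mult_nonneg_nonneg powr_ge_zero)
  have ep: "epowr (average M B w) (p - 1) = ennreal ((i / v) powr (p - 1))"
    using i v by (simp add: average_def divide_ennreal epowr_ennreal)
  have "ennreal (h * y / v) * ennreal ((i / v) powr (p - 1)) \<le> ennreal A"
    by (rule order_trans[OF mult_right_mono[OF av] A(2)[unfolded ep]]) simp
  then have le_A: "h * y / v * (i / v) powr (p - 1) \<le> A"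
    using v y A(1) by (simp add: ennreal_mult[symmetric] h_def)
  have "h = 1 / (c powr (p - 1) * (i / v) powr (p - 1))"
  proof -
    have "a = c * (i / v)" by (simp add: a_def)
    then have "a powr (p - 1) = c powr (p - 1) * (i / v) powr (p - 1)"
      using c i v by (simp only: powr_mult)
    then show ?thesis by (simp only: h_def powr_minus_divide)
  qed
  \<comment> \<open>The average of \<open>w\<close> cancels; what remains is the proportion of
    \<open>Y\<close> in \<open>B\<close> divided by \<open>c powr (p - 1)\<close>.\<close>
  then have eq: "h * y / v * (i / v) powr (p - 1) = y / (v * c powr (p - 1))"
    using i v by simp
  have "y \<le> A * (v * c powr (p - 1))"
    using le_A[unfolded eq] v c by (simp add: pos_divide_le_eq)
  also have "\<dots> = A * c powr (p - 1) * v" by simp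
  also have "\<dots> \<le> 1 / 2 * v" using c v by (intro mult_right_mono) auto
  finally have y_le: "y \<le> v / 2" by simp
  have "emeasure M ?X \<le> emeasure M B" by (intro emeasure_mono) auto
  then obtain x where x: "emeasure M ?X = ennreal x" "0 \<le> x" using v
    by (cases "emeasure M ?X") (auto simp: top_unique)
  have "emeasure M B \<le> emeasure M (?X \<union> Y)" by (intro emeasure_mono) (auto simp: Y_def)
  also have "\<dots> \<le> emeasure M ?X + emeasure M Y" by (intro emeasure_subadditive) auto
  finally have "v \<le> x + y" using x y v by (simp add: ennreal_plus[symmetric] del: ennreal_plus)
  then have "v \<le> 2 * x" using y_le by simp
  then have "ennreal v \<le> ennreal (2 * x)" by (rule ennreal_leI)
  then show ?thesis using x v by (simp add: ennreal_mult)
qed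

section \<open>Reverse Hoelder inequality on doubling balls\<close>

context doubling_balls
begin

text \<open>Each \<open>B x 0\<close> engulfs the ball \<open>B y (Suc 0)\<close> of the finite
  cover that contains \<open>x\<close>. If that ball is null, doubling makes \<open>B y 0\<close>
  null, hence also \<open>B x (Suc 0)\<close> inside it and, by doubling again,
  \<open>B x 0\<close>.\<close>

lemma ball_measure_lower_bound:
  assumes T: "finite T" "T \<subseteq> space M" "space M \<subseteq> (\<Union>y\<in>T. B y (Suc 0))"
  obtains m where "0 < m" "\<And>x. x \<in> space M \<Longrightarrow>
    emeasure M (B x 0) = 0 \<or> ennreal m \<le> emeasure M (B x 0)"
proof -
  \<comment> \<open>The inserted 1 keeps the minimum meaningful when all balls of the cover are
    null.\<close>
  define m where "m = Min (insert 1 {r \<in> (\<lambda>y. measure M (B y (Suc 0))) ` T. 0 < r})"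
  have fin: "finite (insert 1 {r \<in> (\<lambda>y. measure M (B y (Suc 0))) ` T. 0 < r})" using T by simp
  have "m \<in> insert 1 {r \<in> (\<lambda>y. measure M (B y (Suc 0))) ` T. 0 < r}"
    unfolding m_def using fin by (intro Min_in) auto
  then have m_pos: "0 < m" by auto
  have em: "emeasure M X = ennreal (measure M X)" for X
    using finite_space emeasure_space[of M X] by (intro emeasure_eq_ennreal_measure) (auto simp: top_unique)
  show thesis
  proof (rule that[OF m_pos])
    fix x assume x: "x \<in> space M"
    then obtain y where y: "y \<in> T" "x \<in> B y (Suc 0)" using T by blast
    have ys: "y \<in> space M" using y T by blast
    have meet: "B x (Suc 0) \<inter> B y (Suc 0) \<noteq> {}" using y centre[OF x] by blast
    have sub: "B y (Suc 0) \<subseteq> B x 0" "B x (Suc 0) \<subseteq> B y 0"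
      using engulf[OF x ys order_refl meet] engulf[OF ys x order_refl] meet by (auto simp: Int_commute)
    show "emeasure M (B x 0) = 0 \<or> ennreal m \<le> emeasure M (B x 0)"
    proof (cases "emeasure M (B y (Suc 0)) = 0")
      case True
      have "emeasure M (B y 0) \<le> ennreal C * 0" using doubling[OF ys, of 0] True by simp
      then have "emeasure M (B x (Suc 0)) = 0"
        using emeasure_mono[OF sub(2) ball_sets[OF ys]] by (simp add: le_zero_eq[symmetric] del: le_zero_eq)
      then show ?thesis using doubling[OF x, of 0] by simp
    next
      case False
      then have "0 < measure M (B y (Suc 0))" by (simp add: em less_le)
      then have "m \<le> measure M (B y (Suc 0))" unfolding m_def using fin y(1) by (intro Min_le) auto
      then have "ennreal m \<le> emeasure M (B y (Suc 0))" by (simp add: em ennreal_leI)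
      also have "\<dots> \<le> emeasure M (B x 0)" using sub x by (intro emeasure_mono) auto
      finally show ?thesis by simp
    qed
  qed
qed

text \<open>The level ratio is \<open>b = c / (2 * C)\<close>; the assumption
  \<open>c \<le> C\<close> puts it below 1, as \<open>higher_integrability\<close> demands.\<close>

lemma reverse_Hoelder:
  fixes w :: "'a \<Rightarrow> ennreal"
  assumes w: "w \<in> borel_measurable M" "(\<integral>\<^sup>+x. w x \<partial>M) < \<infinity>"
    and c: "0 < c" "c \<le> C"
    and lower: "\<And>x j. x \<in> space M \<Longrightarrow> emeasure M (B x j) \<le>
        2 * emeasure M {y \<in> B x j. ennreal c * (\<integral>\<^sup>+z\<in>B x j. w z \<partial>M) \<le> w y * emeasure M (B x j)}"
    and T: "finite T" "T \<subseteq> space M" "space M \<subseteq> (\<Union>y\<in>T. B y (Suc 0))"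
  shows "\<exists>\<epsilon>>0. (\<integral>\<^sup>+x. epowr (w x) (1 + \<epsilon>) \<partial>M) < \<infinity>"
proof -
  obtain m where m: "0 < m" "\<And>x. x \<in> space M \<Longrightarrow>
      emeasure M (B x 0) = 0 \<or> ennreal m \<le> emeasure M (B x 0)"
    by (rule ball_measure_lower_bound[OF T]) blast
  obtain l0 where l0: "0 < l0" "\<And>l. l0 \<le> l \<Longrightarrow>
      (\<integral>\<^sup>+x\<in>{x \<in> space M. ennreal l < w x}. w x \<partial>M) \<le>
      ennreal l * emeasure M {x \<in> space M. ennreal (c / (2 * C) * l) < w x}"
    by (rule level_set_estimate[OF w c(1) lower m]) blast+
  show ?thesis
    by (rule higher_integrability[OF w _ _ l0]) (use c C_pos in auto)
qed

end

section \<open>Self-improvement of \<open>A\<^sub>p\<close> weights on the boundary\<close>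

context defining_function
begin

lemma space_\<sigma>: "space (\<sigma>_of \<rho>) = bDom \<rho>"
  by (simp add: surface_measure_def space_restrict_space)

lemma borel_imp_sets_\<sigma>:
  assumes "A \<in> sets borel" "A \<subseteq> bDom \<rho>"
  shows "A \<in> sets (\<sigma>_of \<rho>)"
    "emeasure (\<sigma>_of \<rho>) A = emeasure (hausdorff_measure (2 * CARD('n) - 1)) A"
proof -
  let ?R = "restrict_space (hausdorff_measure (2 * CARD('n) - 1)) (bDom \<rho>)"
  have A: "A \<in> sets ?R" using assms closed_bDom by (subst sets_restrict_space_iff) auto
  then show "A \<in> sets (\<sigma>_of \<rho>)" by (simp add: surface_measure_def)
  show "emeasure (\<sigma>_of \<rho>) A = emeasure (hausdorff_measure (2 * CARD('n) - 1)) A"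
    using A assms closed_bDom by (simp add: surface_measure_def main_part_sets emeasure_restrict_space)
qed

lemma \<sigma>_finite: "emeasure (\<sigma>_of \<rho>) (space (\<sigma>_of \<rho>)) < \<infinity>"
  using borel_imp_sets_\<sigma>(2)[of "bDom \<rho>"] closed_bDom hausdorff_measure_bDom_finite by (simp add: space_\<sigma>)

text \<open>A set of the completion is first enlarged by a Borel null set to a Borel set of the same
  measure. Outer regularity of finite Borel measures on the whole space then applies to
  \<open>D\<close>, the extension of the surface measure by zero.\<close>

lemma \<sigma>_outer_regular:
  assumes E: "E \<in> sets (\<sigma>_of \<rho>)" and e: "0 < e"
  shows "\<exists>U. open U \<and> E \<subseteq> U \<and> emeasure (\<sigma>_of \<rho>) (U \<inter> bDom \<rho>) \<le> emeasure (\<sigma>_of \<rho>) E + ennreal e"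
proof -
  let ?H = "hausdorff_measure (2 * CARD('n) - 1) :: (complex^'n) measure"
  let ?R = "restrict_space ?H (bDom \<rho>)"
  have bD [measurable]: "bDom \<rho> \<in> sets borel" using closed_bDom by simp
  obtain S N N' where S: "E = S \<union> N" "N \<subseteq> N'" "N' \<in> null_sets ?R" "S \<in> sets ?R"
    using E unfolding surface_measure_def by (rule sets_completionE)
  have SN: "S \<in> sets borel" "S \<subseteq> bDom \<rho>" "N' \<in> sets borel" "N' \<subseteq> bDom \<rho>"
    using S(3,4) by (auto simp: sets_restrict_space_iff null_sets_def)
  have "emeasure (\<sigma>_of \<rho>) N' = 0"
    using S(3) borel_imp_sets_\<sigma>(2)[OF SN(3,4)] SN by (simp add: null_sets_def emeasure_restrict_space)
  then have SN_le: "emeasure (\<sigma>_of \<rho>) (S \<union> N') \<le> emeasure (\<sigma>_of \<rho>) S"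
    using emeasure_subadditive[of S "\<sigma>_of \<rho>" N'] borel_imp_sets_\<sigma>(1) SN by simp
  define D where "D = density ?H (indicator (bDom \<rho>))"
  have D_eq: "emeasure D X = emeasure (\<sigma>_of \<rho>) (X \<inter> bDom \<rho>)" if "X \<in> sets borel" for X
  proof -
    have "emeasure D X = (\<integral>\<^sup>+x. indicator (bDom \<rho>) x * indicator X x \<partial>?H)"
      unfolding D_def using that bD by (intro emeasure_density borel_measurable_indicator) auto
    also have "\<dots> = (\<integral>\<^sup>+x. indicator (X \<inter> bDom \<rho>) x \<partial>?H)"
      by (intro nn_integral_cong) (simp split: split_indicator)
    also have "\<dots> = emeasure ?H (X \<inter> bDom \<rho>)" using that bD by (intro nn_integral_indicator) auto
    finally have "emeasure D X = emeasure ?H (X \<inter> bDom \<rho>)" .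
    then show ?thesis using that by (simp add: borel_imp_sets_\<sigma>(2))
  qed
  have sets_D: "sets D = sets borel" by (simp add: D_def)
  have D_fin: "emeasure D (space D) \<noteq> \<infinity>"
    using D_eq[of UNIV] \<sigma>_finite by (simp add: D_def space_\<sigma>)
  obtain r where "emeasure D (S \<union> N') = ennreal r" "0 \<le> r"
    using D_fin emeasure_space[of D "S \<union> N'"] by (cases "emeasure D (S \<union> N')") (auto simp: top_unique)
  then have "emeasure D (S \<union> N') < emeasure D (S \<union> N') + ennreal e"
    using e by (simp add: ennreal_plus[symmetric] ennreal_less_iff del: ennreal_plus)
  then have "(INF U\<in>{U. S \<union> N' \<subseteq> U \<and> open U}. emeasure D U) < emeasure D (S \<union> N') + ennreal e"
    using outer_regular[OF sets_D D_fin, of "S \<union> N'"] SN by simp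
  then obtain U where U: "S \<union> N' \<subseteq> U" "open U" "emeasure D U < emeasure D (S \<union> N') + ennreal e"
    by (auto simp: INF_less_iff)
  have "emeasure (\<sigma>_of \<rho>) (U \<inter> bDom \<rho>) \<le> emeasure (\<sigma>_of \<rho>) (S \<union> N') + ennreal e"
    using U D_eq[of U] D_eq[of "S \<union> N'"] SN by (simp add: Int_absorb2 less_imp_le)
  also have "\<dots> \<le> emeasure (\<sigma>_of \<rho>) E + ennreal e"
    using SN_le emeasure_mono[of S E "\<sigma>_of \<rho>"] E S(1) by (intro add_right_mono) (auto intro: order_trans)
  finally show ?thesis using U S(1,2) by (intro exI[of _ U]) auto
qed

lemma Ap_weight_self_improvement:
  assumes p: "1 < p" and Ap: "Ap_weight \<rho> \<kappa> p \<psi>"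
  shows "\<exists>\<epsilon>>0. (\<integral>\<^sup>+x. epowr (epowr (ennreal (\<psi> x)) (1 - p / (p - 1))) (1 + \<epsilon>) \<partial>(\<sigma>_of \<rho>)) < \<infinity>"
proof -
  let ?\<sigma> = "\<sigma>_of \<rho>"
  define w where "w = (\<lambda>x. epowr (ennreal (\<psi> x)) (1 - p / (p - 1)))"
  have \<psi> [measurable]: "\<psi> \<in> borel_measurable ?\<sigma>" using Ap by (simp add: Ap_weight_def)
  have [measurable]: "w \<in> borel_measurable ?\<sigma>" unfolding w_def by measurable
  obtain r0 q C where r0: "0 < r0" and q: "0 < q" "q < 1" and C: "0 < C"
    and engulf: "\<And>x y i j. x \<in> bDom \<rho> \<Longrightarrow> y \<in> bDom \<rho> \<Longrightarrow> i \<le> j \<Longrightarrow>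
        qball \<rho> \<kappa> x (r0 * q ^ Suc i) \<inter> qball \<rho> \<kappa> y (r0 * q ^ Suc j) \<noteq> {} \<Longrightarrow>
        qball \<rho> \<kappa> y (r0 * q ^ Suc j) \<subseteq> qball \<rho> \<kappa> x (r0 * q ^ i)"
    and doubling: "\<And>x j. x \<in> bDom \<rho> \<Longrightarrow>
        emeasure (hausdorff_measure (2 * CARD('n) - 1)) (qball \<rho> \<kappa> x (r0 * q ^ j)) \<le>
        ennreal C * emeasure (hausdorff_measure (2 * CARD('n) - 1)) (qball \<rho> \<kappa> x (r0 * q ^ Suc j))"
    using qball_system[of "2 * CARD('n) - 1"] by metis
  define B where "B = (\<lambda>x j. qball \<rho> \<kappa> x (r0 * q ^ j))"
  have radius: "0 < r0 * q ^ j" for j using r0 q by simp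
  have B_sets: "B x j \<in> sets ?\<sigma>"
    and B_meas: "emeasure ?\<sigma> (B x j) = emeasure (hausdorff_measure (2 * CARD('n) - 1)) (B x j)" for x j
    using borel_imp_sets_\<sigma>[of "B x j"] qball_borel by (auto simp: B_def qball_def)
  have B_fin: "emeasure ?\<sigma> (B x j) < \<infinity>" for x j
    using \<sigma>_finite emeasure_space[of ?\<sigma> "B x j"] by (rule le_less_trans[rotated])
  interpret doubling_balls ?\<sigma> B C
  proof
    show "emeasure ?\<sigma> (space ?\<sigma>) < \<infinity>" by (rule \<sigma>_finite)
    show "U \<inter> space ?\<sigma> \<in> sets ?\<sigma>" if "open U" for U
      using that closed_bDom unfolding space_\<sigma> by (intro borel_imp_sets_\<sigma>) auto
    show "\<exists>U. open U \<and> B x j = U \<inter> space ?\<sigma>" for x j unfolding B_def space_\<sigma> by (rule qball_open)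
    show "x \<in> B x j" if "x \<in> space ?\<sigma>" for x j
      using that radius unfolding B_def space_\<sigma> by (intro qball_centre)
    show "B y (Suc j) \<subseteq> B x i" if "x \<in> space ?\<sigma>" "y \<in> space ?\<sigma>" "i \<le> j" "B x (Suc i) \<inter> B y (Suc j) \<noteq> {}"
      for x y i j using that engulf unfolding B_def space_\<sigma> by blast
    show "emeasure ?\<sigma> (B x j) \<le> ennreal C * emeasure ?\<sigma> (B x (Suc j))" if "x \<in> space ?\<sigma>" for x j
      using that doubling unfolding B_meas unfolding B_def space_\<sigma> by blast
    show "0 < C" by (rule C)
    show "\<exists>j. B x (Suc j) \<subseteq> U" if "x \<in> space ?\<sigma>" "open U" "x \<in> U" for x U
      using that r0 q unfolding B_def space_\<sigma> by (intro qball_shrink)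
    show "\<exists>U. open U \<and> E \<subseteq> U \<and> emeasure ?\<sigma> (U \<inter> space ?\<sigma>) \<le> emeasure ?\<sigma> E + ennreal e"
      if "E \<in> sets ?\<sigma>" "0 < e" for E e using that unfolding space_\<sigma> by (rule \<sigma>_outer_regular)
  qed
  have avg_fin: "average ?\<sigma> (B x j) w < \<infinity>" if "x \<in> bDom \<rho>" for x j
    using Ap that radius[of j] unfolding Ap_weight_def w_def B_def by blast
  \<comment> \<open>In \<open>ennreal\<close> an infinite integral over an infinite measure would
    have average 0; \<open>B_fin\<close> excludes this.\<close>
  have w_ball: "(\<integral>\<^sup>+z\<in>B x j. w z \<partial>?\<sigma>) < \<infinity>" if "x \<in> bDom \<rho>" for x j
  proof (rule ccontr)
    assume "\<not> ?thesis"
    then have "average ?\<sigma> (B x j) w = \<infinity> / emeasure ?\<sigma> (B x j)" by (simp add: average_def less_top[symmetric])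
    then show False using avg_fin[OF that, of j] B_fin[of x j] by (simp add: ennreal_top_divide split: if_splits)
  qed
  obtain T where T: "finite T" "T \<subseteq> bDom \<rho>" "bDom \<rho> \<subseteq> (\<Union>y\<in>T. B y (Suc 0))"
  proof -
    have "\<forall>x\<in>bDom \<rho>. \<exists>U. open U \<and> B x (Suc 0) = U \<inter> bDom \<rho>" unfolding B_def using qball_open by blast
    then obtain U where U: "\<And>x. x \<in> bDom \<rho> \<Longrightarrow> open (U x) \<and> B x (Suc 0) = U x \<inter> bDom \<rho>" by metis
    then have "bDom \<rho> \<subseteq> (\<Union>x\<in>bDom \<rho>. U x)" using centre[unfolded space_\<sigma>] by blast
    then obtain T where "T \<subseteq> bDom \<rho>" "finite T" "bDom \<rho> \<subseteq> (\<Union>x\<in>T. U x)"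
      using compactE_image[OF compact_bDom, of "bDom \<rho>" U] U by metis
    moreover from this have "bDom \<rho> \<subseteq> (\<Union>y\<in>T. B y (Suc 0))" using U by blast
    ultimately show thesis using that by blast
  qed
  have "(\<integral>\<^sup>+x. w x \<partial>?\<sigma>) \<le> (\<integral>\<^sup>+x. (\<Sum>y\<in>T. w x * indicator (B y (Suc 0)) x) \<partial>?\<sigma>)"
  proof (rule nn_integral_mono)
    fix x assume "x \<in> space ?\<sigma>"
    then obtain y where y: "y \<in> T" "x \<in> B y (Suc 0)" using T by (auto simp: space_\<sigma>)
    then have "w x = w x * indicator (B y (Suc 0)) x" by simp
    also have "\<dots> \<le> (\<Sum>y\<in>T. w x * indicator (B y (Suc 0)) x)" using y T by (intro member_le_sum) auto
    finally show "w x \<le> (\<Sum>y\<in>T. w x * indicator (B y (Suc 0)) x)" .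
  qed
  also have "\<dots> = (\<Sum>y\<in>T. \<integral>\<^sup>+x\<in>B y (Suc 0). w x \<partial>?\<sigma>)"
    using B_sets by (intro nn_integral_sum) auto
  also have "\<dots> < \<infinity>" using w_ball T by (auto simp: ennreal_sum_less_top)
  finally have w_fin: "(\<integral>\<^sup>+x. w x \<partial>?\<sigma>) < \<infinity>" .
  have "Ap_char \<rho> \<kappa> p \<psi> < \<infinity>" using Ap by (simp add: Ap_weight_def)
  then obtain A where A: "Ap_char \<rho> \<kappa> p \<psi> = ennreal A" "0 \<le> A" by (cases "Ap_char \<rho> \<kappa> p \<psi>") auto
  have ball_Ap: "average ?\<sigma> (B x j) (\<lambda>x. ennreal (\<psi> x)) * epowr (average ?\<sigma> (B x j) w) (p - 1) \<le> ennreal A"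
    if "x \<in> bDom \<rho>" for x j
    unfolding A(1)[symmetric] Ap_char_def w_def B_def
    using that radius[of j] by (intro SUP_upper2[of "(x, r0 * q ^ j)"]) auto
  \<comment> \<open>The power makes \<open>A * c powr (p - 1) \<le> 1 / 2\<close>, with
    \<open>A + 1\<close> in place of \<open>A\<close> in case \<open>A = 0\<close>; the minimum with
    \<open>C\<close> is for \<open>reverse_Hoelder\<close>.\<close>
  define c where "c = min C ((1 / (2 * (A + 1))) powr (1 / (p - 1)))"
  have c: "0 < c" "c \<le> C" using C A by (auto simp: c_def)
  have "c powr (p - 1) \<le> ((1 / (2 * (A + 1))) powr (1 / (p - 1))) powr (p - 1)"
    using c p by (intro powr_mono2) (auto simp: c_def)
  also have "\<dots> = 1 / (2 * (A + 1))" using p A by (simp add: powr_powr)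
  finally have "A * c powr (p - 1) \<le> A * (1 / (2 * (A + 1)))" using A by (intro mult_left_mono) auto
  also have "\<dots> \<le> 1 / 2" using A by (simp add: field_simps)
  finally have Ac: "A * c powr (p - 1) \<le> 1 / 2" .
  have half: "emeasure ?\<sigma> (B x j) \<le>
        2 * emeasure ?\<sigma> {y \<in> B x j. ennreal c * (\<integral>\<^sup>+z\<in>B x j. w z \<partial>?\<sigma>) \<le> w y * emeasure ?\<sigma> (B x j)}"
    if "x \<in> space ?\<sigma>" for x j
  proof -
    have x: "x \<in> bDom \<rho>" using that by (simp add: space_\<sigma>)
    show ?thesis
      by (rule Ap_inequality_imp_half_large[OF p \<psi> B_sets B_fin w_def w_ball[OF x] A(2) ball_Ap[OF x] c(1) Ac])
  qed
  have "T \<subseteq> space ?\<sigma>" "space ?\<sigma> \<subseteq> (\<Union>y\<in>T. B y (Suc 0))" using T by (simp_all add: space_\<sigma>)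
  note reverse_Hoelder[OF _ w_fin c half T(1) this]
  then show ?thesis unfolding w_def by simp
qed

end

text \<open>For \<open>x \<le> 0\<close> both sides are \<infinity>, since \<open>ennreal\<close>
  cuts negative values off at 0 and \<open>a * b\<close> is still negative.\<close>

lemma epowr_epowr_neg:
  assumes "a < 0" "0 < b"
  shows "epowr (epowr (ennreal x) a) b = epowr (ennreal x) (a * b)"
proof (cases "0 < x")
  case True
  then show ?thesis using assms by (simp add: epowr_ennreal powr_powr)
next
  case False
  then show ?thesis using assms by (simp add: epowr_def ennreal_neg mult_neg_pos)
qed

lemma epowr_product_root:
  assumes "X < \<infinity>" "Y < \<infinity>" "0 < a" "0 < b" "0 < c"
  shows "epowr (epowr X a * epowr Y b) c = epowr Y (b * c) * epowr X (a * c)"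
proof -
  obtain x y where "X = ennreal x" "0 \<le> x" "Y = ennreal y" "0 \<le> y"
    using assms by (cases X; cases Y) auto
  then show ?thesis
    using assms by (simp add: epowr_ennreal_pos ennreal_mult[symmetric] powr_mult powr_powr mult.commute)
qed

theorem mainTheorem4:
  fixes \<rho> :: "complex^'n::finite \<Rightarrow> real"
    and \<kappa> :: "complex^'n \<Rightarrow> complex^'n \<Rightarrow> real"
    and \<mu> \<alpha> p :: real
    and \<Omega> :: "(complex^'n) measure"
    and \<psi> :: "complex^'n \<Rightarrow> real"
  assumes "CARD('n) \<ge> 2"
    and "Ck 2 \<rho>"
    and "strictly_plurisubharmonic \<rho>"
    and "\<forall>w\<in>bDom \<rho>. grad \<rho> w \<noteq> 0"
    and "Dom \<rho> \<noteq> {}" and "connected (Dom \<rho>)" and "bounded (Dom \<rho>)"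
    and "\<mu> > 0"
    and "cutoff \<mu> \<kappa>"
    and "\<exists>c>0. \<forall>w\<in>bDom \<rho>. \<forall>z\<in>closure (Dom \<rho>).
           Re (g0 \<rho> \<kappa> w z) \<ge> c * (- \<rho> z + (norm (w - z))\<^sup>2)"
    and "\<alpha> > 0"
    and "1 < p"
    and "Ap_measure_with_density \<rho> \<kappa> p \<Omega> \<psi>"
  shows "\<exists>p0\<in>{1<..<p}.
           embedding_const \<rho> p p0 \<psi> < \<infinity> \<and>
           hardy_space \<rho> \<alpha> p \<Omega> \<subseteq> hardy_space \<rho> \<alpha> p0 (\<sigma>_of \<rho>) \<and>
           (\<forall>F\<in>hardy_space \<rho> \<alpha> p \<Omega>.
              hardy_norm \<rho> \<alpha> p0 (\<sigma>_of \<rho>) F \<le> embedding_const \<rho> p p0 \<psi> * hardy_norm \<rho> \<alpha> p \<Omega> F)"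
proof -
  let ?\<sigma> = "\<sigma>_of \<rho>"
  have p: "1 < p" by fact
  obtain c where c: "c > 0" "\<forall>w\<in>bDom \<rho>. \<forall>z\<in>closure (Dom \<rho>).
      Re (g0 \<rho> \<kappa> w z) \<ge> c * (- \<rho> z + (norm (w - z))\<^sup>2)"
    using assms(10) by blast
  interpret defining_function \<rho> \<kappa> \<mu> c
    using assms c by unfold_locales auto
  have Ap: "Ap_weight \<rho> \<kappa> p \<psi>" and \<Omega>: "\<Omega> = density ?\<sigma> (\<lambda>x. ennreal (\<psi> x))"
    using assms(13) by (auto simp: Ap_measure_with_density_def)
  have \<psi> [measurable]: "\<psi> \<in> borel_measurable ?\<sigma>" using Ap by (simp add: Ap_weight_def)
  obtain \<epsilon> where \<epsilon>: "0 < \<epsilon>"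
    "(\<integral>\<^sup>+x. epowr (epowr (ennreal (\<psi> x)) (1 - p / (p - 1))) (1 + \<epsilon>) \<partial>?\<sigma>) < \<infinity>"
    using Ap_weight_self_improvement[OF p Ap] by blast
  \<comment> \<open>chosen so that \<open>p0 / (p - p0) = (1 + \<epsilon>) / (p - 1)\<close>\<close>
  define p0 where "p0 = (1 + \<epsilon>) * p / (p + \<epsilon>)"
  have p0: "1 < p0" "p0 < p"
    using p \<epsilon>(1) by (auto simp: p0_def field_simps)
  have "p - p0 = p * (p - 1) / (p + \<epsilon>)" using p \<epsilon>(1) by (simp add: p0_def field_simps)
  then have "p0 / (p - p0) = (1 + \<epsilon>) / (p - 1)" using p \<epsilon>(1) by (simp add: p0_def)
  then have expo: "(1 - p / (p - 1)) * (1 + \<epsilon>) = - (p0 / (p - p0))" and neg: "1 - p / (p - 1) < 0"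
    using p by (simp_all add: field_simps)
  define Z where "Z = (\<integral>\<^sup>+x. epowr (ennreal (\<psi> x)) (- (p0 / (p - p0))) \<partial>?\<sigma>)"
  \<comment> \<open>By \<open>expo\<close> the integrand is the power \<open>1 + \<epsilon>\<close>
    of the dual weight; this finiteness is also that of the embedding constant.\<close>
  have Z: "Z < \<infinity>" using \<epsilon> neg by (simp add: Z_def epowr_epowr_neg expo)
  have const: "embedding_const \<rho> p p0 \<psi> = epowr Z ((p - p0) / (p * p0))"
    by (simp add: embedding_const_def Z_def)
  have e_pos: "0 < (p - p0) / (p * p0)" using p p0 by simp
  have main: "F \<in> hardy_space \<rho> \<alpha> p0 ?\<sigma> \<and>
      hardy_norm \<rho> \<alpha> p0 ?\<sigma> F \<le> embedding_const \<rho> p p0 \<psi> * hardy_norm \<rho> \<alpha> p \<Omega> F"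
    if F: "F \<in> hardy_space \<rho> \<alpha> p \<Omega>" for F
  proof -
    let ?N = "nontangential_max \<rho> \<alpha> F"
    have N [measurable]: "?N \<in> borel_measurable ?\<sigma>"
      using F by (simp add: hardy_space_def \<Omega>)
    define X where "X = (\<integral>\<^sup>+x. ennreal (\<psi> x) * epowr (?N x) p \<partial>?\<sigma>)"
    have norm_X: "hardy_norm \<rho> \<alpha> p \<Omega> F = epowr X (1 / p)"
      by (simp add: hardy_norm_def Lp_norm_def \<Omega> nn_integral_density X_def)
    have X: "X < \<infinity>"
      using F p by (simp add: hardy_space_def norm_X epowr_less_top_iff[of "1 / p", simplified])
    have "(\<integral>\<^sup>+x. epowr (?N x) p0 \<partial>?\<sigma>) \<le> epowr X (p0 / p) * epowr Z ((p - p0) / p)"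
      unfolding X_def Z_def using p0 X Z by (intro nn_integral_epowr_le_weighted) (auto simp: X_def Z_def)
    then have "hardy_norm \<rho> \<alpha> p0 ?\<sigma> F \<le> epowr (epowr X (p0 / p) * epowr Z ((p - p0) / p)) (1 / p0)"
      unfolding hardy_norm_def Lp_norm_def using p0 by (intro epowr_mono) auto
    also have "\<dots> = epowr Z ((p - p0) / p * (1 / p0)) * epowr X (p0 / p * (1 / p0))"
      using X Z p p0 by (intro epowr_product_root) auto
    also have "\<dots> = embedding_const \<rho> p p0 \<psi> * hardy_norm \<rho> \<alpha> p \<Omega> F"
      using p0 by (simp add: const norm_X)
    finally have le: "hardy_norm \<rho> \<alpha> p0 ?\<sigma> F \<le> embedding_const \<rho> p p0 \<psi> * hardy_norm \<rho> \<alpha> p \<Omega> F" .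
    have "hardy_norm \<rho> \<alpha> p \<Omega> F < \<infinity>" using F by (simp add: hardy_space_def)
    then have "embedding_const \<rho> p p0 \<psi> * hardy_norm \<rho> \<alpha> p \<Omega> F < \<infinity>"
      using Z e_pos epowr_less_top_iff[OF e_pos, of Z] by (simp add: const ennreal_mult_less_top)
    with le have "hardy_norm \<rho> \<alpha> p0 ?\<sigma> F < \<infinity>" by (rule le_less_trans)
    then show ?thesis using le F N by (simp add: hardy_space_def)
  qed
  show ?thesis
  proof (intro bexI[of _ p0] conjI ballI subsetI)
    show "embedding_const \<rho> p p0 \<psi> < \<infinity>" using Z e_pos by (simp only: const epowr_less_top_iff)
  qed (use main p0 in auto)
qed

end
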